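(* Let $K$ be a compact subset of $\mathbb{R}^d$. Then a typical measure $\mu\in\mathcal{P}(K)$ satisfies: for every $\alpha\in[0,\dim_{\mathcal H}(K))$, $\dim_{\mathcal H}\big(E_-(\mu;\alpha)\big)=\alpha$. Moreover, writing $s=\dim_{\mathcal H}(K)$, if $\mathcal{H}^{s}(K)>0$, then a typical measure $\mu\in\mathcal{P}(K)$ satisfies $\dim_{\mathcal H}\big(E_-(\mu;\alpha)\big)=\alpha$ for every $\alpha\in[0,s]$ (that is, also for $\alpha=s$).
   Context: $\mathcal{P}(K)$ is the set of Borel probability measures on $K$, endowed with the weak topology (which is completely metrizable). A property is true for a typical measure of $\mathcal{P}(K)$ if it is satisfied by all elements of a dense $G_\delta$ subset of $\mathcal{P}(K)$. For $\mu\in\mathcal{P}(K)$ and $x\in K$, with $B(x,r)$ the ball of center $x$ and radius $r$, the lower local dimension is $\underline{\dim}_{\rm loc}(\mu;x)=\liminf_{r\to 0}\frac{\log\mu(B(x,r))}{\log r}$ (with $\log 0=-\infty$, so it is $+\infty$ off the support of $\mu$), and $E_-(\mu;\alpha)=\{x\in K:\ \underline{\dim}_{\rm loc}(\mu;x)=\alpha\}$. $\mathcal{H}^s$ is $s$-dimensional Hausdorff measure and $\dim_{\mathcal H}(E)=\inf\{s\ge 0:\mathcal{H}^s(E)=0\}$ is Hausdorff dimension. *)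

theory Defs
  imports "HOL-Probability.Probability"
begin

section \<open>Hausdorff measure and dimension\<close>

text \<open>The convention is \<open>diam(U)\<^sup>0 = 1\<close> for every nonempty \<open>U\<close>, so that \<open>\<H>\<^sup>0\<close> is
  counting measure; this is the reason for the case distinction, as \<open>0 powr 0 = 0\<close> in HOL.\<close>

definition diam_pow :: "real \<Rightarrow> 'a::metric_space set \<Rightarrow> ennreal" where
  "diam_pow s U =
    (if U = {} then 0 else if s = 0 then 1 else ennreal (diameter U powr s))"

text \<open>Since \<^const>\<open>diameter\<close> has no meaningful value on unbounded sets, boundedness is
  required explicitly. Finite covers are included, as the sets \<open>U i\<close> may be empty.\<close>

definition hausdorff_premeasure :: "real \<Rightarrow> real \<Rightarrow> 'a::metric_space set \<Rightarrow> ennreal" where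
  "hausdorff_premeasure s \<delta> E =
    (INF U \<in> {U :: nat \<Rightarrow> 'a set. E \<subseteq> (\<Union>i. U i) \<and> (\<forall>i. bounded (U i) \<and> diameter (U i) \<le> \<delta>)}.
       \<Sum>i. diam_pow s (U i))"

definition hausdorff_measure :: "real \<Rightarrow> 'a::metric_space set \<Rightarrow> ennreal" where
  "hausdorff_measure s E = (SUP \<delta> \<in> {0<..}. hausdorff_premeasure s \<delta> E)"

definition hausdorff_dim :: "'a::metric_space set \<Rightarrow> ereal" where
  "hausdorff_dim E = (INF s \<in> {s. 0 \<le> s \<and> hausdorff_measure s E = 0}. ereal s)"

section \<open>Borel probability measures with the weak topology\<close>

definition borel_prob_measures :: "'a::topological_space set \<Rightarrow> 'a measure set" where
  "borel_prob_measures K = {\<mu>. sets \<mu> = sets (restrict_space borel K) \<and> prob_space \<mu>}"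

text \<open>The coarsest topology on \<^term>\<open>borel_prob_measures K\<close> for which \<open>\<mu> \<mapsto> \<integral>f d\<mu>\<close> is continuous
  for every bounded continuous \<open>f\<close> on \<open>K\<close>. Its \<^const>\<open>topspace\<close> is the whole of
  \<^term>\<open>borel_prob_measures K\<close> (take \<^term>\<open>V = UNIV\<close>).\<close>

definition weak_topology :: "'a::topological_space set \<Rightarrow> 'a measure topology" where
  "weak_topology K = topology_generated_by
    {{\<mu> \<in> borel_prob_measures K. (\<integral>x. f x \<partial>\<mu>) \<in> V} |(f :: 'a \<Rightarrow> real) V.
       continuous_on K f \<and> bounded (f ` K) \<and> open V}"

definition typical_in :: "'b topology \<Rightarrow> ('b \<Rightarrow> bool) \<Rightarrow> bool" where
  "typical_in X P \<longleftrightarrow>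
    (\<exists>G. gdelta_in X G \<and> X closure_of G = topspace X \<and> (\<forall>\<mu>\<in>G. P \<mu>))"

section \<open>Lower local dimension\<close>

definition log_ext :: "real \<Rightarrow> ereal" where
  "log_ext t = (if t = 0 then -\<infinity> else ereal (ln t))"

text \<open>The measure \<open>\<mu>\<close> lives on \<open>K\<close>, so that balls are taken in the metric space \<open>K\<close>,
  which is \<^term>\<open>space \<mu>\<close>. For \<open>0 < r < 1\<close> the quotient is \<open>+\<infinity>\<close> if the ball is null.\<close>

definition lower_local_dim :: "'a::metric_space measure \<Rightarrow> 'a \<Rightarrow> ereal" where
  "lower_local_dim \<mu> x =
    Liminf (at_right 0) (\<lambda>r. log_ext (measure \<mu> (ball x r \<inter> space \<mu>)) / ereal (ln r))"

definition lower_level_set :: "'a::metric_space set \<Rightarrow> 'a measure \<Rightarrow> real \<Rightarrow> 'a set" where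
  "lower_level_set K \<mu> \<alpha> = {x \<in> K. lower_local_dim \<mu> x = ereal \<alpha>}"

end

theory Submission
  imports Defs "HOL-Library.Sublist"
begin

text \<open>Write \<open>dim(\<mu>; x)\<close> for the lower local dimension. For every measure \<open>\<mu>\<close>, a Vitali covering
  shows that \<open>{x. dim(\<mu>; x) < \<alpha>}\<close> is \<open>\<H>\<^sup>\<alpha>\<close>-null.
  It therefore suffices that a typical \<open>\<mu>\<close> satisfies \<open>\<H>\<^sup>\<alpha>({x. dim(\<mu>; x) \<le> \<alpha>}) > 0\<close> for all \<open>\<alpha>\<close>.

  If a set \<open>E\<close> has arbitrarily fine finite covers by balls \<open>B(x\<^sub>i, r\<^sub>i)\<close> with \<open>\<Sum> r\<^sub>i\<^sup>\<beta> \<le> 1\<close>, then adding a small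
  multiple of \<open>\<Sum> r\<^sub>i\<^sup>\<beta> \<delta>\<close> (with \<open>\<delta>\<close> the unit mass at \<open>x\<^sub>i\<close>) to any measure makes these balls so heavy that
  typically \<open>dim(\<mu>; x) \<le> \<beta>\<close> on all of \<open>E\<close>; this settles \<open>\<alpha> = s\<close> with \<open>E = K\<close>. For \<open>\<alpha> < t < s\<close> one applies
  it to a countable family of subsets of \<open>K\<close> that are nested according to their dimensions, which run
  through the dyadic multiples of \<open>t\<close>, and whose Hausdorff contents have a common lower bound: the
  intersection of the members of dimension greater than \<open>\<alpha>\<close> then still has positive \<open>\<H>\<^sup>\<alpha>\<close>-measure. The members
  come from a Besicovitch-type theorem: in the tree of dyadic cubes, a minimal subtree of
  \<open>\<beta>\<close>-dimensional content at least \<open>c\<close> has dimension at most \<open>\<beta>\<close>.\<close>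

section \<open>Cuts of trees\<close>

text \<open>The obstacle is that \<alpha> takes uncountably many values, while a typical property
  absorbs only countably many weakly open conditions. The sets on which the lower local dimension is
  forced down must therefore be countable in number and fixed before \<alpha> is known, and for a
  given \<alpha> a whole sequence of them is intersected. Hausdorff measure need not survive this;
  content does, because finitely many open balls covering a decreasing intersection of compact sets
  already cover one of these sets. Moreover all cubes have side at most 1, so a lower bound
  \<open>c\<close> for the content at exponent \<open>t\<close> holds at every smaller exponent, and
  one \<open>c\<close> serves the whole family. Trees make this finitary: covers become finite cuts,
  whose cost is submodular, and this is what makes minimal heavy trees thin. Members need covers
  only at exponents above their own, since bounds on local dimension pass to limits.\<close>

definition is_tree :: "'b list set \<Rightarrow> bool" where
  "is_tree T \<longleftrightarrow> (\<forall>w\<in>T. \<forall>u. prefix u w \<longrightarrow> u \<in> T) \<and> (\<forall>l. finite {w\<in>T. length w = l})"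

text \<open>Only the words of one level have to be met, so branches that die out earlier are
  ignored. For a finitely branching tree this amounts, by Koenig's lemma, to meeting every infinite
  branch.\<close>

definition cuts :: "'b list set \<Rightarrow> 'b list set \<Rightarrow> bool" where
  "cuts C T \<longleftrightarrow> (\<exists>l. \<forall>w\<in>T. length w = l \<longrightarrow> (\<exists>u\<in>C. prefix u w))"

definition cost :: "real \<Rightarrow> 'b list set \<Rightarrow> real" where
  "cost \<beta> C = (\<Sum>u\<in>C. 2 powr (- \<beta> * length u))"

text \<open>With a word of length \<open>k\<close> standing for a dyadic cube of side \<open>2\<^sup>-\<^sup>k\<close>, a \<open>heavy\<close> tree has \<open>\<beta>\<close>-dimensional
  dyadic Hausdorff content at least \<open>c\<close>, and a \<open>thin\<close> tree has Hausdorff dimension at most \<open>\<beta>\<close>.\<close>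

definition heavy :: "real \<Rightarrow> real \<Rightarrow> 'b list set \<Rightarrow> bool" where
  "heavy \<beta> c T \<longleftrightarrow> (\<forall>C. finite C \<longrightarrow> cuts C T \<longrightarrow> c \<le> cost \<beta> C)"

definition thin :: "real \<Rightarrow> 'b list set \<Rightarrow> bool" where
  "thin \<beta> T \<longleftrightarrow> (\<forall>\<gamma>>\<beta>. \<forall>\<epsilon>>0. \<exists>C. finite C \<and> cuts C T \<and> cost \<gamma> C \<le> \<epsilon>)"

section \<open>Elementary properties of trees, cuts and costs\<close>

lemma is_tree_take: "is_tree T \<Longrightarrow> w \<in> T \<Longrightarrow> take n w \<in> T"
  unfolding is_tree_def using take_is_prefix by blast

lemma cutsE:
  assumes "is_tree T" "cuts C T"
  obtains l where "\<And>w. w \<in> T \<Longrightarrow> l \<le> length w \<Longrightarrow> \<exists>u\<in>C. prefix u w"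
proof -
  obtain l where l: "\<And>w. w \<in> T \<Longrightarrow> length w = l \<Longrightarrow> \<exists>u\<in>C. prefix u w"
    using assms(2) unfolding cuts_def by blast
  have "\<exists>u\<in>C. prefix u w" if "w \<in> T" "l \<le> length w" for w
    using l[of "take l w"] is_tree_take[OF assms(1) that(1), of l] that(2)
    by (metis length_take min.absorb2 prefix_order.trans take_is_prefix)
  then show ?thesis using that by blast
qed

lemma cutsI: "(\<And>w. w \<in> T \<Longrightarrow> l \<le> length w \<Longrightarrow> \<exists>u\<in>C. prefix u w) \<Longrightarrow> cuts C T"
  unfolding cuts_def by (metis order_refl)

lemma cuts_mono: "cuts C T \<Longrightarrow> C \<subseteq> C' \<Longrightarrow> T' \<subseteq> T \<Longrightarrow> cuts C' T'"
  unfolding cuts_def by (meson subset_iff)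

lemma cuts_Un:
  assumes "is_tree T" "is_tree T'" "cuts C T" "cuts C' T'"
  shows "cuts (C \<union> C') (T \<union> T')"
proof -
  obtain l where l: "\<And>w. w \<in> T \<Longrightarrow> l \<le> length w \<Longrightarrow> \<exists>u\<in>C. prefix u w"
    using cutsE[OF assms(1,3)] by blast
  obtain l' where l': "\<And>w. w \<in> T' \<Longrightarrow> l' \<le> length w \<Longrightarrow> \<exists>u\<in>C'. prefix u w"
    using cutsE[OF assms(2,4)] by blast
  show ?thesis
    by (rule cutsI[of _ "max l l'"]) (use l l' in fastforce)
qed

lemma is_tree_subset_remove:
  assumes "is_tree T" shows "is_tree {w\<in>T. \<not> prefix v w}"
proof -
  have "finite {w \<in> {w \<in> T. \<not> prefix v w}. length w = l}" for l
    by (rule finite_subset[of _ "{w\<in>T. length w = l}"]) (use assms in \<open>auto simp: is_tree_def\<close>)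
  then show ?thesis
    using assms unfolding is_tree_def by (auto dest: prefix_order.trans)
qed

lemma is_tree_Un:
  assumes "is_tree T" "is_tree T'" shows "is_tree (T \<union> T')"
proof -
  have "{w \<in> T \<union> T'. length w = l} = {w\<in>T. length w = l} \<union> {w\<in>T'. length w = l}" for l by auto
  then show ?thesis using assms unfolding is_tree_def by auto
qed

lemma is_tree_INT:
  assumes "\<And>n. is_tree (T n)" shows "is_tree (\<Inter>n::nat. T n)"
proof -
  have "finite {w \<in> (\<Inter>n. T n). length w = l}" for l
    by (rule finite_subset[of _ "{w\<in>T 0. length w = l}"]) (use assms[of 0] in \<open>auto simp: is_tree_def\<close>)
  moreover have "u \<in> T n" if "w \<in> (\<Inter>n. T n)" "prefix u w" for u w n
    using assms[of n] that unfolding is_tree_def by blast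
  ultimately show ?thesis unfolding is_tree_def by blast
qed

lemma countable_tree:
  assumes "is_tree T" shows "countable T"
proof -
  have "T = (\<Union>l. {w\<in>T. length w = l})" by auto
  then show ?thesis
    using assms countable_UN[of UNIV "\<lambda>l. {w\<in>T. length w = l}"] unfolding is_tree_def
    by (simp add: countable_finite)
qed

lemma cost_nonneg: "0 \<le> cost \<beta> C"
  unfolding cost_def by (simp add: sum_nonneg)

lemma cost_Un_le: "finite C \<Longrightarrow> finite D \<Longrightarrow> cost \<beta> (C \<union> D) \<le> cost \<beta> C + cost \<beta> D"
  unfolding cost_def by (subst sum.union_inter[symmetric]) (auto intro: sum_nonneg)

lemma cost_UN_le:
  assumes "finite Y" "\<And>p. p \<in> Y \<Longrightarrow> finite (A p)"
  shows "cost \<beta> (\<Union>p\<in>Y. A p) \<le> (\<Sum>p\<in>Y. cost \<beta> (A p))"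
  using assms
proof (induction Y rule: finite_induct)
  case (insert p Y)
  have "cost \<beta> (A p \<union> (\<Union>p\<in>Y. A p)) \<le> cost \<beta> (A p) + cost \<beta> (\<Union>p\<in>Y. A p)"
    using insert by (intro cost_Un_le) auto
  then show ?case using insert by simp
qed (simp add: cost_def)

lemma cost_member: "finite C \<Longrightarrow> u \<in> C \<Longrightarrow> 2 powr (- \<beta> * real (length u)) \<le> cost \<beta> C"
  unfolding cost_def by (rule member_le_sum) auto

lemma cost_antimono: "\<beta> \<le> \<gamma> \<Longrightarrow> cost \<gamma> C \<le> cost \<beta> C"
  unfolding cost_def by (intro sum_mono powr_mono) (auto intro: mult_right_mono)

text \<open>Word lengths are nonnegative, so no cost drops when the exponent falls. This lets one
  constant \<open>c\<close> serve all exponents below the initial one.\<close>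

lemma heavy_antimono: "heavy \<gamma> c T \<Longrightarrow> \<beta> \<le> \<gamma> \<Longrightarrow> heavy \<beta> c T"
  unfolding heavy_def using cost_antimono order_trans by blast

lemma heavy_subset: "heavy \<beta> c T \<Longrightarrow> T \<subseteq> T' \<Longrightarrow> heavy \<beta> c T'"
  unfolding heavy_def using cuts_mono by blast

text \<open>Each level of a tree is finite, so that the levels of a decreasing sequence stabilise.\<close>

lemma heavy_INT:
  assumes tree: "\<And>n. is_tree (T n)" and dec: "\<And>n. T (Suc n) \<subseteq> T n"
    and heavy: "\<And>n. heavy (b n) c (T n)" and lim: "b \<longlonglongrightarrow> \<beta>"
  shows "heavy \<beta> c (\<Inter>n. T n)"
  unfolding heavy_def
proof (intro allI impI)
  fix C :: "'a list set" assume C: "finite C" "cuts C (\<Inter>n. T n)"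
  have mono: "T n \<subseteq> T m" if "m \<le> n" for m n
    using lift_Suc_antimono_le[of T, OF dec that] .
  obtain l where l: "\<And>w. w \<in> (\<Inter>n. T n) \<Longrightarrow> length w = l \<Longrightarrow> \<exists>u\<in>C. prefix u w"
    using C(2) unfolding cuts_def by blast
  define A where "A = {w\<in>T 0. length w = l} - (\<Inter>n. T n)"
  have "finite A" using tree[of 0] unfolding A_def is_tree_def by auto
  have "\<forall>w\<in>A. \<exists>n. w \<notin> T n" unfolding A_def by blast
  then obtain N where N: "\<And>w. w \<in> A \<Longrightarrow> w \<notin> T (N w)" by metis
  obtain n0 where n0: "\<And>w. w \<in> A \<Longrightarrow> N w \<le> n0"
    using \<open>finite A\<close> by (metis finite_imageI finite_nat_set_iff_bounded_le imageI)
  have "cuts C (T n)" if "n \<ge> n0" for n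
    unfolding cuts_def
  proof (intro exI[of _ l] ballI impI)
    fix w assume w: "w \<in> T n" "length w = l"
    have "w \<notin> A"
      using N[of w] n0[of w] mono[of "N w" n] w that by (meson le_trans subsetD)
    then have "w \<in> (\<Inter>n. T n)"
      using w mono[of 0 n] by (auto simp: A_def)
    then show "\<exists>u\<in>C. prefix u w" using l w by blast
  qed
  then have "c \<le> cost (b n) C" if "n \<ge> n0" for n
    using heavy[of n] C(1) that unfolding heavy_def by blast
  \<comment> \<open>\<open>C\<close> is a fixed finite set by now, so its cost is continuous in the
    exponent.\<close>
  moreover have "(\<lambda>n. cost (b n) C) \<longlonglongrightarrow> cost \<beta> C"
    unfolding cost_def by (intro tendsto_intros lim) auto
  ultimately show "c \<le> cost \<beta> C"
    by (meson LIMSEQ_le_const)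
qed

text \<open>Countability replaces Zorn's lemma: each word of an enumeration is visited, and the
  branches through it are deleted if the rest stays heavy. A refusal is final, because all later
  trees are smaller.\<close>

lemma minimal_heavy_subtree:
  fixes T :: "'a list set"
  assumes "is_tree T" "heavy \<beta> c T"
  obtains S where "S \<subseteq> T" "is_tree S" "heavy \<beta> c S"
    "\<And>v. v \<in> S \<Longrightarrow> \<not> heavy \<beta> c {w\<in>S. \<not> prefix v w}"
proof (cases "T = {}")
  case True
  then show ?thesis using assms that[of T] by simp
next
  case False
  define e where "e = from_nat_into T"
  have e: "T \<subseteq> range e"
    unfolding e_def using False countable_tree[OF assms(1)] by (simp add: range_from_nat_into)
  define step where "step = (\<lambda>v (S :: 'a list set). if heavy \<beta> c {w\<in>S. \<not> prefix v w} then {w\<in>S. \<not> prefix v w} else S)"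
  define R where "R = rec_nat T (\<lambda>n. step (e n))"
  have R0: "R 0 = T" and RS: "R (Suc n) = step (e n) (R n)" for n by (simp_all add: R_def)
  have R: "is_tree (R n) \<and> heavy \<beta> c (R n)" for n
    by (induction n) (use assms in \<open>auto simp: R0 RS step_def is_tree_subset_remove\<close>)
  have dec: "R (Suc n) \<subseteq> R n" for n by (auto simp: RS step_def)
  show ?thesis
  proof (rule that[of "\<Inter>n. R n"])
    show "(\<Inter>n. R n) \<subseteq> T" using R0 by blast
    show "is_tree (\<Inter>n. R n)" using R by (intro is_tree_INT) auto
    show "heavy \<beta> c (\<Inter>n. R n)"
      using heavy_INT[of R "\<lambda>_. \<beta>"] R dec by auto
    fix v assume v: "v \<in> (\<Inter>n. R n)"
    then obtain n where n: "v = e n" using e R0 by blast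
    have "v \<in> R (Suc n)" using v by blast
    then have "\<not> heavy \<beta> c {w\<in>R n. \<not> prefix v w}"
      unfolding RS n step_def by (auto split: if_splits)
    then show "\<not> heavy \<beta> c {w\<in>\<Inter>n. R n. \<not> prefix v w}"
      using heavy_subset[of \<beta> c "{w\<in>\<Inter>n. R n. \<not> prefix v w}" "{w\<in>R n. \<not> prefix v w}"] by auto
  qed
qed

text \<open>On a branch with one node of each cut, \<open>finer_cut\<close> keeps the longer and
  \<open>coarser_cut\<close> the shorter. The prefix is weak in the former and strict in the latter,
  so that a word kept by both belongs to both cuts.\<close>

definition finer_cut :: "'b list set \<Rightarrow> 'b list set \<Rightarrow> 'b list set" where
  "finer_cut A B = {u\<in>A. \<exists>v\<in>B. prefix v u} \<union> {u\<in>B. \<exists>v\<in>A. prefix v u}"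

definition coarser_cut :: "'b list set \<Rightarrow> 'b list set \<Rightarrow> 'b list set" where
  "coarser_cut A B = {u\<in>A. \<not> (\<exists>v\<in>B. strict_prefix v u)} \<union> {u\<in>B. \<not> (\<exists>v\<in>A. strict_prefix v u)}"

text \<open>Submodularity: words counted twice on the left lie in \<open>A \<inter> B\<close>, where
  they are counted twice on the right as well.\<close>

lemma cost_finer_coarser:
  assumes "finite A" "finite B"
  shows "cost \<beta> (finer_cut A B) + cost \<beta> (coarser_cut A B) \<le> cost \<beta> A + cost \<beta> B"
proof -
  let ?w = "\<lambda>u::'a list. 2 powr (- \<beta> * length u)"
  have fin: "finite (finer_cut A B)" "finite (coarser_cut A B)"
    using assms by (auto simp: finer_cut_def coarser_cut_def)
  have union: "finer_cut A B \<union> coarser_cut A B \<subseteq> A \<union> B"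
    by (auto simp: finer_cut_def coarser_cut_def)
  have inter: "finer_cut A B \<inter> coarser_cut A B \<subseteq> A \<inter> B"
    by (auto simp: finer_cut_def coarser_cut_def strict_prefix_def)
  have "cost \<beta> (finer_cut A B) + cost \<beta> (coarser_cut A B)
    = sum ?w (finer_cut A B \<union> coarser_cut A B) + sum ?w (finer_cut A B \<inter> coarser_cut A B)"
    unfolding cost_def by (rule sum.union_inter[OF fin, symmetric])
  also have "\<dots> \<le> sum ?w (A \<union> B) + sum ?w (A \<inter> B)"
    using assms union inter by (intro add_mono sum_mono2) auto
  also have "\<dots> = cost \<beta> A + cost \<beta> B"
    unfolding cost_def by (rule sum.union_inter[OF assms])
  finally show ?thesis .
qed

lemma cuts_finer_coarser:
  assumes "is_tree T" "cuts A T" "cuts B T"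
  shows "cuts (finer_cut A B) T" "cuts (coarser_cut A B) T"
proof -
  obtain l where l: "\<And>w. w \<in> T \<Longrightarrow> l \<le> length w \<Longrightarrow> \<exists>u\<in>A. prefix u w"
    using cutsE[OF assms(1,2)] by blast
  obtain l' where l': "\<And>w. w \<in> T \<Longrightarrow> l' \<le> length w \<Longrightarrow> \<exists>u\<in>B. prefix u w"
    using cutsE[OF assms(1,3)] by blast
  show "cuts (finer_cut A B) T"
  proof (rule cutsI[of _ "max l l'"])
    fix w assume "w \<in> T" "max l l' \<le> length w"
    then obtain a b where ab: "a \<in> A" "prefix a w" "b \<in> B" "prefix b w"
      using l l' by (metis max.bounded_iff)
    then have "prefix a b \<or> prefix b a" using prefix_same_cases by blast
    then show "\<exists>u\<in>finer_cut A B. prefix u w"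
      using ab unfolding finer_cut_def by blast
  qed
  show "cuts (coarser_cut A B) T"
  proof (rule cutsI[of _ l])
    fix w assume w: "w \<in> T" "l \<le> length w"
    define P where "P = (\<lambda>u. u \<in> A \<union> B \<and> prefix u w)"
    obtain a where "P a" using l[OF w] unfolding P_def by blast
    then obtain u where u: "P u" "\<And>v. P v \<Longrightarrow> length u \<le> length v"
      using ex_has_least_nat[of P a length] by blast
    have "\<not> strict_prefix v u" if "v \<in> A \<union> B" for v
      using u that unfolding P_def
      by (metis not_le prefix_length_less prefix_order.less_imp_le prefix_order.trans)
    then show "\<exists>u\<in>coarser_cut A B. prefix u w"
      using u(1) unfolding coarser_cut_def P_def by blast
  qed
qed

text \<open>The coarser of two cuts still costs at least \<open>c\<close>; hence refining one cut of cost almost \<open>c\<close> by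
  another keeps the cost almost \<open>c\<close>.\<close>

lemma common_refinement_cut:
  fixes c \<epsilon> :: real
  assumes T: "is_tree T" "heavy \<beta> c T" and "finite I" "I \<noteq> {}"
    and D: "\<And>i. i \<in> I \<Longrightarrow> finite (D i) \<and> cuts (D i) T \<and> cost \<beta> (D i) \<le> c + \<epsilon>"
  shows "\<exists>C. finite C \<and> cuts C T \<and> cost \<beta> C \<le> c + card I * \<epsilon> \<and> (\<forall>i\<in>I. \<forall>u\<in>C. \<exists>v\<in>D i. prefix v u)"
  using assms(3,4) D
proof (induction I rule: finite_ne_induct)
  case (singleton i)
  then show ?case by (intro exI[of _ "D i"]) auto
next
  case (insert i I)
  then obtain C where C: "finite C" "cuts C T" "cost \<beta> C \<le> c + card I * \<epsilon>"
    "\<And>i u. i \<in> I \<Longrightarrow> u \<in> C \<Longrightarrow> \<exists>v\<in>D i. prefix v u" by (metis insertCI)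
  have Di: "finite (D i)" "cuts (D i) T" "cost \<beta> (D i) \<le> c + \<epsilon>" using insert.prems by auto
  have "c \<le> cost \<beta> (coarser_cut (D i) C)"
    using T cuts_finer_coarser(2)[OF T(1) Di(2) C(2)] C(1) Di(1)
    unfolding heavy_def by (simp add: coarser_cut_def)
  then have "cost \<beta> (finer_cut (D i) C) \<le> c + \<epsilon> + card I * \<epsilon>"
    using cost_finer_coarser[OF Di(1) C(1), of \<beta>] C(3) Di(3) by linarith
  moreover have "real (card (insert i I)) = 1 + card I" using insert by simp
  ultimately have "cost \<beta> (finer_cut (D i) C) \<le> c + card (insert i I) * \<epsilon>"
    by (simp add: algebra_simps)
  moreover have "\<exists>v\<in>D j. prefix v u" if "j \<in> insert i I" "u \<in> finer_cut (D i) C" for j u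
    using that C(4) unfolding finer_cut_def
    by (auto dest: prefix_order.trans intro: prefix_order.refl) (meson prefix_order.trans)+
  moreover have "finite (finer_cut (D i) C)" using Di(1) C(1) by (simp add: finer_cut_def)
  ultimately show ?case
    using cuts_finer_coarser(1)[OF T(1) Di(2) C(2)] by blast
qed

text \<open>Let \<open>S\<close> be a minimal heavy subtree. Deleting the branches through a node \<open>q\<close> leaves a tree with a
  cut of cost below \<open>c\<close>; together with \<open>q\<close> itself this is a cut of \<open>S\<close> that contains no proper
  prefix of \<open>q\<close>. The common refinement of such cuts, with one node \<open>q\<close> of great depth above each
  node of level \<open>N\<close>, has cost at most \<open>c + 1\<close> and only members of length greater than \<open>N\<close>.\<close>

lemma minimal_heavy_deep_cut:
  fixes S :: "'a list set"
  assumes S: "is_tree S" "heavy \<beta> c S" and \<beta>: "0 < \<beta>" and c: "0 \<le> c"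
    and min: "\<And>v. v \<in> S \<Longrightarrow> \<not> heavy \<beta> c {w\<in>S. \<not> prefix v w}"
  shows "\<exists>C. finite C \<and> cuts C S \<and> (\<forall>u\<in>C. N < length u) \<and> cost \<beta> C \<le> c + 1"
proof -
  define F where "F = {w\<in>S. length w = N}"
  have "finite F" using S(1) unfolding F_def is_tree_def by blast
  \<comment> \<open>\<open>L\<close> is so deep that one node of length \<open>L\<close> for each
    node of level \<open>N\<close> costs less than 1 in total; this is the excess over
    \<open>c\<close> in the conclusion.\<close>
  have "(\<lambda>L. card F * (2 powr (-\<beta>)) ^ L) \<longlonglongrightarrow> real (card F) * 0"
    using \<beta> by (intro tendsto_mult tendsto_const LIMSEQ_realpow_zero) (auto simp: powr_less_one)
  then have "\<forall>\<^sub>F L in sequentially. card F * (2 powr (-\<beta>)) ^ L < 1"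
    by (intro order_tendstoD) auto
  then obtain L where L: "N < L" "card F * (2 powr (-\<beta>)) ^ L < 1"
    using eventually_happens[OF eventually_conj[OF eventually_gt_at_top[of N]]] by auto
  define \<epsilon> where "\<epsilon> = 2 powr (-\<beta> * real L)"
  have "\<epsilon> = (2 powr (-\<beta>)) ^ L"
    unfolding \<epsilon>_def powr_powr[symmetric] by (rule powr_realpow) simp
  then have eps: "0 < \<epsilon>" "card F * \<epsilon> < 1"
    using L(2) by (auto simp: \<epsilon>_def)
  \<comment> \<open>Nodes of level \<open>N\<close> without descendants at level \<open>L\<close>
    lie on dead ends, which cuts may ignore.\<close>
  define I where "I = {r\<in>F. \<exists>q\<in>S. length q = L \<and> prefix r q}"
  have "\<forall>r\<in>I. \<exists>q. q \<in> S \<and> length q = L \<and> prefix r q" by (auto simp: I_def)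
  then obtain q where q: "\<And>r. r \<in> I \<Longrightarrow> q r \<in> S \<and> length (q r) = L \<and> prefix r (q r)"
    unfolding bchoice_iff by blast
  have "finite I" "card I \<le> card F"
    using \<open>finite F\<close> unfolding I_def by (auto intro: card_mono)
  have "\<forall>r\<in>I. \<exists>D. finite D \<and> cuts D {w\<in>S. \<not> prefix (q r) w} \<and> cost \<beta> D < c"
    using min q unfolding heavy_def by (simp add: not_le)
  then obtain D where D: "\<And>r. r \<in> I \<Longrightarrow> finite (D r) \<and> cuts (D r) {w\<in>S. \<not> prefix (q r) w} \<and> cost \<beta> (D r) < c"
    unfolding bchoice_iff by blast
  have cuts_D: "cuts (insert (q r) (D r)) S" if "r \<in> I" for r
    using D[OF that] unfolding cuts_def by blast
  have cost_D: "cost \<beta> (insert (q r) (D r)) \<le> c + \<epsilon>" if "r \<in> I" for r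
  proof -
    have "cost \<beta> (insert (q r) (D r)) \<le> cost \<beta> {q r} + cost \<beta> (D r)"
      using cost_Un_le[of "{q r}" "D r" \<beta>] D[OF that] by simp
    also have "cost \<beta> {q r} = \<epsilon>" using q[OF that] by (simp add: cost_def \<epsilon>_def)
    finally show ?thesis using D[OF that] by linarith
  qed
  \<comment> \<open>Otherwise \<open>D r\<close> would also meet the branches through
    \<open>q r\<close>, and so cut all of \<open>S\<close> at a cost below \<open>c\<close>.\<close>
  have no_prefix: "\<not> prefix v (q r)" if r: "r \<in> I" and v: "v \<in> D r" for r v
  proof
    assume pre: "prefix v (q r)"
    obtain l where l: "\<And>w. w \<in> {w\<in>S. \<not> prefix (q r) w} \<Longrightarrow> l \<le> length w \<Longrightarrow> \<exists>u\<in>D r. prefix u w"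
      using cutsE[OF is_tree_subset_remove[OF S(1), of "q r"], of "D r"] D[OF r] by blast
    have "cuts (D r) S"
    proof (rule cutsI[of _ l])
      fix w assume "w \<in> S" "l \<le> length w"
      then show "\<exists>u\<in>D r. prefix u w"
        using l[of w] pre v prefix_order.trans by (cases "prefix (q r) w") blast+
    qed
    then show False using S(2) D[OF r] unfolding heavy_def by (meson not_le)
  qed
  have deep: "take N w \<in> I" if w: "w \<in> S" "L \<le> length w" for w
  proof -
    have "prefix (take N (take L w)) (take L w)" by (rule take_is_prefix)
    then have "prefix (take N w) (take L w)" using L(1) by simp
    then show ?thesis
      unfolding I_def F_def using w L(1) is_tree_take[OF S(1) w(1)]
      by (auto intro!: bexI[of _ "take L w"])
  qed
  show ?thesis
  proof (cases "I = {}")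
    case True
    have "cuts {} S"
    proof (rule cutsI[of _ L])
      fix w assume w: "w \<in> S" "L \<le> length w"
      then show "\<exists>u\<in>{}. prefix u w" using deep[OF w] True by blast
    qed
    then show ?thesis using c by (intro exI[of _ "{}"]) (auto simp: cost_def)
  next
    case False
    have "finite (insert (q r) (D r)) \<and> cuts (insert (q r) (D r)) S \<and> cost \<beta> (insert (q r) (D r)) \<le> c + \<epsilon>"
      if "r \<in> I" for r
      using D[OF that] cuts_D[OF that] cost_D[OF that] by simp
    then have "\<exists>C. finite C \<and> cuts C S \<and> cost \<beta> C \<le> c + card I * \<epsilon>
      \<and> (\<forall>r\<in>I. \<forall>u\<in>C. \<exists>v\<in>insert (q r) (D r). prefix v u)"
      by (rule common_refinement_cut[OF S \<open>finite I\<close> False])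
    then obtain C where C: "finite C" "cuts C S" "cost \<beta> C \<le> c + card I * \<epsilon>"
      and C_prefix: "\<forall>r\<in>I. \<forall>u\<in>C. \<exists>v\<in>insert (q r) (D r). prefix v u"
      by (elim exE conjE)
    obtain l where l: "\<And>w. w \<in> S \<Longrightarrow> l \<le> length w \<Longrightarrow> \<exists>u\<in>C. prefix u w"
      using cutsE[OF S(1) C(2)] by blast
    define C' where "C' = {u\<in>C. N < length u}"
    have "cuts C' S"
    proof (rule cutsI[of _ "max l L"])
      fix w assume w: "w \<in> S" "max l L \<le> length w"
      then obtain u where u: "u \<in> C" "prefix u w" using l by fastforce
      define r where "r = take N w"
      have r: "r \<in> I" "prefix r w"
        using deep[OF w(1)] w(2) unfolding r_def by (auto simp: take_is_prefix)
      have "length r = N" using r(1) unfolding I_def F_def by simp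
      \<comment> \<open>A short \<open>u\<close> would be a prefix of \<open>r\<close>, hence of
        \<open>q r\<close>. Its prefix \<open>v\<close> in the cut for \<open>r\<close> is too short
        to be \<open>q r\<close>, so it lies in \<open>D r\<close>, against
        \<open>no_prefix\<close>.\<close>
      have "N < length u"
      proof (rule ccontr)
        assume "\<not> N < length u"
        then have "prefix u r"
          using u(2) r(2) \<open>length r = N\<close> by (metis not_le prefix_length_prefix not_less)
        then have pre: "prefix u (q r)" using q[OF r(1)] prefix_order.trans by blast
        obtain v where v: "v \<in> insert (q r) (D r)" "prefix v u" using C_prefix r(1) u(1) by blast
        have "v \<noteq> q r"
          using v(2) q[OF r(1)] L(1) \<open>\<not> N < length u\<close> prefix_length_le by fastforce
        then show False using no_prefix[OF r(1)] v pre prefix_order.trans by blast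
      qed
      then show "\<exists>u\<in>C'. prefix u w" using u unfolding C'_def by blast
    qed
    moreover have "cost \<beta> C' \<le> cost \<beta> C"
      unfolding cost_def C'_def using C(1) by (intro sum_mono2) auto
    moreover have "card I * \<epsilon> \<le> 1"
    proof -
      have "card I * \<epsilon> \<le> card F * \<epsilon>"
        using \<open>card I \<le> card F\<close> eps(1) by (intro mult_right_mono) auto
      then show ?thesis using eps(2) by linarith
    qed
    ultimately show ?thesis
      using C(1,3) by (intro exI[of _ C']) (auto simp: C'_def)
  qed
qed

text \<open>Raising the exponent from \<open>\<beta>\<close> to \<open>\<gamma>\<close> multiplies
  the cost of a word longer than \<open>N\<close> by at most
  \<open>2 powr ((\<beta> - \<gamma>) * N)\<close>, which beats the fixed bound \<open>c + 1\<close>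
  as \<open>N\<close> grows.\<close>

lemma minimal_heavy_thin:
  fixes S :: "'a list set"
  assumes S: "is_tree S" "heavy \<beta> c S" and \<beta>: "0 < \<beta>" and c: "0 \<le> c"
    and min: "\<And>v. v \<in> S \<Longrightarrow> \<not> heavy \<beta> c {w\<in>S. \<not> prefix v w}"
  shows "thin \<beta> S"
  unfolding thin_def
proof (intro allI impI)
  fix \<gamma> \<epsilon> :: real assume \<gamma>: "\<beta> < \<gamma>" and \<epsilon>: "0 < \<epsilon>"
  have "(\<lambda>N. (2 powr (\<beta> - \<gamma>)) ^ N * (c + 1)) \<longlonglongrightarrow> 0 * (c + 1)"
    using \<gamma> by (intro tendsto_mult tendsto_const LIMSEQ_realpow_zero) (auto simp: powr_less_one)
  then have "\<forall>\<^sub>F N in sequentially. (2 powr (\<beta> - \<gamma>)) ^ N * (c + 1) < \<epsilon>"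
    using \<epsilon> by (intro order_tendstoD) auto
  then obtain N where N: "(2 powr (\<beta> - \<gamma>)) ^ N * (c + 1) < \<epsilon>"
    by (metis (lifting) eventually_sequentially order_refl)
  obtain C where C: "finite C" "cuts C S" "\<And>u. u \<in> C \<Longrightarrow> N < length u" "cost \<beta> C \<le> c + 1"
    using minimal_heavy_deep_cut[OF S \<beta> c min, where N = N] by blast
  have "cost \<gamma> C \<le> (\<Sum>u\<in>C. (2 powr (\<beta> - \<gamma>)) ^ N * 2 powr (- \<beta> * real (length u)))"
    unfolding cost_def
  proof (rule sum_mono)
    fix u assume "u \<in> C"
    then have "(\<beta> - \<gamma>) * real (length u) \<le> (\<beta> - \<gamma>) * real N"
      using C(3) \<gamma> by (intro mult_left_mono_neg) (auto intro: less_imp_le)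
    then have "- \<gamma> * real (length u) \<le> (\<beta> - \<gamma>) * real N + - \<beta> * real (length u)"
      by (simp add: algebra_simps)
    then have "2 powr (- \<gamma> * real (length u)) \<le> 2 powr ((\<beta> - \<gamma>) * real N + - \<beta> * real (length u))"
      by (intro powr_mono) auto
    also have "\<dots> = (2 powr (\<beta> - \<gamma>)) powr real N * 2 powr (- \<beta> * real (length u))"
      by (simp only: powr_add powr_powr)
    also have "\<dots> = (2 powr (\<beta> - \<gamma>)) ^ N * 2 powr (- \<beta> * real (length u))"
      by (subst powr_realpow) simp_all
    finally show "2 powr (- \<gamma> * real (length u)) \<le> (2 powr (\<beta> - \<gamma>)) ^ N * 2 powr (- \<beta> * real (length u))" .
  qed
  also have "\<dots> = (2 powr (\<beta> - \<gamma>)) ^ N * cost \<beta> C"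
    by (simp add: cost_def sum_distrib_left)
  also have "\<dots> \<le> (2 powr (\<beta> - \<gamma>)) ^ N * (c + 1)"
    using C(4) by (intro mult_left_mono) auto
  finally show "\<exists>C. finite C \<and> cuts C S \<and> cost \<gamma> C \<le> \<epsilon>"
    using C(1,2) N by (intro exI[of _ C]) auto
qed

text \<open>Tree version of Besicovitch's theorem that a set of large dimension has subsets of
  smaller dimensions.\<close>

lemma thin_heavy_subtree:
  assumes "is_tree T" "heavy \<beta> c T" "0 < \<beta>" "0 \<le> c"
  shows "\<exists>S. S \<subseteq> T \<and> is_tree S \<and> heavy \<beta> c S \<and> thin \<beta> S"
  using minimal_heavy_subtree[OF assms(1,2)] minimal_heavy_thin[OF _ _ assms(3,4)] by metis

section \<open>Chains of thin heavy trees indexed by dyadic exponents\<close>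

lemma thin_mono: "thin \<beta> T \<Longrightarrow> \<beta> \<le> \<gamma> \<Longrightarrow> thin \<gamma> T"
  unfolding thin_def by fastforce

lemma thin_Un:
  assumes "is_tree S" "is_tree T" "thin \<beta> S" "thin \<beta> T"
  shows "thin \<beta> (S \<union> T)"
  unfolding thin_def
proof (intro allI impI)
  fix \<gamma> \<epsilon> :: real assume *: "\<beta> < \<gamma>" "0 < \<epsilon>"
  obtain C where C: "finite C" "cuts C S" "cost \<gamma> C \<le> \<epsilon> / 2"
    using assms(3) * unfolding thin_def by (meson half_gt_zero)
  obtain D where D: "finite D" "cuts D T" "cost \<gamma> D \<le> \<epsilon> / 2"
    using assms(4) * unfolding thin_def by (meson half_gt_zero)
  show "\<exists>C. finite C \<and> cuts C (S \<union> T) \<and> cost \<gamma> C \<le> \<epsilon>"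
    using C D cuts_Un[OF assms(1,2) C(2) D(2)] cost_Un_le[OF C(1) D(1), of \<gamma>]
    by (intro exI[of _ "C \<union> D"]) auto
qed

text \<open>Starting from the trees \<open>{}\<close> and \<open>T\<close> for the exponents \<open>0\<close> and \<open>t\<close>, a thin heavy tree is
  interpolated at each dyadic fraction \<open>i t / 2\<^sup>n\<close> between its two neighbours.\<close>

primrec dyadic_trees :: "(real \<Rightarrow> 'b list set \<Rightarrow> 'b list set) \<Rightarrow> real \<Rightarrow> 'b list set \<Rightarrow> nat \<Rightarrow> nat \<Rightarrow> 'b list set" where
  "dyadic_trees \<Phi> t T 0 i = (if i = 0 then {} else T)"
| "dyadic_trees \<Phi> t T (Suc n) j =
    (if even j then dyadic_trees \<Phi> t T n (j div 2)
     else dyadic_trees \<Phi> t T n (j div 2)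
       \<union> \<Phi> (real j * t / 2 ^ Suc n) (dyadic_trees \<Phi> t T n (Suc (j div 2))))"

text \<open>The union with the lower neighbour makes the chain increase. It stays thin because that
  neighbour is thin at a smaller exponent, and heavy because the new part is. At the ends, the tree
  of index 0 is empty, so heaviness is claimed for \<open>0 < i\<close>, and that of index
  \<open>2^n\<close> is \<open>T\<close>, so thinness is claimed for \<open>i < 2^n\<close>.\<close>

lemma dyadic_trees_properties:
  assumes T: "is_tree T" "heavy t c T" and "0 < t"
    and \<Phi>: "\<And>\<beta> S. 0 < \<beta> \<Longrightarrow> is_tree S \<Longrightarrow> heavy \<beta> c S \<Longrightarrow>
      \<Phi> \<beta> S \<subseteq> S \<and> is_tree (\<Phi> \<beta> S) \<and> heavy \<beta> c (\<Phi> \<beta> S) \<and> thin \<beta> (\<Phi> \<beta> S)"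
  shows "(\<forall>i\<le>2^n. is_tree (dyadic_trees \<Phi> t T n i) \<and> dyadic_trees \<Phi> t T n i \<subseteq> T
      \<and> (0 < i \<longrightarrow> heavy (i * t / 2^n) c (dyadic_trees \<Phi> t T n i)))
    \<and> (\<forall>i<2^n. thin (i * t / 2^n) (dyadic_trees \<Phi> t T n i)
      \<and> dyadic_trees \<Phi> t T n i \<subseteq> dyadic_trees \<Phi> t T n (Suc i))"
proof (induction n)
  case 0
  have "is_tree ({} :: 'a list set)" by (simp add: is_tree_def)
  moreover have "thin 0 ({} :: 'a list set)"
    unfolding thin_def by (auto simp: cuts_def cost_def intro!: exI[of _ "{}"])
  ultimately show ?case using T by (auto simp: le_Suc_eq)
next
  case (Suc n)
  let ?F = "dyadic_trees \<Phi> t T"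
  have IH1: "is_tree (?F n i)" "?F n i \<subseteq> T" "0 < i \<Longrightarrow> heavy (i * t / 2^n) c (?F n i)" if "i \<le> 2^n" for i
    using Suc that by auto
  have IH2: "thin (i * t / 2^n) (?F n i)" "?F n i \<subseteq> ?F n (Suc i)" if "i < 2^n" for i
    using Suc that by auto
  have evn: "?F (Suc n) (2 * i) = ?F n i" for i by simp
  have exp_even: "real (2 * i) * t / 2 ^ Suc n = i * t / 2 ^ n" for i by simp
  define \<beta> where "\<beta> = (\<lambda>i::nat. real (2 * i + 1) * t / 2 ^ Suc n)"
  have odd: "?F (Suc n) (2 * i + 1) = ?F n i \<union> \<Phi> (\<beta> i) (?F n (Suc i))" for i by (simp add: \<beta>_def)
  have \<beta>: "0 < \<beta> i" "i * t / 2 ^ n \<le> \<beta> i" "\<beta> i \<le> Suc i * t / 2 ^ n" for i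
    using \<open>0 < t\<close> by (auto simp: \<beta>_def field_simps intro: add_pos_nonneg)
  have \<Phi>i: "\<Phi> (\<beta> i) (?F n (Suc i)) \<subseteq> ?F n (Suc i)" "is_tree (\<Phi> (\<beta> i) (?F n (Suc i)))"
      "heavy (\<beta> i) c (\<Phi> (\<beta> i) (?F n (Suc i)))" "thin (\<beta> i) (\<Phi> (\<beta> i) (?F n (Suc i)))" if "i < 2^n" for i
    using \<Phi>[OF \<beta>(1)[of i] IH1(1)[of "Suc i"] heavy_antimono[OF IH1(3)[of "Suc i"] \<beta>(3)[of i]]] that by auto
  have odd_props: "is_tree (?F (Suc n) (2*i+1))" "?F (Suc n) (2*i+1) \<subseteq> T"
     "heavy (\<beta> i) c (?F (Suc n) (2*i+1))" "thin (\<beta> i) (?F (Suc n) (2*i+1))"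
     "?F n i \<subseteq> ?F (Suc n) (2*i+1)" "?F (Suc n) (2*i+1) \<subseteq> ?F n (Suc i)" if i: "i < 2^n" for i
    unfolding odd using \<Phi>i[OF i] IH1[of i] IH1[of "Suc i"] IH2[OF i] i \<beta>[of i]
    by (auto intro: is_tree_Un heavy_subset thin_Un thin_mono)
  show ?case
  proof (intro conjI allI impI)
    fix j :: nat assume j: "j \<le> 2 ^ Suc n"
    consider i where "j = 2 * i" "i \<le> 2^n" | i where "j = 2 * i + 1" "i < 2^n"
      using j by (cases "even j") (auto elim!: evenE oddE)
    note cases_j = this
    have "is_tree (?F (Suc n) j) \<and> ?F (Suc n) j \<subseteq> T"
      using cases_j
    proof cases
      case (1 i)
      then show ?thesis using IH1(1,2)[of i] unfolding 1(1) evn by blast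
    next
      case (2 i)
      then show ?thesis using odd_props(1,2)[of i] unfolding 2(1) by blast
    qed
    then show "is_tree (?F (Suc n) j)" "?F (Suc n) j \<subseteq> T" by blast+
    show "heavy (j * t / 2 ^ Suc n) c (?F (Suc n) j)" if "0 < j"
      using cases_j
    proof cases
      case (1 i)
      then show ?thesis using IH1(3)[of i] that unfolding 1(1) evn exp_even by simp
    next
      case (2 i)
      then show ?thesis using odd_props(3)[of i] unfolding \<beta>_def 2(1) by blast
    qed
  next
    fix j :: nat assume j: "j < 2 ^ Suc n"
    consider i where "j = 2 * i" "i < 2^n" | i where "j = 2 * i + 1" "i < 2^n"
      using j by (cases "even j") (auto elim!: evenE oddE)
    note cases_j = this
    show "thin (j * t / 2 ^ Suc n) (?F (Suc n) j)"
      using cases_j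
    proof cases
      case (1 i)
      then show ?thesis using IH2(1)[of i] unfolding 1(1) evn exp_even by simp
    next
      case (2 i)
      then show ?thesis using odd_props(4)[of i] unfolding \<beta>_def 2(1) by blast
    qed
    show "?F (Suc n) j \<subseteq> ?F (Suc n) (Suc j)"
      using cases_j
    proof cases
      case (1 i)
      have "Suc j = 2 * i + 1" using 1(1) by simp
      show ?thesis using odd_props(5)[OF 1(2)] unfolding \<open>Suc j = 2 * i + 1\<close> unfolding 1(1) evn .
    next
      case (2 i)
      have "Suc j = 2 * Suc i" using 2(1) by simp
      then show ?thesis using odd_props(6)[of i] 2 unfolding \<open>Suc j = 2 * Suc i\<close> evn by metis
    qed
  qed
qed

lemma nested_thin_trees:
  fixes T :: "'a list set"
  assumes T: "is_tree T" "heavy t c T" and "0 < t" "0 \<le> c"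
  obtains F :: "nat \<Rightarrow> nat \<Rightarrow> 'a list set" where
    "\<And>n i. i \<le> 2^n \<Longrightarrow> is_tree (F n i) \<and> F n i \<subseteq> T"
    "\<And>n i. i < 2^n \<Longrightarrow> thin (i * t / 2^n) (F n i)"
    "\<And>\<alpha>. 0 \<le> \<alpha> \<Longrightarrow> \<alpha> < t \<Longrightarrow> \<exists>S. is_tree S \<and> S \<subseteq> T \<and> heavy \<alpha> c S
      \<and> (\<forall>\<beta>>\<alpha>. \<exists>n i. i < 2^n \<and> i * t / 2^n < \<beta> \<and> S \<subseteq> F n i)"
proof -
  define \<Phi> where "\<Phi> = (\<lambda>\<beta> (S :: 'a list set).
    SOME S'. S' \<subseteq> S \<and> is_tree S' \<and> heavy \<beta> c S' \<and> thin \<beta> S')"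
  have \<Phi>: "\<Phi> \<beta> S \<subseteq> S \<and> is_tree (\<Phi> \<beta> S) \<and> heavy \<beta> c (\<Phi> \<beta> S) \<and> thin \<beta> (\<Phi> \<beta> S)"
    if "0 < \<beta>" "is_tree S" "heavy \<beta> c S" for \<beta> S
    unfolding \<Phi>_def by (rule someI_ex) (rule thin_heavy_subtree[OF that(2,3,1) \<open>0 \<le> c\<close>])
  define F where "F = dyadic_trees \<Phi> t T"
  have F: "is_tree (F n i)" "F n i \<subseteq> T" "0 < i \<Longrightarrow> heavy (i * t / 2^n) c (F n i)" if "i \<le> 2^n" for n i
    using dyadic_trees_properties[where \<Phi> = \<Phi> and n = n, OF T \<open>0 < t\<close> \<Phi>] that unfolding F_def by auto
  have F': "thin (i * t / 2^n) (F n i)" "F n i \<subseteq> F n (Suc i)" if "i < 2^n" for n i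
    using dyadic_trees_properties[where \<Phi> = \<Phi> and n = n, OF T \<open>0 < t\<close> \<Phi>] that unfolding F_def by auto
  show ?thesis
  proof (rule that[of F])
    fix \<alpha> assume \<alpha>: "0 \<le> \<alpha>" "\<alpha> < t"
    \<comment> \<open>The least index whose exponent strictly exceeds \<open>\<alpha>\<close>; as
      \<open>n\<close> grows, these exponents decrease to \<open>\<alpha>\<close>.\<close>
    define I where "I = (\<lambda>n. Suc (nat \<lfloor>\<alpha> * 2 ^ n / t\<rfloor>))"
    have I: "\<alpha> < I n * t / 2^n" "I n * t / 2^n \<le> \<alpha> + t / 2^n" for n
    proof -
      have nonneg: "0 \<le> \<alpha> * 2 ^ n / t" using \<alpha> \<open>0 < t\<close> by simp
      then have "real (I n) = real_of_int \<lfloor>\<alpha> * 2 ^ n / t\<rfloor> + 1" by (simp add: I_def)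
      then have "\<alpha> * 2 ^ n / t < I n" "I n \<le> \<alpha> * 2 ^ n / t + 1" by linarith+
      then show "\<alpha> < I n * t / 2^n" "I n * t / 2^n \<le> \<alpha> + t / 2^n"
        using \<open>0 < t\<close> by (simp_all add: field_simps)
    qed
    have I_le: "I n \<le> 2 ^ n" for n
    proof -
      have "\<alpha> * 2 ^ n / t < 2 ^ n" using \<alpha> \<open>0 < t\<close> by (simp add: field_simps)
      then have "\<lfloor>\<alpha> * 2 ^ n / t\<rfloor> < 2 ^ n" by (simp add: floor_less_iff)
      then have "nat \<lfloor>\<alpha> * 2 ^ n / t\<rfloor> < 2 ^ n" by (simp add: nat_less_iff)
      then show ?thesis unfolding I_def by (rule Suc_leI)
    qed
    have I_pos: "0 < I n" for n by (simp add: I_def)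
    have "I (Suc n) \<le> 2 * I n" for n
    proof -
      have "real_of_int \<lfloor>\<alpha> * 2 ^ Suc n / t\<rfloor> \<le> \<alpha> * 2 ^ Suc n / t" by (rule of_int_floor_le)
      also have "\<dots> = 2 * (\<alpha> * 2 ^ n / t)" by simp
      also have "\<dots> < 2 * I n" using I(1)[of n] \<open>0 < t\<close> by (simp add: field_simps)
      finally have "\<lfloor>\<alpha> * 2 ^ Suc n / t\<rfloor> < 2 * int (I n)" by linarith
      then have "nat \<lfloor>\<alpha> * 2 ^ Suc n / t\<rfloor> < 2 * I n" using I_pos[of n] by linarith
      then show ?thesis by (subst I_def) (rule Suc_leI)
    qed
    then have I_Suc: "I (Suc n) = 2 * I n \<or> I (Suc n) = 2 * I n - 1" for n
    proof -
      have "real (2 * I n) * t / 2 ^ Suc n \<le> \<alpha> + 2 * (t / 2 ^ Suc n)" using I(2)[of n] by simp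
      also have "\<dots> < I (Suc n) * t / 2 ^ Suc n + 2 * (t / 2 ^ Suc n)" using I(1)[of "Suc n"] by simp
      finally have "real (2 * I n) * t < (I (Suc n) + 2) * t"
        by (simp add: field_simps del: power_Suc)
      then have "2 * I n < I (Suc n) + 2" using \<open>0 < t\<close> by (simp only: mult_less_cancel_right) linarith
      then show ?thesis using \<open>\<And>n. I (Suc n) \<le> 2 * I n\<close>[of n] by linarith
    qed
    \<comment> \<open>The new index is either \<open>2 * I n\<close>, which names the same tree as
      \<open>I n\<close> one stage earlier, or the index just below, whose tree is contained in that
      one.\<close>
    have dec: "F (Suc n) (I (Suc n)) \<subseteq> F n (I n)" for n
    proof -
      have "F (Suc n) (2 * I n) = F n (I n)" by (simp add: F_def)
      moreover have "F (Suc n) (2 * I n - 1) \<subseteq> F (Suc n) (Suc (2 * I n - 1))"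
        using I_le[of n] I_pos[of n] by (intro F'(2)) simp
      ultimately show ?thesis using I_Suc[of n] I_pos[of n] by auto
    qed
    have lim: "(\<lambda>n. I n * t / 2^n) \<longlonglongrightarrow> \<alpha>"
    proof (rule tendsto_sandwich[of "\<lambda>_. \<alpha>" _ _ "\<lambda>n. \<alpha> + t / 2^n"])
      have "(\<lambda>n. \<alpha> + t * (1/2)^n) \<longlonglongrightarrow> \<alpha> + t * 0"
        by (intro tendsto_intros LIMSEQ_realpow_zero) auto
      then show "(\<lambda>n. \<alpha> + t / 2^n) \<longlonglongrightarrow> \<alpha>" by (simp add: power_one_over)
    qed (use I in \<open>auto intro: always_eventually less_imp_le\<close>)
    define S where "S = (\<Inter>n. F n (I n))"
    have "heavy \<alpha> c S"
      unfolding S_def using F I_le I_pos dec lim by (intro heavy_INT[where b = "\<lambda>n. I n * t / 2^n"]) auto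
    moreover have "is_tree S" unfolding S_def by (intro is_tree_INT F(1) I_le)
    moreover have "S \<subseteq> T" unfolding S_def using F(2)[OF I_le[of 0]] by blast
    moreover have "\<exists>n i. i < 2^n \<and> i * t / 2^n < \<beta> \<and> S \<subseteq> F n i" if "\<alpha> < \<beta>" for \<beta>
    proof -
      have "\<forall>\<^sub>F n in sequentially. I n * t / 2^n < min \<beta> t"
        using lim \<alpha> that by (intro order_tendstoD) auto
      \<comment> \<open>Staying below \<open>t\<close> keeps the index below \<open>2^n\<close>,
        where thinness is available.\<close>
      then obtain n where n: "I n * t / 2^n < min \<beta> t"
        by (metis (lifting) eventually_sequentially order_refl)
      then have "real (I n) < 2 ^ n" using \<open>0 < t\<close> by (simp add: field_simps)
      then have "I n < 2 ^ n" by (metis of_nat_less_iff of_nat_numeral of_nat_power)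
      then show ?thesis using n unfolding S_def by (intro exI[of _ n] exI[of _ "I n"]) auto
    qed
    ultimately show "\<exists>S. is_tree S \<and> S \<subseteq> T \<and> heavy \<alpha> c S
      \<and> (\<forall>\<beta>>\<alpha>. \<exists>n i. i < 2^n \<and> i * t / 2^n < \<beta> \<and> S \<subseteq> F n i)" by blast
  qed (use F F' in auto)
qed

section \<open>Hausdorff measure and lower local dimension\<close>

text \<open>Vitali and dyadic covers come with their own index sets and with bounds for finite
  subfamilies; free positions of the sequence are filled with the empty set, which costs
  nothing.\<close>

lemma hausdorff_premeasure_le_countable:
  fixes V :: "'i \<Rightarrow> 'a::metric_space set"
  assumes I: "countable I" and cover: "E \<subseteq> (\<Union>i\<in>I. V i)" and "0 \<le> \<delta>"
    and small: "\<And>i. i \<in> I \<Longrightarrow> bounded (V i) \<and> diameter (V i) \<le> \<delta>"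
    and sums: "\<And>J. finite J \<Longrightarrow> J \<subseteq> I \<Longrightarrow> (\<Sum>j\<in>J. diam_pow s (V j)) \<le> M"
  shows "hausdorff_premeasure s \<delta> E \<le> M"
proof -
  define U where "U = (\<lambda>n. if n \<in> to_nat_on I ` I then V (from_nat_into I n) else {})"
  have U_nat: "U (to_nat_on I i) = V i" if "i \<in> I" for i
    using that I by (simp add: U_def)
  have "U n = {} \<or> (\<exists>i\<in>I. U n = V i)" for n
    unfolding U_def using I by auto
  then have "bounded (U n) \<and> diameter (U n) \<le> \<delta>" for n
    using small \<open>0 \<le> \<delta>\<close> by (metis bounded_empty diameter_empty)
  moreover have "E \<subseteq> (\<Union>n. U n)" using cover U_nat by fastforce
  ultimately have "hausdorff_premeasure s \<delta> E \<le> (\<Sum>n. diam_pow s (U n))"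
    unfolding hausdorff_premeasure_def by (intro INF_lower) auto
  also have "\<dots> \<le> M"
  proof (rule suminf_le_const)
    fix n
    define J where "J = {i\<in>I. to_nat_on I i < n}"
    have inj: "inj_on (to_nat_on I) J"
      using inj_on_to_nat_on[OF I] by (rule inj_on_subset) (auto simp: J_def)
    have "finite (to_nat_on I ` J)" by (rule finite_subset[of _ "{..<n}"]) (auto simp: J_def)
    then have "finite J" using inj by (rule finite_imageD)
    have "(\<Sum>m<n. diam_pow s (U m)) = (\<Sum>m\<in>to_nat_on I ` J. diam_pow s (U m))"
      by (rule sum.mono_neutral_right) (auto simp: J_def U_def diam_pow_def)
    also have "\<dots> = (\<Sum>j\<in>J. diam_pow s (V j))"
      by (subst sum.reindex[OF inj]) (auto simp: J_def U_nat intro!: sum.cong)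
    also have "\<dots> \<le> M" using \<open>finite J\<close> by (intro sums) (auto simp: J_def)
    finally show "(\<Sum>m<n. diam_pow s (U m)) \<le> M" .
  qed auto
  finally show ?thesis .
qed

section \<open>Null sets, change of exponent and Hausdorff dimension\<close>

lemma hausdorff_measure_eq_0_iff:
  "hausdorff_measure s E = 0 \<longleftrightarrow> (\<forall>\<delta>>0. hausdorff_premeasure s \<delta> E = 0)"
  unfolding hausdorff_measure_def bot_ennreal[symmetric] SUP_bot_conv by auto

lemma hausdorff_premeasure_0_cover:
  assumes "hausdorff_premeasure s \<delta> E = 0" "0 < e"
  obtains U where "E \<subseteq> (\<Union>i::nat. U i)" "\<And>i. bounded (U i) \<and> diameter (U i) \<le> \<delta>"
    "(\<Sum>i. diam_pow s (U i)) < e"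
proof -
  have "hausdorff_premeasure s \<delta> E < e" using assms by simp
  then show ?thesis
    unfolding hausdorff_premeasure_def INF_less_iff using that by blast
qed

lemma ennreal_eq_0I:
  fixes x :: ennreal
  assumes "\<And>e. 0 < e \<Longrightarrow> x \<le> ennreal e" shows "x = 0"
  using ennreal_le_epsilon[of 0 x] assms by simp

lemma hausdorff_premeasure_exponent:
  assumes M: "hausdorff_premeasure a \<delta> E < M" and ab: "0 \<le> a" "a < b"
  shows "hausdorff_premeasure b \<delta> E \<le> ennreal (\<delta> powr (b - a)) * M"
proof -
  obtain U where U: "E \<subseteq> (\<Union>i::nat. U i)" "\<And>i. bounded (U i) \<and> diameter (U i) \<le> \<delta>"
      and sum: "(\<Sum>i. diam_pow a (U i)) < M"
    using M unfolding hausdorff_premeasure_def INF_less_iff by blast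
  define c where "c = \<delta> powr (b - a)"
  have "0 \<le> c" by (simp add: c_def)
  have le: "diam_pow b (U i) \<le> ennreal c * diam_pow a (U i)" for i
  proof (cases "U i = {}")
    case False
    have d: "0 \<le> diameter (U i)" "diameter (U i) \<le> \<delta>" using U(2) diameter_ge_0 by auto
    \<comment> \<open>For \<open>a = 0\<close> every nonempty set has weight 1, while a set of
      diameter 0 still has weight 0 at the exponent \<open>b > 0\<close>.\<close>
    have "diameter (U i) powr b \<le> c * (if a = 0 then 1 else diameter (U i) powr a)"
    proof (cases "diameter (U i) = 0")
      case False
      then have "diameter (U i) powr b = diameter (U i) powr (b - a) * diameter (U i) powr a"
        by (simp add: powr_add[symmetric])
      also have "\<dots> \<le> c * diameter (U i) powr a"
        unfolding c_def using d ab by (intro mult_right_mono powr_mono2) auto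
      finally show ?thesis using False d by auto
    qed (use \<open>0 \<le> c\<close> in simp)
    then have "ennreal (diameter (U i) powr b) \<le> ennreal (c * (if a = 0 then 1 else diameter (U i) powr a))"
      by (rule ennreal_leI)
    then show ?thesis
      using False ab \<open>0 \<le> c\<close> by (simp add: diam_pow_def ennreal_mult split: if_splits)
  qed (simp add: diam_pow_def)
  have "hausdorff_premeasure b \<delta> E \<le> (\<Sum>i. diam_pow b (U i))"
    unfolding hausdorff_premeasure_def using U by (intro INF_lower) auto
  also have "\<dots> \<le> (\<Sum>i. ennreal c * diam_pow a (U i))"
    by (intro suminf_le le) auto
  also have "\<dots> = ennreal c * (\<Sum>i. diam_pow a (U i))" by simp
  also have "\<dots> \<le> ennreal c * M"
    using sum by (intro mult_left_mono) auto
  finally show ?thesis by (simp add: c_def)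
qed

lemma hausdorff_premeasure_antimono:
  "\<delta>' \<le> \<delta> \<Longrightarrow> hausdorff_premeasure s \<delta> E \<le> hausdorff_premeasure s \<delta>' E"
  unfolding hausdorff_premeasure_def by (intro INF_superset_mono) (auto intro: order_trans)

lemma hausdorff_measure_0_of_bounded_premeasure:
  assumes M: "\<And>\<delta>. 0 < \<delta> \<Longrightarrow> hausdorff_premeasure a \<delta> E \<le> ennreal M" and ab: "0 \<le> a" "a < b"
  shows "hausdorff_measure b E = 0"
  unfolding hausdorff_measure_eq_0_iff
proof (intro allI impI ennreal_eq_0I)
  fix \<delta> e :: real assume pos: "0 < \<delta>" "0 < e"
  \<comment> \<open>The change of exponent takes a strict bound, hence the summand 1. Unless
    \<open>\<delta>\<close> is smaller, \<open>\<delta>'\<close> solves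
    \<open>\<delta>' powr (b - a) * c = e\<close>.\<close>
  define c where "c = max M 0 + 1"
  have c: "0 < c" "M < c" by (auto simp: c_def)
  define \<delta>' where "\<delta>' = min \<delta> ((e / c) powr (1 / (b - a)))"
  have "0 < \<delta>'" "\<delta>' \<le> \<delta>" using pos c by (auto simp: \<delta>'_def)
  have "\<delta>' powr (b - a) \<le> ((e / c) powr (1 / (b - a))) powr (b - a)"
    using \<open>0 < \<delta>'\<close> ab by (intro powr_mono2) (auto simp: \<delta>'_def)
  also have "\<dots> = e / c" using ab pos c by (simp add: powr_powr)
  finally have le: "\<delta>' powr (b - a) * c \<le> e" using c by (simp add: field_simps)
  have "ennreal M < ennreal c" using c by (intro ennreal_lessI) auto
  then have "hausdorff_premeasure a \<delta>' E < ennreal c"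
    using M[OF \<open>0 < \<delta>'\<close>] by (rule order_le_less_trans[rotated])
  then have "hausdorff_premeasure b \<delta>' E \<le> ennreal (\<delta>' powr (b - a)) * ennreal c"
    using ab by (rule hausdorff_premeasure_exponent)
  also have "\<dots> \<le> ennreal e"
    using le c by (simp add: ennreal_mult[symmetric] ennreal_leI)
  finally show "hausdorff_premeasure b \<delta> E \<le> ennreal e"
    using hausdorff_premeasure_antimono[OF \<open>\<delta>' \<le> \<delta>\<close>] order_trans by blast
qed

lemma hausdorff_measure_0_mono_exponent:
  assumes "hausdorff_measure a E = 0" "0 \<le> a" "a < b"
  shows "hausdorff_measure b E = 0"
  using assms hausdorff_measure_0_of_bounded_premeasure[of a E 0]
  unfolding hausdorff_measure_eq_0_iff[of a] by simp

lemma hausdorff_measure_UN_null: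
  assumes I: "countable I" and null: "\<And>i. i \<in> I \<Longrightarrow> hausdorff_measure s (E i) = 0"
  shows "hausdorff_measure s (\<Union>i\<in>I. E i) = 0"
  unfolding hausdorff_measure_eq_0_iff
proof (intro allI impI ennreal_eq_0I)
  fix \<delta> e :: real assume pos: "0 < \<delta>" "0 < e"
  define \<eta> where "\<eta> = (\<lambda>i. e * (1/2) ^ Suc (to_nat_on I i))"
  have \<eta>: "0 < \<eta> i" for i using pos by (simp add: \<eta>_def)
  have "\<exists>U. E i \<subseteq> (\<Union>n::nat. U n) \<and> (\<forall>n. bounded (U n) \<and> diameter (U n) \<le> \<delta>)
      \<and> (\<Sum>n. diam_pow s (U n)) < ennreal (\<eta> i)" if i: "i \<in> I" for i
  proof -
    have "hausdorff_premeasure s \<delta> (E i) = 0"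
      using null[OF i] pos unfolding hausdorff_measure_eq_0_iff by blast
    then show ?thesis
      using hausdorff_premeasure_0_cover[of s \<delta> "E i" "ennreal (\<eta> i)"] \<eta>[of i] by (metis ennreal_less_zero_iff)
  qed
  then obtain U where U: "\<And>i. i \<in> I \<Longrightarrow> E i \<subseteq> (\<Union>n::nat. U i n)"
      "\<And>i n. i \<in> I \<Longrightarrow> bounded (U i n) \<and> diameter (U i n) \<le> \<delta>"
      "\<And>i. i \<in> I \<Longrightarrow> (\<Sum>n. diam_pow s (U i n)) < ennreal (\<eta> i)"
    by metis
  show "hausdorff_premeasure s \<delta> (\<Union>i\<in>I. E i) \<le> ennreal e"
  proof (rule hausdorff_premeasure_le_countable[of "I \<times> UNIV" _ "\<lambda>(i, n). U i n"])
    fix J assume J: "finite J" "J \<subseteq> I \<times> (UNIV :: nat set)"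
    define A where "A = fst ` J"
    have A: "finite A" "A \<subseteq> I" using J by (auto simp: A_def)
    have "(\<Sum>j\<in>J. diam_pow s (case j of (i, n) \<Rightarrow> U i n)) \<le> (\<Sum>j\<in>A \<times> snd ` J. diam_pow s (case j of (i, n) \<Rightarrow> U i n))"
      using J by (intro sum_mono2) (auto simp: A_def image_iff, force+)
    also have "\<dots> = (\<Sum>i\<in>A. \<Sum>n\<in>snd ` J. diam_pow s (U i n))"
      by (simp add: sum.cartesian_product case_prod_unfold)
    also have "\<dots> \<le> (\<Sum>i\<in>A. ennreal (\<eta> i))"
    proof (rule sum_mono)
      fix i assume "i \<in> A"
      have "(\<Sum>n\<in>snd ` J. diam_pow s (U i n)) \<le> (\<Sum>n. diam_pow s (U i n))"
        using J by (intro sum_le_suminf) auto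
      then show "(\<Sum>n\<in>snd ` J. diam_pow s (U i n)) \<le> ennreal (\<eta> i)"
        using U(3)[of i] \<open>i \<in> A\<close> A by (meson order.strict_implies_order order_trans subsetD)
    qed
    also have "\<dots> = ennreal (\<Sum>i\<in>A. \<eta> i)"
      using \<eta> by (intro sum_ennreal) (auto intro: less_imp_le)
    also have "\<dots> \<le> ennreal e"
    proof (rule ennreal_leI)
      have inj: "inj_on (to_nat_on I) A" using inj_on_to_nat_on[OF I] A(2) by (rule inj_on_subset)
      have "(\<Sum>i\<in>A. (1/2::real) ^ Suc (to_nat_on I i)) = (\<Sum>m\<in>to_nat_on I ` A. (1/2) ^ Suc m)"
        by (simp add: sum.reindex[OF inj])
      also have "\<dots> \<le> (\<Sum>m. (1/2) ^ Suc m)"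
        using A(1) power_half_series by (intro sum_le_suminf) (auto simp: sums_iff)
      also have "\<dots> = 1" using power_half_series by (simp add: sums_iff)
      finally have "e * (\<Sum>i\<in>A. (1/2::real) ^ Suc (to_nat_on I i)) \<le> e * 1"
        using pos by (intro mult_left_mono) auto
      then show "(\<Sum>i\<in>A. \<eta> i) \<le> e" by (simp add: \<eta>_def sum_distrib_left)
    qed
    finally show "(\<Sum>j\<in>J. diam_pow s (case j of (i, n) \<Rightarrow> U i n)) \<le> ennreal e" .
  qed (use I U pos in \<open>auto, blast\<close>)
qed

lemma hausdorff_measure_less_dim:
  assumes "0 \<le> t" "ereal t < hausdorff_dim E"
  shows "hausdorff_measure t E > 0"
proof (rule ccontr)
  assume "\<not> hausdorff_measure t E > 0"
  then have "hausdorff_dim E \<le> ereal t"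
    unfolding hausdorff_dim_def using assms(1) by (intro INF_lower) (auto simp: not_less)
  then show False using assms(2) by simp
qed

lemma hausdorff_measure_greater_dim:
  assumes "hausdorff_dim E < ereal t"
  shows "hausdorff_measure t E = 0"
proof -
  obtain s where "0 \<le> s" "hausdorff_measure s E = 0" "s < t"
    using assms unfolding hausdorff_dim_def INF_less_iff by auto
  then show ?thesis using hausdorff_measure_0_mono_exponent by blast
qed

lemma hausdorff_dim_leI:
  assumes "0 \<le> a" "\<And>s. a < s \<Longrightarrow> hausdorff_measure s E = 0"
  shows "hausdorff_dim E \<le> ereal a"
proof (rule ccontr)
  assume "\<not> hausdorff_dim E \<le> ereal a"
  then obtain s where s: "ereal a < ereal s" "ereal s < hausdorff_dim E"
    using ereal_dense2[of "ereal a" "hausdorff_dim E"] by (auto simp: not_le)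
  have "hausdorff_dim E \<le> ereal s"
    unfolding hausdorff_dim_def using assms s by (intro INF_lower) auto
  then show False using s by simp
qed

lemma hausdorff_dim_geI:
  assumes "hausdorff_measure a E \<noteq> 0"
  shows "ereal a \<le> hausdorff_dim E"
  unfolding hausdorff_dim_def
proof (rule INF_greatest)
  fix s assume "s \<in> {s. 0 \<le> s \<and> hausdorff_measure s E = 0}"
  then have "\<not> s < a" using assms hausdorff_measure_0_mono_exponent by blast
  then show "ereal a \<le> ereal s" by simp
qed

lemma hausdorff_measure_subset_null:
  assumes "hausdorff_measure s F = 0" "E \<subseteq> F"
  shows "hausdorff_measure s E = 0"
proof -
  have "hausdorff_premeasure s \<delta> E \<le> hausdorff_premeasure s \<delta> F" for \<delta>
    unfolding hausdorff_premeasure_def using assms(2) by (intro INF_superset_mono) auto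
  then show ?thesis
    using assms(1) unfolding hausdorff_measure_eq_0_iff by (metis le_zero_eq)
qed

section \<open>Lower local dimension and the mass of small balls\<close>

lemma borel_prob_measuresD:
  assumes "\<mu> \<in> borel_prob_measures K"
  shows "prob_space \<mu>" "sets \<mu> = sets (restrict_space borel K)" "space \<mu> = K"
  using assms sets_eq_imp_space_eq[of \<mu> "restrict_space borel K"]
  unfolding borel_prob_measures_def by (auto simp: space_restrict_space)

lemma ball_Int_sets:
  assumes "\<mu> \<in> borel_prob_measures K" shows "ball x r \<inter> K \<in> sets \<mu>"
  using borel_prob_measuresD(2)[OF assms] by (auto simp: sets_restrict_space image_iff)

text \<open>For \<open>r < 1\<close> the logarithm is negative, so the inequality turns round; a
  null ball gives the quotient \<open>\<infinity>\<close>, in agreement with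
  \<open>r powr \<gamma> < 0\<close> being false.\<close>

lemma log_ext_div_less_iff:
  assumes "0 < r" "r < 1" "0 \<le> m"
  shows "log_ext m / ereal (ln r) < ereal \<gamma> \<longleftrightarrow> r powr \<gamma> < m"
proof (cases "m = 0")
  case True
  then have "log_ext m / ereal (ln r) = \<infinity>"
    using assms by (simp add: log_ext_def divide_ereal_def)
  then show ?thesis using True by simp
next
  case False
  have "ln m / ln r < \<gamma> \<longleftrightarrow> \<gamma> * ln r < ln m"
    using assms by (simp add: field_simps)
  also have "\<dots> \<longleftrightarrow> exp (\<gamma> * ln r) < exp (ln m)" by simp
  also have "\<dots> \<longleftrightarrow> r powr \<gamma> < m" using assms False by (simp add: powr_def)
  finally show ?thesis using False assms by (simp add: log_ext_def)
qed

lemma lower_local_dim_lessD: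
  assumes "lower_local_dim \<mu> x < ereal \<gamma>" "0 < \<delta>"
  shows "\<exists>r. 0 < r \<and> r < \<delta> \<and> r powr \<gamma> < measure \<mu> (ball x r \<inter> space \<mu>)"
proof (rule ccontr)
  assume *: "\<not> ?thesis"
  have "ereal \<gamma> \<le> lower_local_dim \<mu> x"
    unfolding lower_local_dim_def
  proof (rule Liminf_bounded)
    have "eventually (\<lambda>r. r \<in> {0<..<min \<delta> 1}) (at_right (0::real))"
      using assms(2) by (intro eventually_at_right_real) auto
    then show "\<forall>\<^sub>F r in at_right 0. ereal \<gamma> \<le> log_ext (measure \<mu> (ball x r \<inter> space \<mu>)) / ereal (ln r)"
    proof eventually_elim
      case (elim r)
      then show ?case
        using * log_ext_div_less_iff[of r "measure \<mu> (ball x r \<inter> space \<mu>)" \<gamma>]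
        by (metis greaterThanLessThan_iff measure_nonneg min_less_iff_conj not_less)
    qed
  qed
  then show False using assms(1) by simp
qed

lemma lower_local_dim_leI:
  assumes "\<And>\<delta>. 0 < \<delta> \<Longrightarrow> \<exists>r. 0 < r \<and> r < \<delta> \<and> r powr \<gamma> < measure \<mu> (ball x r \<inter> space \<mu>)"
  shows "lower_local_dim \<mu> x \<le> ereal \<gamma>"
proof (rule ccontr)
  assume "\<not> ?thesis"
  then have "\<forall>\<^sub>F r in at_right 0. ereal \<gamma> < log_ext (measure \<mu> (ball x r \<inter> space \<mu>)) / ereal (ln r)"
    unfolding lower_local_dim_def not_le by (rule less_LiminfD)
  then have "\<forall>\<^sub>F r in at_right 0. \<not> log_ext (measure \<mu> (ball x r \<inter> space \<mu>)) / ereal (ln r) < ereal \<gamma>"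
    by (auto elim!: eventually_mono)
  then obtain b where b: "0 < b"
    "\<And>r. 0 < r \<Longrightarrow> r < b \<Longrightarrow> \<not> log_ext (measure \<mu> (ball x r \<inter> space \<mu>)) / ereal (ln r) < ereal \<gamma>"
    unfolding eventually_at_right_field by auto
  obtain r where "0 < r" "r < min b 1" "r powr \<gamma> < measure \<mu> (ball x r \<inter> space \<mu>)"
    using assms[of "min b 1"] b(1) by auto
  then show False using b(2)[of r] by (auto simp: log_ext_div_less_iff)
qed

lemma lower_local_dim_nonneg:
  assumes "prob_space \<mu>" shows "0 \<le> lower_local_dim \<mu> x"
proof (rule ccontr)
  assume "\<not> ?thesis"
  then have "lower_local_dim \<mu> x < ereal 0" by (simp add: zero_ereal_def)
  then obtain r where "0 < r" "r powr 0 < measure \<mu> (ball x r \<inter> space \<mu>)"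
    using lower_local_dim_lessD[of \<mu> x 0 1] by auto
  then show False using prob_space.prob_le_1[OF assms, of "ball x r \<inter> space \<mu>"] by simp
qed

text \<open>Every point of the set is the centre of arbitrarily small balls of mass above
  \<open>r powr \<gamma>\<close>. A disjoint subfamily has total mass at most 1 and becomes a cover
  after fivefold enlargement; the enlarged balls have diameter \<open>10 * r\<close>, whence the
  constant and the radii below \<open>\<delta> / 10\<close>.\<close>

lemma hausdorff_premeasure_lower_local_dim_le:
  fixes K :: "'a::euclidean_space set"
  assumes \<mu>: "\<mu> \<in> borel_prob_measures K" and "0 < \<gamma>" "0 < \<delta>"
  shows "hausdorff_premeasure \<gamma> \<delta> {x\<in>K. lower_local_dim \<mu> x < ereal \<gamma>} \<le> ennreal (10 powr \<gamma>)"
proof -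
  interpret prob_space \<mu> by (rule borel_prob_measuresD(1)[OF \<mu>])
  define A where "A = {x\<in>K. lower_local_dim \<mu> x < ereal \<gamma>}"
  have "\<forall>x\<in>A. \<exists>r. 0 < r \<and> r < \<delta> / 10 \<and> r powr \<gamma> < measure \<mu> (ball x r \<inter> K)"
    using lower_local_dim_lessD[of \<mu> _ \<gamma> "\<delta> / 10"] assms(3) borel_prob_measuresD(3)[OF \<mu>]
    unfolding A_def by auto
  then obtain r where r: "\<And>x. x \<in> A \<Longrightarrow> 0 < r x \<and> r x < \<delta> / 10 \<and> r x powr \<gamma> < measure \<mu> (ball x (r x) \<inter> K)"
    by metis
  have r': "0 < r x \<and> r x \<le> \<delta> / 10" if "x \<in> A" for x using r[OF that] by simp
  have "A \<subseteq> (\<Union>x\<in>A. cball x (r x))"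
  proof
    fix x assume "x \<in> A"
    then show "x \<in> (\<Union>x\<in>A. cball x (r x))" using r'[of x] by (intro UN_I[of x]) auto
  qed
  then obtain C where C: "countable C" "C \<subseteq> A"
    "pairwise (\<lambda>x y. disjnt (cball x (r x)) (cball y (r y))) C"
    "A \<subseteq> (\<Union>x\<in>C. cball x (5 * r x))"
    by (rule Vitali_covering_lemma_cballs[OF _ r']) (assumption, rule that)
  have diam: "diameter (cball x (5 * r x)) = 10 * r x" if "x \<in> C" for x
  proof -
    have "0 < r x" using r C(2) that by blast
    then show ?thesis by (simp add: diameter_cball)
  qed
  show ?thesis
    unfolding A_def[symmetric]
  proof (rule hausdorff_premeasure_le_countable[OF C(1,4)])
    fix J assume J: "finite J" "J \<subseteq> C"
    have "(\<Sum>x\<in>J. r x powr \<gamma>) \<le> (\<Sum>x\<in>J. measure \<mu> (ball x (r x) \<inter> K))"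
      using r J C(2) by (intro sum_mono) (meson less_imp_le subsetD)
    also have "\<dots> = measure \<mu> (\<Union>x\<in>J. ball x (r x) \<inter> K)"
    proof (rule finite_measure_finite_Union[symmetric])
      show "disjoint_family_on (\<lambda>x. ball x (r x) \<inter> K) J"
        unfolding disjoint_family_on_def
      proof (intro ballI impI)
        fix x y assume "x \<in> J" "y \<in> J" "x \<noteq> y"
        then have "disjnt (cball x (r x)) (cball y (r y))"
          using C(3) J(2) unfolding pairwise_def by blast
        moreover have "ball x (r x) \<subseteq> cball x (r x)" "ball y (r y) \<subseteq> cball y (r y)" by auto
        ultimately show "ball x (r x) \<inter> K \<inter> (ball y (r y) \<inter> K) = {}"
          unfolding disjnt_def by blast
      qed
    qed (use J ball_Int_sets[OF \<mu>] in auto)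
    also have "\<dots> \<le> 1" by simp
    finally have *: "10 powr \<gamma> * (\<Sum>x\<in>J. r x powr \<gamma>) \<le> 10 powr \<gamma>" by simp
    have "(\<Sum>x\<in>J. diam_pow \<gamma> (cball x (5 * r x))) = (\<Sum>x\<in>J. ennreal (10 powr \<gamma> * r x powr \<gamma>))"
    proof (rule sum.cong)
      fix x assume "x \<in> J"
      then have "0 < r x" "x \<in> C" using J C(2) r by blast+
      then show "diam_pow \<gamma> (cball x (5 * r x)) = ennreal (10 powr \<gamma> * r x powr \<gamma>)"
        using \<open>0 < \<gamma>\<close> by (simp add: diam_pow_def diam powr_mult)
    qed simp
    also have "\<dots> = ennreal (10 powr \<gamma> * (\<Sum>x\<in>J. r x powr \<gamma>))"
      by (simp add: sum_distrib_left)
    also have "\<dots> \<le> ennreal (10 powr \<gamma>)" using * by (rule ennreal_leI)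
    finally show "(\<Sum>x\<in>J. diam_pow \<gamma> (cball x (5 * r x))) \<le> ennreal (10 powr \<gamma>)" .
  next
    fix x assume "x \<in> C"
    then show "bounded (cball x (5 * r x)) \<and> diameter (cball x (5 * r x)) \<le> \<delta>"
      using r'[of x] C(2) diam[of x] by auto
  qed (use \<open>0 < \<delta>\<close> in simp)
qed

lemma hausdorff_measure_lower_local_dim_less:
  fixes K :: "'a::euclidean_space set"
  assumes \<mu>: "\<mu> \<in> borel_prob_measures K" and "0 \<le> \<beta>"
  shows "hausdorff_measure \<beta> {x\<in>K. lower_local_dim \<mu> x < ereal \<beta>} = 0"
proof -
  \<comment> \<open>The bound at \<open>\<gamma>\<close> yields nullity only at larger exponents, so
    \<open>\<gamma>\<close> runs through the rationals below \<open>\<beta>\<close>. Positive ones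
    suffice, since lower local dimensions are nonnegative.\<close>
  define Q where "Q = {\<gamma>\<in>\<rat>. 0 < \<gamma> \<and> \<gamma> < \<beta>}"
  have "countable Q" unfolding Q_def using countable_rat by (rule countable_subset[rotated]) auto
  moreover have "hausdorff_measure \<beta> {x\<in>K. lower_local_dim \<mu> x < ereal \<gamma>} = 0" if "\<gamma> \<in> Q" for \<gamma>
    using hausdorff_measure_0_of_bounded_premeasure[of \<gamma> _ "10 powr \<gamma>"]
      hausdorff_premeasure_lower_local_dim_le[OF \<mu>] that by (auto simp: Q_def)
  ultimately have "hausdorff_measure \<beta> (\<Union>\<gamma>\<in>Q. {x\<in>K. lower_local_dim \<mu> x < ereal \<gamma>}) = 0"
    by (rule hausdorff_measure_UN_null)
  then show ?thesis
  proof (rule hausdorff_measure_subset_null, safe)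
    fix x assume x: "x \<in> K" "lower_local_dim \<mu> x < ereal \<beta>"
    then obtain y where y: "lower_local_dim \<mu> x < ereal y" "ereal y < ereal \<beta>"
      using ereal_dense2 by blast
    have "0 \<le> y"
      using lower_local_dim_nonneg[OF borel_prob_measuresD(1)[OF \<mu>], of x] y(1)
      by (metis ereal_less_eq(5) less_imp_le order_trans)
    obtain \<gamma> where "\<gamma> \<in> \<rat>" "y < \<gamma>" "\<gamma> < \<beta>" using y(2) Rats_dense_in_real[of y \<beta>] by auto
    then have "\<gamma> \<in> Q" "lower_local_dim \<mu> x < ereal \<gamma>"
      using y \<open>0 \<le> y\<close> by (auto simp: Q_def intro: less_trans)
    then show "x \<in> (\<Union>\<gamma>\<in>Q. {x\<in>K. lower_local_dim \<mu> x < ereal \<gamma>})" using x by blast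
  qed
qed

text \<open>For each \<open>s > \<alpha>\<close> the level set lies in the null set where the local
  dimension is below \<open>s\<close>. It contains \<open>Z\<close> up to the set where the local
  dimension is below \<open>\<alpha>\<close>, which is null at \<open>\<alpha>\<close>, so it is not
  null at \<open>\<alpha>\<close> itself.\<close>

lemma hausdorff_dim_lower_level_set:
  fixes K :: "'a::euclidean_space set"
  assumes \<mu>: "\<mu> \<in> borel_prob_measures K" and "0 \<le> \<alpha>" and "Z \<subseteq> K"
    and pos: "hausdorff_measure \<alpha> Z > 0" and le: "\<And>x. x \<in> Z \<Longrightarrow> lower_local_dim \<mu> x \<le> ereal \<alpha>"
  shows "hausdorff_dim (lower_level_set K \<mu> \<alpha>) = ereal \<alpha>"
proof (rule antisym)
  show "hausdorff_dim (lower_level_set K \<mu> \<alpha>) \<le> ereal \<alpha>"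
  proof (rule hausdorff_dim_leI[OF \<open>0 \<le> \<alpha>\<close>])
    fix s assume "\<alpha> < s"
    then have "0 \<le> s" "lower_level_set K \<mu> \<alpha> \<subseteq> {x\<in>K. lower_local_dim \<mu> x < ereal s}"
      using \<open>0 \<le> \<alpha>\<close> by (auto simp: lower_level_set_def)
    then show "hausdorff_measure s (lower_level_set K \<mu> \<alpha>) = 0"
      using hausdorff_measure_lower_local_dim_less[OF \<mu>] hausdorff_measure_subset_null by blast
  qed
  show "ereal \<alpha> \<le> hausdorff_dim (lower_level_set K \<mu> \<alpha>)"
  proof (rule hausdorff_dim_geI, rule notI)
    assume null: "hausdorff_measure \<alpha> (lower_level_set K \<mu> \<alpha>) = 0"
    define E where "E = (\<lambda>b. if b then lower_level_set K \<mu> \<alpha> else {x\<in>K. lower_local_dim \<mu> x < ereal \<alpha>})"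
    have "hausdorff_measure \<alpha> (\<Union>b\<in>UNIV. E b) = 0"
      using null hausdorff_measure_lower_local_dim_less[OF \<mu> \<open>0 \<le> \<alpha>\<close>]
      by (intro hausdorff_measure_UN_null) (auto simp: E_def)
    moreover have "Z \<subseteq> (\<Union>b\<in>UNIV. E b)"
      using le \<open>Z \<subseteq> K\<close> by (force simp: E_def lower_level_set_def UNIV_bool)
    ultimately show False using pos hausdorff_measure_subset_null by fastforce
  qed
qed

section \<open>Dyadic coding of compact sets\<close>

text \<open>A point is coded at level \<open>k\<close> by the list of the half-open dyadic cells of side \<open>2\<^sup>-\<^sup>1, \<dots>, 2\<^sup>-\<^sup>k\<close> that
  contain it, so that the nesting of cells becomes the prefix order.\<close>

definition dyadic_cell :: "nat \<Rightarrow> 'a::euclidean_space \<Rightarrow> 'a \<Rightarrow> int" where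
  "dyadic_cell k x = restrict (\<lambda>b. \<lfloor>2 ^ k * (x \<bullet> b)\<rfloor>) Basis"

definition dyadic_code :: "nat \<Rightarrow> 'a::euclidean_space \<Rightarrow> ('a \<Rightarrow> int) list" where
  "dyadic_code k x = map (\<lambda>j. dyadic_cell (Suc j) x) [0..<k]"

definition dyadic_codes :: "'a::euclidean_space set \<Rightarrow> ('a \<Rightarrow> int) list set" where
  "dyadic_codes K = {dyadic_code k x |k x. x \<in> K}"

definition dyadic_piece :: "'a::euclidean_space set \<Rightarrow> ('a \<Rightarrow> int) list \<Rightarrow> 'a set" where
  "dyadic_piece K w = {y\<in>K. dyadic_code (length w) y = w}"

text \<open>Cells are half-open, so the pieces need not be closed; with closures, and for bounded
  \<open>K\<close>, the limit set of a tree is a decreasing intersection of compact sets, though it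
  may contain points whose own codes leave \<open>T\<close>.\<close>

definition limit_set :: "'a::euclidean_space set \<Rightarrow> ('a \<Rightarrow> int) list set \<Rightarrow> 'a set" where
  "limit_set K T = {x. \<forall>k. \<exists>w\<in>T. length w = k \<and> x \<in> closure (dyadic_piece K w)}"

section \<open>Geometry of dyadic cells and codes\<close>

lemma length_dyadic_code [simp]: "length (dyadic_code k x) = k"
  by (simp add: dyadic_code_def)

lemma take_dyadic_code: "take j (dyadic_code k x) = dyadic_code (min j k) x"
  by (simp add: dyadic_code_def take_map take_upt min_def)

lemma dyadic_codesE:
  assumes "w \<in> dyadic_codes K"
  obtains x where "x \<in> K" "w = dyadic_code (length w) x"
  using assms unfolding dyadic_codes_def by auto

lemma dyadic_piece_prefix:
  assumes "prefix u w" shows "dyadic_piece K w \<subseteq> dyadic_piece K u"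
proof
  fix y assume "y \<in> dyadic_piece K w"
  then have y: "y \<in> K" "w = dyadic_code (length w) y" by (auto simp: dyadic_piece_def)
  have "u = take (length u) w" using assms by (auto simp: prefix_def)
  also have "\<dots> = dyadic_code (length u) y"
    using prefix_length_le[OF assms] by (subst y(2)) (simp add: take_dyadic_code min_def)
  finally show "y \<in> dyadic_piece K u" using y by (simp add: dyadic_piece_def)
qed

lemma dyadic_cell_Suc:
  assumes "dyadic_cell (Suc j) x = dyadic_cell (Suc j) y"
  shows "dyadic_cell j x = dyadic_cell j y"
proof -
  have "\<lfloor>2 ^ j * (z \<bullet> b)\<rfloor> = \<lfloor>2 ^ Suc j * (z \<bullet> b)\<rfloor> div 2" for z b :: 'a
    using floor_divide_real_eq_div[of 2 "2 ^ Suc j * (z \<bullet> b)"] by simp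
  moreover have "\<lfloor>2 ^ Suc j * (x \<bullet> b)\<rfloor> = \<lfloor>2 ^ Suc j * (y \<bullet> b)\<rfloor>" if "b \<in> Basis" for b
    using fun_cong[OF assms, of b] that by (simp add: dyadic_cell_def del: power_Suc)
  ultimately show ?thesis
    unfolding dyadic_cell_def by (intro restrict_ext) metis
qed

lemma dyadic_cell_coarser:
  "i \<le> j \<Longrightarrow> dyadic_cell j x = dyadic_cell j y \<Longrightarrow> dyadic_cell i x = dyadic_cell i y"
  by (induction rule: inc_induct) (auto intro: dyadic_cell_Suc)

lemma dyadic_code_eq:
  "dyadic_cell k x = dyadic_cell k y \<Longrightarrow> dyadic_code k x = dyadic_code k y"
  unfolding dyadic_code_def by (auto intro!: dyadic_cell_coarser[where j = k])

lemma dist_dyadic_code: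
  fixes x y :: "'a::euclidean_space"
  assumes "0 < k" "dyadic_code k x = dyadic_code k y"
  shows "dist x y \<le> DIM('a) * (1/2) ^ k"
proof -
  have "dyadic_code k x ! (k - 1) = dyadic_code k y ! (k - 1)" using assms(2) by simp
  then have cell: "dyadic_cell k x = dyadic_cell k y" using assms(1) by (simp add: dyadic_code_def)
  have "\<bar>(x - y) \<bullet> b\<bar> \<le> (1/2) ^ k" if "b \<in> Basis" for b
  proof -
    have "\<lfloor>2 ^ k * (x \<bullet> b)\<rfloor> = \<lfloor>2 ^ k * (y \<bullet> b)\<rfloor>"
      using fun_cong[OF cell, of b] that by (simp add: dyadic_cell_def)
    then have "\<bar>2 ^ k * (x \<bullet> b) - 2 ^ k * (y \<bullet> b)\<bar> \<le> 1" by linarith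
    moreover have "2 ^ k * (x \<bullet> b) - 2 ^ k * (y \<bullet> b) = 2 ^ k * ((x - y) \<bullet> b)"
      by (simp add: inner_diff_left algebra_simps)
    ultimately have "2 ^ k * \<bar>(x - y) \<bullet> b\<bar> \<le> 1" by (simp add: abs_mult)
    then show ?thesis by (simp add: field_simps)
  qed
  then have "(\<Sum>b\<in>Basis. \<bar>(x - y) \<bullet> b\<bar>) \<le> (\<Sum>b\<in>(Basis :: 'a set). (1/2) ^ k)"
    by (rule sum_mono)
  then show ?thesis
    using norm_le_l1[of "x - y"] by (simp add: dist_norm)
qed

text \<open>A code is determined by its finest cell, so counting cells bounds the number of
  codes.\<close>

lemma dyadic_code_image:
  assumes "finite (dyadic_cell k ` S)"
  shows "finite (dyadic_code k ` S)" "card (dyadic_code k ` S) \<le> card (dyadic_cell k ` S)"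
proof -
  define g where "g = (\<lambda>c. dyadic_code k (SOME x :: 'a. dyadic_cell k x = c))"
  have "dyadic_code k x = g (dyadic_cell k x)" for x
    unfolding g_def by (rule dyadic_code_eq) (metis (mono_tags, lifting) someI)
  then have "dyadic_code k ` S = g ` dyadic_cell k ` S" by (auto simp: image_image)
  then show "finite (dyadic_code k ` S)" "card (dyadic_code k ` S) \<le> card (dyadic_cell k ` S)"
    using assms by (auto intro: card_image_le)
qed

lemma finite_dyadic_code_bounded:
  assumes "bounded K" shows "finite (dyadic_code k ` K)"
proof (rule dyadic_code_image)
  obtain B where B: "\<And>x. x \<in> K \<Longrightarrow> norm x \<le> B" using assms unfolding bounded_iff by blast
  define m where "m = \<lceil>2 ^ k * B\<rceil> + 1"
  have "dyadic_cell k ` K \<subseteq> (\<Pi>\<^sub>E b\<in>Basis. {- m..m})"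
  proof safe
    fix x b :: 'a assume x: "x \<in> K" and b: "b \<in> Basis"
    have "2 ^ k * \<bar>x \<bullet> b\<bar> \<le> 2 ^ k * B"
      using Basis_le_norm[OF b, of x] B[OF x] by (intro mult_left_mono) auto
    then have "\<bar>2 ^ k * (x \<bullet> b)\<bar> \<le> 2 ^ k * B" by (simp add: abs_mult)
    then show "dyadic_cell k x b \<in> {- m..m}"
      unfolding dyadic_cell_def m_def using b by simp linarith
  qed (simp add: dyadic_cell_def)
  then show "finite (dyadic_cell k ` K)" by (rule finite_subset) (auto intro!: finite_PiE)
qed

text \<open>A ball whose radius is at most the side of a cell meets at most three consecutive cells
  in each coordinate direction.\<close>

lemma card_dyadic_code_ball:
  fixes x :: "'a::euclidean_space"
  assumes "r \<le> (1/2) ^ k"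
  shows "finite (dyadic_code k ` ball x r)" "card (dyadic_code k ` ball x r) \<le> 3 ^ DIM('a)"
proof -
  let ?m = "\<lambda>b. \<lfloor>2 ^ k * (x \<bullet> b)\<rfloor>"
  have sub: "dyadic_cell k ` ball x r \<subseteq> (\<Pi>\<^sub>E b\<in>Basis. {?m b - 1..?m b + 1})"
  proof safe
    fix y b :: 'a assume y: "y \<in> ball x r" and b: "b \<in> Basis"
    have "\<bar>(x - y) \<bullet> b\<bar> < (1/2) ^ k"
      using Basis_le_norm[OF b, of "x - y"] y assms by (simp add: dist_norm)
    then have "2 ^ k * \<bar>(x - y) \<bullet> b\<bar> < 1" by (simp add: field_simps)
    then have "\<bar>2 ^ k * ((x - y) \<bullet> b)\<bar> < 1" by (simp add: abs_mult)
    then have "\<bar>2 ^ k * (x \<bullet> b) - 2 ^ k * (y \<bullet> b)\<bar> < 1"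
      by (simp add: inner_diff_left algebra_simps)
    then show "dyadic_cell k y b \<in> {?m b - 1..?m b + 1}"
      unfolding dyadic_cell_def using b by simp linarith
  qed (simp add: dyadic_cell_def)
  have fin: "finite (\<Pi>\<^sub>E b\<in>(Basis :: 'a set). {?m b - 1..?m b + 1})" by (intro finite_PiE) auto
  have "card (\<Pi>\<^sub>E b\<in>(Basis :: 'a set). {?m b - 1..?m b + 1}) = 3 ^ DIM('a)"
    by (subst card_PiE) auto
  then have "card (dyadic_cell k ` ball x r) \<le> 3 ^ DIM('a)"
    using card_mono[OF fin sub] by simp
  then show "finite (dyadic_code k ` ball x r)" "card (dyadic_code k ` ball x r) \<le> 3 ^ DIM('a)"
    using dyadic_code_image[OF finite_subset[OF sub fin]] by auto
qed

lemma is_tree_dyadic_codes: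
  assumes "bounded K" shows "is_tree (dyadic_codes K)"
proof -
  have "{w \<in> dyadic_codes K. length w = k} \<subseteq> dyadic_code k ` K" for k
    by (auto simp: dyadic_codes_def)
  then have "finite {w \<in> dyadic_codes K. length w = k}" for k
    using finite_dyadic_code_bounded[OF assms] finite_subset by blast
  moreover have "u \<in> dyadic_codes K" if w: "w \<in> dyadic_codes K" and u: "prefix u w" for u w
  proof -
    obtain x where x: "x \<in> K" "w = dyadic_code (length w) x" using w by (rule dyadic_codesE)
    have "x \<in> dyadic_piece K w" using x by (simp add: dyadic_piece_def)
    then have "x \<in> dyadic_piece K u" using dyadic_piece_prefix[OF u] by blast
    then have "x \<in> K \<and> u = dyadic_code (length u) x" by (simp add: dyadic_piece_def)
    then show ?thesis unfolding dyadic_codes_def by blast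
  qed
  ultimately show ?thesis unfolding is_tree_def by blast
qed

section \<open>Limit sets of trees, covers by balls and Hausdorff measure\<close>

lemma limit_set_subset:
  assumes "closed K" shows "limit_set K T \<subseteq> K"
proof
  fix x assume "x \<in> limit_set K T"
  then obtain w where "x \<in> closure (dyadic_piece K w)" unfolding limit_set_def by blast
  moreover have "dyadic_piece K w \<subseteq> K" by (auto simp: dyadic_piece_def)
  ultimately show "x \<in> K" using assms closure_minimal by blast
qed

lemma limit_set_mono: "S \<subseteq> T \<Longrightarrow> limit_set K S \<subseteq> limit_set K T"
  unfolding limit_set_def by blast

text \<open>The covers are finite so that asking all their balls to be heavy is a weakly open
  condition, and centred in \<open>K\<close> so that point masses can be put there.\<close>

definition ball_coverable :: "'a::metric_space set \<Rightarrow> real \<Rightarrow> 'a set \<Rightarrow> bool" where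
  "ball_coverable K \<beta> E \<longleftrightarrow> (\<forall>\<epsilon>>0. \<exists>Y. finite Y \<and> Y \<subseteq> K \<times> {0<..<\<epsilon>}
    \<and> E \<subseteq> (\<Union>(x, r)\<in>Y. ball x r) \<and> (\<Sum>(x, r)\<in>Y. r powr \<beta>) \<le> \<epsilon>)"

lemma ball_coverableE:
  assumes "ball_coverable K \<beta> E" "0 < \<epsilon>"
  obtains Y where "finite Y" "Y \<subseteq> K \<times> {0<..<\<epsilon>}" "E \<subseteq> (\<Union>(x, r)\<in>Y. ball x r)"
    "(\<Sum>(x, r)\<in>Y. r powr \<beta>) \<le> \<epsilon>"
  using assms(1)[unfolded ball_coverable_def, rule_format, OF assms(2)]
  by (elim exE conjE) (rule that)

lemma ball_coverableI:
  fixes x :: "'i \<Rightarrow> 'a::metric_space"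
  assumes "\<And>\<epsilon>::real. 0 < \<epsilon> \<Longrightarrow> \<exists>J (x :: 'i \<Rightarrow> 'a) r. finite J \<and> (\<forall>j\<in>J. x j \<in> K \<and> 0 < r j \<and> r j < \<epsilon>)
    \<and> E \<subseteq> (\<Union>j\<in>J. ball (x j) (r j)) \<and> (\<Sum>j\<in>J. r j powr \<beta>) \<le> \<epsilon>"
  shows "ball_coverable K \<beta> E"
  unfolding ball_coverable_def
proof (intro allI impI)
  fix \<epsilon> :: real assume "0 < \<epsilon>"
  obtain J and x :: "'i \<Rightarrow> 'a" and r where J: "finite J" "\<And>j. j \<in> J \<Longrightarrow> x j \<in> K \<and> 0 < r j \<and> r j < \<epsilon>"
    "E \<subseteq> (\<Union>j\<in>J. ball (x j) (r j))" "(\<Sum>j\<in>J. r j powr \<beta>) \<le> \<epsilon>"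
    using assms[OF \<open>0 < \<epsilon>\<close>] by metis
  have "(\<Sum>(x, r)\<in>(\<lambda>j. (x j, r j)) ` J. r powr \<beta>) \<le> (\<Sum>j\<in>J. r j powr \<beta>)"
    using sum_image_le[OF J(1), of "\<lambda>(x, r). r powr \<beta>" "\<lambda>j. (x j, r j)"] by simp
  then show "\<exists>Y. finite Y \<and> Y \<subseteq> K \<times> {0<..<\<epsilon>}
    \<and> E \<subseteq> (\<Union>(x, r)\<in>Y. ball x r) \<and> (\<Sum>(x, r)\<in>Y. r powr \<beta>) \<le> \<epsilon>"
    using J by (intro exI[of _ "(\<lambda>j. (x j, r j)) ` J"]) auto
qed

lemma ball_coverable_null:
  fixes E :: "'a::euclidean_space set"
  assumes "compact E" "E \<subseteq> K" "0 \<le> \<beta>" and null: "hausdorff_measure \<beta> E = 0"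
  shows "ball_coverable K \<beta> E"
proof (rule ball_coverableI)
  fix \<epsilon> :: real assume "0 < \<epsilon>"
  \<comment> \<open>The covering sets and the enlargement of their diameters to radii each
    contribute \<open>e\<close> to the sum, hence the half. The bound \<open>e < 1\<close> serves
    exponent 0, where one nonempty set already costs 1.\<close>
  define e where "e = min \<epsilon> 1 / 2"
  have e: "0 < e" "e < 1" "2 * e \<le> \<epsilon>" using \<open>0 < \<epsilon>\<close> by (auto simp: e_def)
  have "hausdorff_premeasure \<beta> e E = 0"
    using null e(1) unfolding hausdorff_measure_eq_0_iff by blast
  then obtain U where U: "E \<subseteq> (\<Union>i::nat. U i)" "\<And>i. bounded (U i) \<and> diameter (U i) \<le> e"
      and sum: "(\<Sum>i. diam_pow \<beta> (U i)) < ennreal e"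
    using hausdorff_premeasure_0_cover[of \<beta> e E "ennreal e"] e(1) by auto
  show "\<exists>J (x :: nat \<Rightarrow> 'a) r. finite J \<and> (\<forall>j\<in>J. x j \<in> K \<and> 0 < r j \<and> r j < \<epsilon>)
    \<and> E \<subseteq> (\<Union>j\<in>J. ball (x j) (r j)) \<and> (\<Sum>j\<in>J. r j powr \<beta>) \<le> \<epsilon>"
  proof (cases "\<beta> = 0")
    case True
    have "U i = {}" for i
    proof (rule ccontr)
      assume "U i \<noteq> {}"
      then have "1 = (\<Sum>j\<in>{i}. diam_pow \<beta> (U j))" using True by (simp add: diam_pow_def)
      also have "\<dots> \<le> (\<Sum>i. diam_pow \<beta> (U i))" by (rule sum_le_suminf) auto
      also have "\<dots> < ennreal 1" using sum e(2) by (meson ennreal_leI less_imp_le order_less_le_trans)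
      finally show False by simp
    qed
    then have "E = {}" using U(1) by auto
    then show ?thesis using \<open>0 < \<epsilon>\<close> by (intro exI[of _ "{}"]) auto
  next
    case False
    then have "0 < \<beta>" using assms by simp
    define I where "I = {i. U i \<inter> E \<noteq> {}}"
    have "\<forall>i\<in>I. \<exists>x. x \<in> U i \<inter> E" by (auto simp: I_def)
    then obtain x where x: "\<And>i. i \<in> I \<Longrightarrow> x i \<in> U i \<inter> E" by metis
    \<comment> \<open>Open balls take radii strictly above the diameter, even where it is 0;
      continuity of \<open>powr\<close> at the diameter keeps the added cost summable.\<close>
    have "\<exists>\<rho>. diameter (U i) < \<rho> \<and> \<rho> < 2 * e \<and> \<rho> powr \<beta> < diameter (U i) powr \<beta> + e * (1/2) ^ Suc i" for i
    proof -
      let ?d = "diameter (U i)"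
      have d: "0 \<le> ?d" "?d \<le> e" using U(2) diameter_ge_0 by auto
      have "\<forall>\<^sub>F \<rho> in at_right ?d. 0 \<le> \<rho>"
        using eventually_at_right_less[of ?d] by eventually_elim (use d in simp)
      then have "((\<lambda>\<rho>. \<rho> powr \<beta>) \<longlongrightarrow> ?d powr \<beta>) (at_right ?d)"
        using \<open>0 < \<beta>\<close> by (intro tendsto_powr' tendsto_ident_at tendsto_const) auto
      moreover have "?d powr \<beta> < ?d powr \<beta> + e * (1/2) ^ Suc i" using e by simp
      ultimately have "\<forall>\<^sub>F \<rho> in at_right ?d. \<rho> powr \<beta> < ?d powr \<beta> + e * (1/2) ^ Suc i"
        by (rule order_tendstoD)
      moreover have "\<forall>\<^sub>F \<rho> in at_right ?d. \<rho> \<in> {?d<..<2 * e}"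
        using d e by (intro eventually_at_right_real) auto
      ultimately have "\<forall>\<^sub>F \<rho> in at_right ?d. \<rho> \<in> {?d<..<2 * e} \<and> \<rho> powr \<beta> < ?d powr \<beta> + e * (1/2) ^ Suc i"
        by (rule eventually_conj[rotated])
      then have "\<exists>\<rho>. \<rho> \<in> {?d<..<2 * e} \<and> \<rho> powr \<beta> < ?d powr \<beta> + e * (1/2) ^ Suc i"
        by (rule eventually_happens'[OF trivial_limit_at_right_real])
      then show ?thesis by auto
    qed
    then obtain \<rho> where \<rho>: "\<And>i. diameter (U i) < \<rho> i" "\<And>i. \<rho> i < 2 * e"
        "\<And>i. \<rho> i powr \<beta> < diameter (U i) powr \<beta> + e * (1/2) ^ Suc i"
      by metis
    have \<rho>_pos: "0 < \<rho> i" for i using \<rho>(1)[of i] diameter_ge_0[of "U i"] U(2) by (meson le_less_trans)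
    have "E \<subseteq> (\<Union>i\<in>I. ball (x i) (\<rho> i))"
    proof
      fix y assume "y \<in> E"
      then obtain i where i: "y \<in> U i" using U(1) by blast
      then have "i \<in> I" using \<open>y \<in> E\<close> by (auto simp: I_def)
      have "dist (x i) y \<le> diameter (U i)"
        using diameter_bounded_bound[of "U i" "x i" y] U(2) i x[OF \<open>i \<in> I\<close>] by auto
      then show "y \<in> (\<Union>i\<in>I. ball (x i) (\<rho> i))" using \<rho>(1)[of i] \<open>i \<in> I\<close> by (intro UN_I[of i]) auto
    qed
    then obtain J where J: "J \<subseteq> I" "finite J" "E \<subseteq> (\<Union>i\<in>J. ball (x i) (\<rho> i))"
      using compactE_image[OF \<open>compact E\<close>, of I "\<lambda>i. ball (x i) (\<rho> i)"] by auto
    have "(\<Sum>i\<in>J. \<rho> i powr \<beta>) \<le> (\<Sum>i\<in>J. diameter (U i) powr \<beta> + e * (1/2) ^ Suc i)"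
      using \<rho>(3) by (intro sum_mono less_imp_le)
    also have "\<dots> = (\<Sum>i\<in>J. diameter (U i) powr \<beta>) + e * (\<Sum>i\<in>J. (1/2) ^ Suc i)"
      by (simp add: sum.distrib sum_distrib_left)
    also have "\<dots> \<le> e + e * 1"
    proof (intro add_mono mult_left_mono)
      have "ennreal (\<Sum>i\<in>J. diameter (U i) powr \<beta>) = (\<Sum>i\<in>J. ennreal (diameter (U i) powr \<beta>))"
        by (rule sum_ennreal[symmetric]) auto
      also have "\<dots> = (\<Sum>i\<in>J. diam_pow \<beta> (U i))"
        using J(1) False by (intro sum.cong) (auto simp: I_def diam_pow_def)
      also have "\<dots> \<le> (\<Sum>i. diam_pow \<beta> (U i))" using J(2) by (intro sum_le_suminf) auto
      also have "\<dots> \<le> ennreal e" using sum by simp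
      finally show "(\<Sum>i\<in>J. diameter (U i) powr \<beta>) \<le> e" using e by (simp add: ennreal_le_iff)
      have "(\<Sum>i\<in>J. (1/2::real) ^ Suc i) \<le> (\<Sum>i. (1/2) ^ Suc i)"
        using J(2) power_half_series by (intro sum_le_suminf) (auto simp: sums_iff)
      then show "(\<Sum>i\<in>J. (1/2::real) ^ Suc i) \<le> 1" using power_half_series by (simp add: sums_iff)
    qed (use e in auto)
    finally have "(\<Sum>i\<in>J. \<rho> i powr \<beta>) \<le> \<epsilon>" using e by simp
    moreover have "x i \<in> K \<and> 0 < \<rho> i \<and> \<rho> i < \<epsilon>" if "i \<in> J" for i
      using that x[of i] J(1) \<open>E \<subseteq> K\<close> \<rho>_pos[of i] \<rho>(2)[of i] e(3) by auto
    ultimately show ?thesis using J(2,3) by blast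
  qed
qed

lemma powr_half_length: "2 powr (- \<beta> * real n) = ((1/2) ^ n) powr \<beta>"
proof -
  have "((1/2::real) ^ n) = 2 powr (- real n)"
    by (simp add: powr_minus powr_realpow power_one_over inverse_eq_divide)
  then show ?thesis by (simp add: powr_powr mult.commute)
qed

lemma ball_coverable_thin:
  fixes K :: "'a::euclidean_space set"
  assumes T: "is_tree T" "thin \<gamma> T" and "0 \<le> \<gamma>" "\<gamma> < \<beta>"
  shows "ball_coverable K \<beta> (limit_set K T)"
proof (rule ball_coverableI)
  fix \<epsilon> :: real assume "0 < \<epsilon>"
  have "0 < \<beta>" using assms by simp
  \<comment> \<open>Pieces of level \<open>k > 0\<close> have diameter at most
    \<open>DIM('a) / 2^k\<close>; doubling lets an open ball around one point contain the closure of
    the piece.\<close>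
  define D where "D = 2 * real DIM('a)"
  have "0 < D" by (simp add: D_def)
  have "(\<lambda>N. D * (1/2) ^ N) \<longlonglongrightarrow> D * 0"
    by (intro tendsto_mult tendsto_const LIMSEQ_realpow_zero) auto
  then have "\<forall>\<^sub>F N in sequentially. D * (1/2) ^ N < \<epsilon>"
    using \<open>0 < \<epsilon>\<close> by (intro order_tendstoD) auto
  then obtain N where N: "D * (1/2) ^ N < \<epsilon>"
    using eventually_happens'[OF sequentially_bot] by blast
  \<comment> \<open>The second entry is below the cost of any single word of length at most
    \<open>N\<close>, so a cut of cost at most \<open>e\<close> consists of deep words, that is, of
    small cells.\<close>
  define e where "e = min (\<epsilon> / D powr \<beta>) (2 powr (- \<beta> * real N) / 2)"
  have "0 < e" "e < 2 powr (- \<beta> * real N)" "e \<le> \<epsilon> / D powr \<beta>"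
    using \<open>0 < D\<close> \<open>0 < \<epsilon>\<close> by (auto simp: e_def min_less_iff_disj)
  obtain C where C: "finite C" "cuts C T" "cost \<beta> C \<le> e"
    using T(2) \<open>\<gamma> < \<beta>\<close> \<open>0 < e\<close> unfolding thin_def by blast
  have deep: "N < length u" if "u \<in> C" for u
  proof (rule ccontr)
    assume "\<not> N < length u"
    then have "2 powr (- \<beta> * real N) \<le> 2 powr (- \<beta> * real (length u))"
      using \<open>0 < \<beta>\<close> by (intro powr_mono) auto
    then show False using cost_member[OF C(1) that, of \<beta>] C(3) \<open>e < _\<close> by linarith
  qed
  define J where "J = {u\<in>C. dyadic_piece K u \<noteq> {}}"
  have "\<forall>u\<in>J. \<exists>x. x \<in> dyadic_piece K u" by (auto simp: J_def)
  then obtain x where x: "\<And>u. u \<in> J \<Longrightarrow> x u \<in> dyadic_piece K u" by metis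
  define r where "r = (\<lambda>u :: ('a \<Rightarrow> int) list. D * (1/2) ^ length u)"
  have r: "0 < r u" "r u < \<epsilon>" if "u \<in> J" for u
  proof -
    have "(1/2::real) ^ length u \<le> (1/2) ^ N"
      using deep[of u] that by (intro power_decreasing) (auto simp: J_def)
    then have "D * (1/2) ^ length u \<le> D * (1/2) ^ N" using \<open>0 < D\<close> by (intro mult_left_mono) auto
    then show "r u < \<epsilon>" using N unfolding r_def by linarith
    show "0 < r u" using \<open>0 < D\<close> by (simp add: r_def)
  qed
  have piece: "closure (dyadic_piece K u) \<subseteq> ball (x u) (r u)" if u: "u \<in> J" for u
  proof -
    have "dyadic_piece K u \<subseteq> cball (x u) (r u / 2)"
    proof
      fix y assume "y \<in> dyadic_piece K u"
      then have "dyadic_code (length u) (x u) = dyadic_code (length u) y" "0 < length u"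
        using x[OF u] deep[of u] u by (auto simp: dyadic_piece_def J_def)
      then show "y \<in> cball (x u) (r u / 2)"
        using dist_dyadic_code[of "length u" "x u" y] by (simp add: r_def D_def)
    qed
    then have "closure (dyadic_piece K u) \<subseteq> cball (x u) (r u / 2)" by (simp add: closure_minimal)
    also have "\<dots> \<subseteq> ball (x u) (r u)" using r(1)[OF u] by auto
    finally show ?thesis .
  qed
  show "\<exists>J (x :: ('a \<Rightarrow> int) list \<Rightarrow> 'a) r. finite J \<and> (\<forall>j\<in>J. x j \<in> K \<and> 0 < r j \<and> r j < \<epsilon>)
    \<and> limit_set K T \<subseteq> (\<Union>j\<in>J. ball (x j) (r j)) \<and> (\<Sum>j\<in>J. r j powr \<beta>) \<le> \<epsilon>"
  proof (intro exI conjI ballI)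
    show "finite J" using C(1) by (simp add: J_def)
    show "x u \<in> K" "0 < r u" "r u < \<epsilon>" if "u \<in> J" for u
      using x[OF that] r[OF that] by (auto simp: dyadic_piece_def)
    show "limit_set K T \<subseteq> (\<Union>u\<in>J. ball (x u) (r u))"
    proof
      fix y assume y: "y \<in> limit_set K T"
      obtain l where l: "\<And>w. w \<in> T \<Longrightarrow> length w = l \<Longrightarrow> \<exists>u\<in>C. prefix u w"
        using C(2) unfolding cuts_def by blast
      obtain w where w: "w \<in> T" "length w = l" "y \<in> closure (dyadic_piece K w)"
        using y unfolding limit_set_def by blast
      obtain u where u: "u \<in> C" "prefix u w" using l w by blast
      then have "y \<in> closure (dyadic_piece K u)"
        using w(3) closure_mono[OF dyadic_piece_prefix[OF u(2)]] by blast
      moreover from this have "u \<in> J" using u(1) by (auto simp: J_def)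
      ultimately show "y \<in> (\<Union>u\<in>J. ball (x u) (r u))" using piece by blast
    qed
    have "(\<Sum>u\<in>J. r u powr \<beta>) = D powr \<beta> * cost \<beta> J"
      using \<open>0 < D\<close> unfolding cost_def powr_half_length r_def by (simp add: powr_mult sum_distrib_left)
    also have "\<dots> \<le> D powr \<beta> * cost \<beta> C"
      unfolding cost_def using C(1) by (intro mult_left_mono sum_mono2) (auto simp: J_def)
    also have "\<dots> \<le> D powr \<beta> * (\<epsilon> / D powr \<beta>)"
      using C(3) \<open>e \<le> \<epsilon> / D powr \<beta>\<close> by (intro mult_left_mono) auto
    finally show "(\<Sum>u\<in>J. r u powr \<beta>) \<le> \<epsilon>" using \<open>0 < D\<close> by simp
  qed
qed

text \<open>If the limit set were null, finitely many balls of small total size would cover it and,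
  by compactness, a whole level of the tree. The codes of comparable size met by these balls would
  then form a cut of cost below \<open>c\<close>.\<close>

lemma limit_set_heavy:
  fixes K :: "'a::euclidean_space set"
  assumes "compact K" and T: "is_tree T" "T \<subseteq> dyadic_codes K" "heavy \<beta> c T" and "0 < c" "0 \<le> \<beta>"
  shows "hausdorff_measure \<beta> (limit_set K T) > 0"
proof (rule ccontr)
  assume "\<not> ?thesis"
  then have null: "hausdorff_measure \<beta> (limit_set K T) = 0" by (simp add: not_less)
  define D where "D = (\<lambda>k. \<Union>w\<in>{w\<in>T. length w = k}. closure (dyadic_piece K w))"
  have limit: "limit_set K T = (\<Inter>k. D k)" by (auto simp: limit_set_def D_def)
  have "compact (closure (dyadic_piece K w))" for w
    using compact_imp_bounded[OF \<open>compact K\<close>] unfolding compact_closure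
    by (rule bounded_subset) (auto simp: dyadic_piece_def)
  then have comp: "compact (D k)" for k
    unfolding D_def using T(1) by (intro compact_UN) (auto simp: is_tree_def)
  have D_mono: "D n \<subseteq> D m" if "m \<le> n" for m n
  proof
    fix y assume "y \<in> D n"
    then obtain w where w: "w \<in> T" "length w = n" "y \<in> closure (dyadic_piece K w)" by (auto simp: D_def)
    have "y \<in> closure (dyadic_piece K (take m w))"
      using w(3) closure_mono[OF dyadic_piece_prefix[OF take_is_prefix[of m w]]] by blast
    then show "y \<in> D m" unfolding D_def using is_tree_take[OF T(1) w(1), of m] w(2) that by auto
  qed
  have sub: "limit_set K T \<subseteq> K" using \<open>compact K\<close> by (intro limit_set_subset compact_imp_closed)
  have "closed (limit_set K T)"
    unfolding limit using comp by (intro closed_INT ballI compact_imp_closed)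
  then have "compact (K \<inter> limit_set K T)" using \<open>compact K\<close> by (rule compact_Int_closed[rotated])
  then have comp_limit: "compact (limit_set K T)" using sub by (simp add: Int_absorb1)
  have "ball_coverable K \<beta> (limit_set K T)"
    using sub comp_limit null \<open>0 \<le> \<beta>\<close> by (intro ball_coverable_null)
  \<comment> \<open>A ball of radius \<open>r\<close> meets at most \<open>3 ^ DIM('a)\<close> cells
    of the level chosen for it, and their side is at most \<open>2 * r\<close>.\<close>
  define M where "M = 3 ^ DIM('a) * 2 powr \<beta>"
  have "0 < M" by (simp add: M_def)
  define e where "e = min 1 (c / (2 * M))"
  have e: "0 < e" "e \<le> 1" "M * e < c" using \<open>0 < c\<close> \<open>0 < M\<close> by (auto simp: e_def min_def field_simps)
  obtain Y where Y: "finite Y" "Y \<subseteq> K \<times> {0<..<e}" "limit_set K T \<subseteq> (\<Union>(x, r)\<in>Y. ball x r)"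
      "(\<Sum>(x, r)\<in>Y. r powr \<beta>) \<le> e"
    using \<open>ball_coverable K \<beta> (limit_set K T)\<close> e(1) by (rule ball_coverableE)
  have "\<exists>j. r \<le> (1/2) ^ j \<and> (1/2) ^ j \<le> 2 * r" if r: "0 < r" "r < 1" for r :: real
  proof -
    obtain n where n: "(1/2) ^ n < r" using real_arch_pow_inv[OF r(1), of "1/2"] by auto
    define m where "m = (LEAST n. (1/2) ^ n < r)"
    have m: "(1/2) ^ m < r" unfolding m_def using n by (rule LeastI)
    then obtain j where j: "m = Suc j" using r by (cases m) auto
    have "\<not> (1/2) ^ j < r" using not_less_Least[of j "\<lambda>n. (1/2) ^ n < r"] j unfolding m_def by simp
    then show ?thesis using m j by (intro exI[of _ j]) auto
  qed
  then obtain j where j: "\<And>r :: real. 0 < r \<Longrightarrow> r < 1 \<Longrightarrow> r \<le> (1/2) ^ j r \<and> (1/2) ^ j r \<le> 2 * r"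
    by metis
  have rad: "r \<le> (1/2) ^ j r" "(1/2) ^ j r \<le> 2 * r" "0 < r" if "(x, r) \<in> Y" for x r
    using that Y(2) e(2) j[of r] by auto
  define C where "C = (\<Union>(x, r)\<in>Y. dyadic_code (j r) ` ball x r)"
  have fin: "finite (dyadic_code (j r) ` ball x r)" if "(x, r) \<in> Y" for x r
    using card_dyadic_code_ball(1)[OF rad(1)[OF that]] .
  have "finite C" unfolding C_def by (rule finite_UN_I[OF Y(1)]) (use fin in auto)
  have "cost \<beta> C \<le> (\<Sum>p\<in>Y. cost \<beta> (case p of (x, r) \<Rightarrow> dyadic_code (j r) ` ball x r))"
    unfolding C_def by (rule cost_UN_le[OF Y(1)]) (use fin in auto)
  also have "\<dots> \<le> (\<Sum>(x, r)\<in>Y. M * r powr \<beta>)"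
  proof (rule sum_mono, clarsimp)
    fix x r assume p: "(x, r) \<in> Y"
    have "cost \<beta> (dyadic_code (j r) ` ball x r) = (\<Sum>u\<in>dyadic_code (j r) ` ball x r. ((1/2) ^ j r) powr \<beta>)"
      unfolding cost_def powr_half_length by (intro sum.cong) auto
    also have "\<dots> = real (card (dyadic_code (j r) ` ball x r)) * (((1/2) ^ j r) powr \<beta>)"
      by (rule sum_constant)
    also have "\<dots> \<le> 3 ^ DIM('a) * (((1/2) ^ j r) powr \<beta>)"
      using of_nat_mono[OF card_dyadic_code_ball(2)[OF rad(1)[OF p], of x], where 'a = real]
      by (intro mult_right_mono) auto
    also have "\<dots> \<le> 3 ^ DIM('a) * ((2 * r) powr \<beta>)"
      using rad[OF p] \<open>0 \<le> \<beta>\<close> by (intro mult_left_mono powr_mono2) auto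
    also have "\<dots> = M * r powr \<beta>" using rad[OF p] by (simp add: M_def powr_mult)
    finally show "cost \<beta> (dyadic_code (j r) ` ball x r) \<le> M * r powr \<beta>" .
  qed
  also have "\<dots> = M * (\<Sum>(x, r)\<in>Y. r powr \<beta>)" by (simp add: sum_distrib_left case_prod_unfold)
  also have "\<dots> \<le> M * e" using Y(4) \<open>0 < M\<close> by (intro mult_left_mono) auto
  finally have "cost \<beta> C < c" using e(3) by simp
  define V where "V = (\<Union>(x, r)\<in>Y. ball x r)"
  have "open V" unfolding V_def by auto
  have "\<exists>k. D k \<subseteq> V"
  proof (rule ccontr)
    assume "\<not> (\<exists>k. D k \<subseteq> V)"
    then have "D k - V \<noteq> {}" for k by blast
    moreover have "compact (D k - V)" for k using comp \<open>open V\<close> by (rule compact_diff)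
    ultimately have "\<Inter>(range (\<lambda>k. D k - V)) \<noteq> {}" using D_mono by (intro compact_nest) blast+
    then show False using Y(3) unfolding limit V_def[symmetric] by blast
  qed
  then obtain k where k: "D k \<subseteq> V" by blast
  \<comment> \<open>Depth \<open>k\<close> puts the piece of a word inside \<open>V\<close>; the sum
    of the \<open>j r\<close> makes the word at least as long as every code in
    \<open>C\<close>.\<close>
  have "cuts C T"
  proof (rule cutsI[of _ "k + (\<Sum>(x, r)\<in>Y. j r)"])
    fix w assume w: "w \<in> T" "k + (\<Sum>(x, r)\<in>Y. j r) \<le> length w"
    obtain y where y: "y \<in> K" "w = dyadic_code (length w) y" using w(1) T(2) by (blast elim: dyadic_codesE)
    then have "y \<in> dyadic_piece K w" by (simp add: dyadic_piece_def)
    then have "y \<in> D (length w)" unfolding D_def using w(1) closure_subset by blast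
    then have "y \<in> V" using k D_mono[of k "length w"] w(2) by auto
    then obtain x r where p: "(x, r) \<in> Y" "y \<in> ball x r" unfolding V_def by auto
    have "j r \<le> (\<Sum>(x, r)\<in>Y. j r)" using member_le_sum[OF p(1), of "\<lambda>(x, r). j r"] Y(1) by auto
    then have "dyadic_code (j r) y = take (j r) w"
      using w(2) by (subst y(2)) (simp add: take_dyadic_code min_def)
    then have "prefix (dyadic_code (j r) y) w" by (simp add: take_is_prefix)
    moreover have "dyadic_code (j r) y \<in> C"
      unfolding C_def using p(2) by (intro UN_I[OF p(1)]) simp
    ultimately show "\<exists>u\<in>C. prefix u w" by blast
  qed
  then show False using T(3) \<open>finite C\<close> \<open>cost \<beta> C < c\<close> unfolding heavy_def by (meson not_le)
qed

text \<open>Positive measure gives a scale \<open>\<delta>\<close> of positive premeasure. A cut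
  with a word of length at most \<open>N\<close> costs at least \<open>2 powr (- t * N)\<close>; any
  other cut covers \<open>K\<close> by pieces of diameter at most \<open>\<delta>\<close>. The
  constant \<open>c\<close> is the smaller of the two resulting bounds.\<close>

lemma heavy_dyadic_codes:
  fixes K :: "'a::euclidean_space set"
  assumes "hausdorff_measure t K > 0" "0 < t" "bounded K"
  shows "\<exists>c>0. heavy t c (dyadic_codes K)"
proof -
  obtain \<delta> where \<delta>: "0 < \<delta>" "hausdorff_premeasure t \<delta> K \<noteq> 0"
    using assms(1) hausdorff_measure_eq_0_iff[of t K] by auto
  obtain p where p: "0 < p" "ennreal p \<le> hausdorff_premeasure t \<delta> K"
  proof (cases "hausdorff_premeasure t \<delta> K")
    case (real q)
    then show ?thesis using \<delta>(2) that[of q] by (cases "q = 0") auto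
  next
    case top
    then show ?thesis using that[of 1] by simp
  qed
  define D where "D = real DIM('a)"
  have "0 < D" by (simp add: D_def)
  have "(\<lambda>N. D * (1/2) ^ N) \<longlonglongrightarrow> D * 0"
    by (intro tendsto_mult tendsto_const LIMSEQ_realpow_zero) auto
  then have "\<forall>\<^sub>F N in sequentially. D * (1/2) ^ N < \<delta>"
    using \<delta>(1) by (intro order_tendstoD) auto
  then obtain N where N: "D * (1/2) ^ N < \<delta>"
    using eventually_happens'[OF sequentially_bot] by blast
  define c where "c = min (2 powr (- t * real N)) (p / D powr t)"
  have "0 < c" using p(1) \<open>0 < D\<close> by (simp add: c_def)
  moreover have "c \<le> cost t C" if C: "finite C" "cuts C (dyadic_codes K)" for C
  proof (cases "\<exists>u\<in>C. length u \<le> N")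
    case True
    then obtain u where u: "u \<in> C" "length u \<le> N" by blast
    then have "2 powr (- t * real N) \<le> 2 powr (- t * real (length u))"
      using \<open>0 < t\<close> by (intro powr_mono) auto
    then show ?thesis using cost_member[OF C(1) u(1), of t] unfolding c_def by linarith
  next
    case False
    then have deep: "N < length u" if "u \<in> C" for u using that by (simp add: not_le)
    have diam: "dist x y \<le> D * (1/2) ^ length u" if "u \<in> C" "x \<in> dyadic_piece K u" "y \<in> dyadic_piece K u" for u x y
    proof -
      have "dyadic_code (length u) x = dyadic_code (length u) y" using that by (simp add: dyadic_piece_def)
      moreover have "0 < length u" using deep[OF that(1)] by linarith
      ultimately show ?thesis unfolding D_def by (intro dist_dyadic_code)
    qed
    have diameter: "diameter (dyadic_piece K u) \<le> D * (1/2) ^ length u" if "u \<in> C" for u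
      using diam[OF that] \<open>0 < D\<close> by (intro diameter_le) (auto simp: dist_norm)
    have "hausdorff_premeasure t \<delta> K \<le> ennreal (D powr t * cost t C)"
    proof (rule hausdorff_premeasure_le_countable[of C _ "dyadic_piece K"])
      show "countable C" using C(1) by (rule countable_finite)
      obtain l where l: "\<And>w. w \<in> dyadic_codes K \<Longrightarrow> length w = l \<Longrightarrow> \<exists>u\<in>C. prefix u w"
        using C(2) unfolding cuts_def by blast
      show "K \<subseteq> (\<Union>u\<in>C. dyadic_piece K u)"
      proof
        fix y assume "y \<in> K"
        then have "dyadic_code l y \<in> dyadic_codes K" by (auto simp: dyadic_codes_def)
        then obtain u where u: "u \<in> C" "prefix u (dyadic_code l y)" using l by force
        have "y \<in> dyadic_piece K (dyadic_code l y)" using \<open>y \<in> K\<close> by (simp add: dyadic_piece_def)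
        then show "y \<in> (\<Union>u\<in>C. dyadic_piece K u)" using dyadic_piece_prefix[OF u(2)] u(1) by blast
      qed
      show "bounded (dyadic_piece K u) \<and> diameter (dyadic_piece K u) \<le> \<delta>" if "u \<in> C" for u
      proof
        show "bounded (dyadic_piece K u)"
          using \<open>bounded K\<close> by (rule bounded_subset) (auto simp: dyadic_piece_def)
        have "(1/2::real) ^ length u \<le> (1/2) ^ N" using deep[OF that] by (intro power_decreasing) auto
        then have "D * (1/2) ^ length u \<le> D * (1/2) ^ N" using \<open>0 < D\<close> by (intro mult_left_mono) auto
        then show "diameter (dyadic_piece K u) \<le> \<delta>" using diameter[OF that] N by linarith
      qed
      fix J assume J: "finite J" "J \<subseteq> C"
      have "(\<Sum>u\<in>J. diam_pow t (dyadic_piece K u)) \<le> (\<Sum>u\<in>J. ennreal (D powr t * 2 powr (- t * real (length u))))"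
      proof (rule sum_mono)
        fix u assume u: "u \<in> J"
        have "bounded (dyadic_piece K u)"
          using \<open>bounded K\<close> by (rule bounded_subset) (auto simp: dyadic_piece_def)
        then have "0 \<le> diameter (dyadic_piece K u)" by (rule diameter_ge_0)
        then have "diameter (dyadic_piece K u) powr t \<le> (D * (1/2) ^ length u) powr t"
          using diameter[of u] u J \<open>0 < t\<close> by (intro powr_mono2) auto
        also have "\<dots> = D powr t * 2 powr (- t * real (length u))"
          unfolding powr_half_length by (rule powr_mult)
        finally show "diam_pow t (dyadic_piece K u) \<le> ennreal (D powr t * 2 powr (- t * real (length u)))"
          using \<open>0 < t\<close> by (auto simp: diam_pow_def intro: ennreal_leI)
      qed
      also have "\<dots> = ennreal (D powr t * cost t J)"
        unfolding cost_def sum_distrib_left by (rule sum_ennreal) auto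
      also have "\<dots> \<le> ennreal (D powr t * cost t C)"
        unfolding cost_def using J(2) C(1) by (intro ennreal_leI mult_left_mono sum_mono2) auto
      finally show "(\<Sum>u\<in>J. diam_pow t (dyadic_piece K u)) \<le> ennreal (D powr t * cost t C)" .
    qed (use \<delta> in simp)
    then have "ennreal p \<le> ennreal (D powr t * cost t C)" using p(2) order_trans by blast
    then have "p \<le> D powr t * cost t C" using cost_nonneg[of t C] by (simp add: ennreal_le_iff)
    then have "p / D powr t \<le> cost t C" using \<open>0 < D\<close> by (simp add: field_simps)
    then show ?thesis unfolding c_def by linarith
  qed
  ultimately show ?thesis unfolding heavy_def by blast
qed

lemma nested_coverable_sets:
  fixes K :: "'a::euclidean_space set"
  assumes "compact K" "0 < t" "hausdorff_measure t K > 0"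
  obtains \<E> where "countable \<E>"
    "\<And>E \<gamma>. (E, \<gamma>) \<in> \<E> \<Longrightarrow> 0 \<le> \<gamma> \<and> (\<forall>\<beta>>\<gamma>. ball_coverable K \<beta> E)"
    "\<And>\<alpha>. 0 \<le> \<alpha> \<Longrightarrow> \<alpha> < t \<Longrightarrow> \<exists>Z\<subseteq>K. hausdorff_measure \<alpha> Z > 0 \<and> (\<forall>\<beta>>\<alpha>. \<exists>(E, \<gamma>)\<in>\<E>. \<gamma> < \<beta> \<and> Z \<subseteq> E)"
proof -
  let ?T = "dyadic_codes K"
  have tree: "is_tree ?T" using \<open>compact K\<close> by (intro is_tree_dyadic_codes compact_imp_bounded)
  obtain c where c: "0 < c" "heavy t c ?T"
    using heavy_dyadic_codes[OF assms(3,2) compact_imp_bounded[OF assms(1)]] by blast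
  obtain F :: "nat \<Rightarrow> nat \<Rightarrow> ('a \<Rightarrow> int) list set" where F: "\<And>n i. i \<le> 2^n \<Longrightarrow> is_tree (F n i) \<and> F n i \<subseteq> ?T"
    "\<And>n i. i < 2^n \<Longrightarrow> thin (i * t / 2^n) (F n i)"
    "\<And>\<alpha>. 0 \<le> \<alpha> \<Longrightarrow> \<alpha> < t \<Longrightarrow> \<exists>S. is_tree S \<and> S \<subseteq> ?T \<and> heavy \<alpha> c S
      \<and> (\<forall>\<beta>>\<alpha>. \<exists>n i. i < 2^n \<and> i * t / 2^n < \<beta> \<and> S \<subseteq> F n i)"
    by (rule nested_thin_trees[OF tree c(2) \<open>0 < t\<close> less_imp_le[OF c(1)]]) (rule that)
  define \<E> where "\<E> = (\<lambda>(n, i). (limit_set K (F n i), i * t / 2^n)) ` {(n, i). i < 2^n}"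
  show ?thesis
  proof (rule that[of \<E>])
    show "countable \<E>" unfolding \<E>_def by (intro countable_image) auto
    show "0 \<le> \<gamma> \<and> (\<forall>\<beta>>\<gamma>. ball_coverable K \<beta> E)" if "(E, \<gamma>) \<in> \<E>" for E \<gamma>
    proof -
      obtain n i where ni: "i < 2^n" "E = limit_set K (F n i)" "\<gamma> = i * t / 2^n"
        using \<open>(E, \<gamma>) \<in> \<E>\<close> by (auto simp: \<E>_def)
      moreover from this have "0 \<le> \<gamma>" using \<open>0 < t\<close> by simp
      ultimately show ?thesis
        using ball_coverable_thin[of "F n i" \<gamma>] F(1)[of i n] F(2)[of i n] by auto
    qed
    fix \<alpha> assume \<alpha>: "0 \<le> \<alpha>" "\<alpha> < t"
    then obtain S where S: "is_tree S" "S \<subseteq> ?T" "heavy \<alpha> c S"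
      "\<And>\<beta>. \<alpha> < \<beta> \<Longrightarrow> \<exists>n i. i < 2^n \<and> i * t / 2^n < \<beta> \<and> S \<subseteq> F n i"
      using F(3)[OF \<alpha>] by blast
    show "\<exists>Z\<subseteq>K. hausdorff_measure \<alpha> Z > 0 \<and> (\<forall>\<beta>>\<alpha>. \<exists>(E, \<gamma>)\<in>\<E>. \<gamma> < \<beta> \<and> Z \<subseteq> E)"
    proof (intro exI[of _ "limit_set K S"] conjI allI impI)
      show "limit_set K S \<subseteq> K" using \<open>compact K\<close> by (intro limit_set_subset compact_imp_closed)
      show "hausdorff_measure \<alpha> (limit_set K S) > 0"
        using limit_set_heavy[OF \<open>compact K\<close> S(1-3) c(1) \<alpha>(1)] .
      fix \<beta> assume "\<alpha> < \<beta>"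
      then obtain n i where ni: "i < 2^n" "i * t / 2^n < \<beta>" "S \<subseteq> F n i" using S(4) by blast
      then have "(limit_set K (F n i), i * t / 2^n) \<in> \<E>" by (force simp: \<E>_def)
      then show "\<exists>(E, \<gamma>)\<in>\<E>. \<gamma> < \<beta> \<and> limit_set K S \<subseteq> E"
        using ni limit_set_mono[OF ni(3)] by blast
    qed
  qed
qed

section \<open>Baire property of the weak topology\<close>

lemma topspace_weak_topology: "topspace (weak_topology K) = borel_prob_measures K"
proof -
  have "borel_prob_measures K = {\<mu> \<in> borel_prob_measures K. (\<integral>x. 0 \<partial>\<mu>) \<in> (UNIV :: real set)}" by simp
  moreover have "continuous_on K (\<lambda>x. 0 :: real)" "bounded ((\<lambda>x. 0 :: real) ` K)" "open (UNIV :: real set)"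
    by (auto simp: bounded_iff)
  ultimately have "borel_prob_measures K \<in> {{\<mu> \<in> borel_prob_measures K. (\<integral>x. f x \<partial>\<mu>) \<in> V} |(f :: 'a \<Rightarrow> real) V.
       continuous_on K f \<and> bounded (f ` K) \<and> open V}"
    by blast
  then show ?thesis
    unfolding weak_topology_def topology_generated_by_topspace by blast
qed

lemma openin_weak_topology:
  fixes f :: "'a::topological_space \<Rightarrow> real"
  assumes "continuous_on K f" "bounded (f ` K)" "open V"
  shows "openin (weak_topology K) {\<mu> \<in> borel_prob_measures K. (\<integral>x. f x \<partial>\<mu>) \<in> V}"
  unfolding weak_topology_def using assms by (intro topology_generated_by_Basis) blast

lemma integrable_borel_prob:
  fixes f :: "'a::topological_space \<Rightarrow> real"
  assumes \<mu>: "\<mu> \<in> borel_prob_measures K" and f: "continuous_on K f" and B: "\<And>x. x \<in> K \<Longrightarrow> \<bar>f x\<bar> \<le> B"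
  shows "integrable \<mu> f"
proof -
  interpret prob_space \<mu> by (rule borel_prob_measuresD(1)[OF \<mu>])
  have "f \<in> borel_measurable (restrict_space borel K)"
    using f by (rule borel_measurable_continuous_on_restrict)
  then have "f \<in> borel_measurable \<mu>"
    using measurable_cong_sets[OF borel_prob_measuresD(2)[OF \<mu>] refl] by blast
  then show ?thesis
    using B borel_prob_measuresD(3)[OF \<mu>] by (intro integrable_const_bound[of _ B]) auto
qed

text \<open>\<open>\<nu>\<close> is \<open>q\<close> times \<open>\<mu>\<close> plus a positive rest
  of mass \<open>1 - q\<close>, and the averages of \<open>f\<close> over both parts lie between
  \<open>- B\<close> and \<open>B\<close>.\<close>

lemma integral_diff_le_of_dominated:
  fixes f :: "'a::topological_space \<Rightarrow> real"
  assumes \<mu>: "\<mu> \<in> borel_prob_measures K" and \<nu>: "\<nu> \<in> borel_prob_measures K"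
    and f: "continuous_on K f" and B: "\<And>x. x \<in> K \<Longrightarrow> \<bar>f x\<bar> \<le> B"
    and q: "0 \<le> q" "q \<le> 1" and dom: "\<And>A. A \<in> sets \<mu> \<Longrightarrow> q * measure \<mu> A \<le> measure \<nu> A"
  shows "\<bar>(\<integral>x. f x \<partial>\<nu>) - (\<integral>x. f x \<partial>\<mu>)\<bar> \<le> 2 * B * (1 - q)"
proof -
  interpret M: prob_space \<mu> by (rule borel_prob_measuresD(1)[OF \<mu>])
  interpret N: prob_space \<nu> by (rule borel_prob_measuresD(1)[OF \<nu>])
  note [simp] = borel_prob_measuresD(3)[OF \<mu>] borel_prob_measuresD(3)[OF \<nu>]
  have sets: "sets \<mu> = sets \<nu>" using borel_prob_measuresD(2) \<mu> \<nu> by metis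
  have le: "scale_measure (ennreal q) \<mu> \<le> \<nu>"
    using dom q sets
    by (subst le_measure) (auto simp: M.emeasure_eq_measure N.emeasure_eq_measure ennreal_mult[symmetric] intro!: ennreal_leI)
  \<comment> \<open>Adding \<open>B\<close> makes the integrand nonnegative, so that domination of
    measures carries over to integrals; this is used for \<open>f\<close> and for its
    negative.\<close>
  have *: "q * (\<integral>x. B + g x \<partial>\<mu>) \<le> (\<integral>x. B + g x \<partial>\<nu>)"
    if g: "continuous_on K g" "\<And>x. x \<in> K \<Longrightarrow> \<bar>g x\<bar> \<le> B" for g :: "'a \<Rightarrow> real"
  proof -
    have int: "integrable \<mu> (\<lambda>x. B + g x)" "integrable \<nu> (\<lambda>x. B + g x)"
      using integrable_borel_prob[OF \<mu> g] integrable_borel_prob[OF \<nu> g] by auto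
    have pos: "0 \<le> B + g x" if "x \<in> K" for x using g(2)[OF that] by linarith
    have "ennreal (q * (\<integral>x. B + g x \<partial>\<mu>)) = ennreal q * (\<integral>\<^sup>+x. ennreal (B + g x) \<partial>\<mu>)"
    proof (subst nn_integral_eq_integral)
      have "0 \<le> (\<integral>x. B + g x \<partial>\<mu>)" using pos by (intro integral_nonneg_AE AE_I2) simp
      then show "ennreal (q * (\<integral>x. B + g x \<partial>\<mu>)) = ennreal q * ennreal (\<integral>x. B + g x \<partial>\<mu>)"
        using q by (intro ennreal_mult)
    qed (use int(1) pos in \<open>auto intro!: AE_I2\<close>)
    also have "\<dots> = (\<integral>\<^sup>+x. ennreal (B + g x) \<partial>scale_measure (ennreal q) \<mu>)"
      using int(1) by (intro nn_integral_scale_measure[symmetric]) auto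
    also have "\<dots> \<le> (\<integral>\<^sup>+x. ennreal (B + g x) \<partial>\<nu>)"
      using sets le by (intro nn_integral_mono_measure) auto
    also have "\<dots> = ennreal (\<integral>x. B + g x \<partial>\<nu>)"
      using int(2) pos by (intro nn_integral_eq_integral) (auto intro!: AE_I2)
    finally show ?thesis
      using pos by (subst (asm) ennreal_le_iff) (auto intro!: integral_nonneg_AE AE_I2)
  qed
  note int = integrable_borel_prob[OF \<mu> f B] integrable_borel_prob[OF \<nu> f B]
  have "\<bar>\<integral>x. f x \<partial>\<mu>\<bar> \<le> B"
  proof -
    have "(\<integral>x. f x \<partial>\<mu>) \<le> (\<integral>x. B \<partial>\<mu>)"
      using B by (intro integral_mono[OF int(1)]) (auto simp: abs_le_iff)
    moreover have "(\<integral>x. - B \<partial>\<mu>) \<le> (\<integral>x. f x \<partial>\<mu>)"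
      using B by (intro integral_mono[OF _ int(1)]) (auto simp: abs_le_iff minus_le_iff)
    ultimately show ?thesis using M.prob_space by simp
  qed
  moreover have "q * (B + (\<integral>x. f x \<partial>\<mu>)) \<le> B + (\<integral>x. f x \<partial>\<nu>)"
    using *[OF f B] int M.prob_space N.prob_space by simp
  moreover have "q * (B - (\<integral>x. f x \<partial>\<mu>)) \<le> B - (\<integral>x. f x \<partial>\<nu>)"
    using *[of "\<lambda>x. - f x"] f B int M.prob_space N.prob_space by (simp add: continuous_on_minus)
  moreover have "(1 - q) * (\<integral>x. f x \<partial>\<mu>) \<le> (1 - q) * B" "(1 - q) * (- B) \<le> (1 - q) * (\<integral>x. f x \<partial>\<mu>)"
    using q \<open>\<bar>\<integral>x. f x \<partial>\<mu>\<bar> \<le> B\<close> by (intro mult_left_mono; linarith)+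
  ultimately show ?thesis by (simp add: algebra_simps abs_le_iff)
qed

text \<open>Because of this fact, perturbations that are small in total variation, for which limits are easy
  to construct, suffice for the Baire property; compactness of the space of measures is not needed.\<close>

lemma weak_topology_dominated:
  assumes W: "openin (weak_topology K) W" and \<mu>: "\<mu> \<in> W"
  shows "\<exists>q. 0 < q \<and> q < 1 \<and> (\<forall>\<nu>\<in>borel_prob_measures K.
    (\<forall>A\<in>sets \<mu>. q * measure \<mu> A \<le> measure \<nu> A) \<longrightarrow> \<nu> \<in> W)"
proof -
  have mono: "\<forall>A\<in>sets \<mu>. p * measure \<mu> A \<le> measure \<nu> A"
    if "p \<le> q" "\<forall>A\<in>sets \<mu>. q * measure \<mu> A \<le> measure \<nu> A" for p q \<nu>
    using that by (meson measure_nonneg mult_right_mono order_trans)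
  have "generate_topology_on {{\<mu> \<in> borel_prob_measures K. (\<integral>x. f x \<partial>\<mu>) \<in> V} |(f :: 'a \<Rightarrow> real) V.
       continuous_on K f \<and> bounded (f ` K) \<and> open V} W"
    using W unfolding weak_topology_def by (rule openin_topology_generated_by)
  then show ?thesis
    using \<mu>
  proof (induction rule: generate_topology_on.induct)
    case Empty
    then show ?case by simp
  next
    case (Int a b)
    obtain p where p: "0 < p" "p < 1" "\<And>\<nu>. \<nu> \<in> borel_prob_measures K \<Longrightarrow> \<forall>A\<in>sets \<mu>. p * measure \<mu> A \<le> measure \<nu> A \<Longrightarrow> \<nu> \<in> a"
      using Int by blast
    obtain q where q: "0 < q" "q < 1" "\<And>\<nu>. \<nu> \<in> borel_prob_measures K \<Longrightarrow> \<forall>A\<in>sets \<mu>. q * measure \<mu> A \<le> measure \<nu> A \<Longrightarrow> \<nu> \<in> b"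
      using Int by blast
    show ?case
      using p q mono[of p "max p q"] mono[of q "max p q"]
      by (intro exI[of _ "max p q"]) auto
  next
    case (UN \<K>)
    then obtain k where "k \<in> \<K>" "\<mu> \<in> k" by blast
    with UN.IH show ?case by (metis Union_iff)
  next
    case (Basis s)
    then obtain f :: "'a \<Rightarrow> real" and V where s: "s = {\<mu> \<in> borel_prob_measures K. (\<integral>x. f x \<partial>\<mu>) \<in> V}"
      and f: "continuous_on K f" "bounded (f ` K)" "open V" by blast
    obtain B where B: "0 < B" "\<And>x. x \<in> K \<Longrightarrow> \<bar>f x\<bar> \<le> B"
      using f(2) unfolding bounded_pos by auto
    have \<mu>': "\<mu> \<in> borel_prob_measures K" "(\<integral>x. f x \<partial>\<mu>) \<in> V" using Basis s by auto
    obtain e where e: "0 < e" "\<And>y. \<bar>y - (\<integral>x. f x \<partial>\<mu>)\<bar> < e \<Longrightarrow> y \<in> V"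
      using f(3) \<mu>'(2) unfolding open_dist dist_real_def by blast
    \<comment> \<open>Chosen so that \<open>2 * B * (1 - q)\<close> is at most \<open>e / 2\<close>;
      the maximum keeps \<open>q\<close> positive.\<close>
    define q where "q = max (1/2) (1 - e / (4 * B))"
    have q: "0 < q" "q < 1" "2 * B * (1 - q) < e"
      using e(1) B(1) by (auto simp: q_def max_def field_simps)
    show ?case
    proof (intro exI[of _ q] conjI q ballI impI)
      fix \<nu> assume \<nu>: "\<nu> \<in> borel_prob_measures K" "\<forall>A\<in>sets \<mu>. q * measure \<mu> A \<le> measure \<nu> A"
      have "\<bar>(\<integral>x. f x \<partial>\<nu>) - (\<integral>x. f x \<partial>\<mu>)\<bar> \<le> 2 * B * (1 - q)"
        using \<nu> q by (intro integral_diff_le_of_dominated[OF \<mu>'(1) \<nu>(1) f(1) B(2)]) auto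
      then show "\<nu> \<in> s" using \<nu>(1) e(2) q(3) unfolding s by auto
    qed
  qed
qed

text \<open>The measures \<open>c n\<close> times \<open>\<mu> n\<close> increase, and their masses
  stay below every \<open>b m\<close>. Normalising their supremum by its mass, which is at most
  \<open>b n\<close>, leaves at least \<open>c n / b n\<close> times \<open>\<mu> n\<close>.\<close>

lemma limit_of_increasing_measures:
  assumes \<mu>: "\<And>n. \<mu> n \<in> borel_prob_measures K" and c: "\<And>n. 0 < c n" "\<And>n. c n < b n"
    and b: "\<And>n. b (Suc n) \<le> b n"
    and inc: "\<And>n A. A \<in> sets (\<mu> n) \<Longrightarrow> c n * measure (\<mu> n) A \<le> c (Suc n) * measure (\<mu> (Suc n)) A"
  shows "\<exists>\<nu>\<in>borel_prob_measures K. \<forall>n. \<forall>A\<in>sets (\<mu> n). c n / b n * measure (\<mu> n) A \<le> measure \<nu> A"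
proof -
  let ?R = "restrict_space borel K"
  have em: "emeasure (\<mu> n) A = ennreal (measure (\<mu> n) A)" for n A
    using prob_space.finite_measure[OF borel_prob_measuresD(1)[OF \<mu>]] by (rule finite_measure.emeasure_eq_measure)
  have sets: "sets (\<mu> n) = sets ?R" for n by (rule borel_prob_measuresD(2)[OF \<mu>])
  have K: "K \<in> sets ?R" by (metis sets.top space_restrict_space space_borel Int_UNIV_right)
  have \<mu>K: "measure (\<mu> n) K = 1" for n
    using prob_space.prob_space[OF borel_prob_measuresD(1)[OF \<mu>]] borel_prob_measuresD(3)[OF \<mu>] by metis
  define l where "l = (\<lambda>n. scale_measure (ennreal (c n)) (\<mu> n))"
  have sets_l: "sets (l n) = sets ?R" for n by (simp add: l_def sets)
  have em_l: "emeasure (l n) A = ennreal (c n * measure (\<mu> n) A)" for n A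
    using c(1)[of n] by (simp add: l_def em ennreal_mult)
  have "l n \<le> l (Suc n)" for n
    by (subst le_measure) (auto simp: sets_l em_l sets intro!: ennreal_leI inc)
  then have mono: "l m \<le> l n" if "m \<le> n" for m n using that by (rule lift_Suc_mono_le)
  then have chain: "Complete_Partial_Order.chain (\<le>) (range l)"
    unfolding Complete_Partial_Order.chain_def by (metis nle_le rangeE)
  define L where "L = (SUP n. l n)"
  have sets_L: "sets L = sets ?R" unfolding L_def by (rule sets_SUP) (auto simp: sets_l)
  have em_L: "emeasure L A = (SUP n. ennreal (c n * measure (\<mu> n) A))" if "A \<in> sets ?R" for A
    unfolding L_def using emeasure_SUP_chain[OF _ that chain] by (simp add: sets_l em_l)
  have b_mono: "b n \<le> b m" if "m \<le> n" for m n using lift_Suc_antimono_le[of b, OF b that] .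
  have c_mono: "c m \<le> c n" if "m \<le> n" for m n
    using lift_Suc_mono_le[of c, OF _ that] inc[of K] K by (simp add: sets \<mu>K)
  have "emeasure L K \<le> ennreal (b n)" for n
    unfolding em_L[OF K]
  proof (rule SUP_least)
    fix m
    have "c m \<le> b n"
      using c_mono[of m "max m n"] c(2)[of "max m n"] b_mono[of n "max m n"] by linarith
    then show "ennreal (c m * measure (\<mu> m) K) \<le> ennreal (b n)" by (simp add: \<mu>K ennreal_leI)
  qed
  moreover have low: "ennreal (c n) \<le> emeasure L K" for n
    unfolding em_L[OF K] using SUP_upper[of n UNIV "\<lambda>n. ennreal (c n * measure (\<mu> n) K)"] by (simp add: \<mu>K)
  ultimately obtain z where z: "emeasure L K = ennreal z" "0 \<le> z" "\<And>n. z \<le> b n"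
  proof (cases "emeasure L K")
    case (real r)
    then show ?thesis
      using that[of r] \<open>\<And>n. emeasure L K \<le> ennreal (b n)\<close> c less_imp_le less_trans
      by (metis ennreal_le_iff)
  next
    case top
    then show ?thesis using \<open>\<And>n. emeasure L K \<le> ennreal (b n)\<close>[of 0] by (simp add: top_unique)
  qed
  have "0 < z" using low[of 0] c(1)[of 0] z(1,2) by (simp add: ennreal_le_iff)
  define \<nu> where "\<nu> = scale_measure (ennreal (1 / z)) L"
  have "emeasure \<nu> (space \<nu>) = 1"
    using z \<open>0 < z\<close> sets_eq_imp_space_eq[OF sets_L]
    by (simp add: \<nu>_def space_scale_measure space_restrict_space ennreal_mult[symmetric])
  then have prob: "prob_space \<nu>" by (rule prob_spaceI)
  then have \<nu>: "\<nu> \<in> borel_prob_measures K"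
    unfolding borel_prob_measures_def by (simp add: \<nu>_def sets_L)
  have "c n / b n * measure (\<mu> n) A \<le> measure \<nu> A" if A: "A \<in> sets (\<mu> n)" for n A
  proof -
    have "ennreal (1 / z * (c n * measure (\<mu> n) A)) = ennreal (1 / z) * ennreal (c n * measure (\<mu> n) A)"
      using \<open>0 < z\<close> c(1)[of n] by (intro ennreal_mult) auto
    also have "\<dots> \<le> ennreal (1 / z) * emeasure L A"
      using em_L[of A] A sets by (intro mult_left_mono) (auto intro: SUP_upper)
    also have "\<dots> = ennreal (measure \<nu> A)"
      using finite_measure.emeasure_eq_measure[OF prob_space.finite_measure[OF prob], of A] by (simp add: \<nu>_def)
    finally have "1 / z * (c n * measure (\<mu> n) A) \<le> measure \<nu> A" by simp
    moreover have "1 / b n * (c n * measure (\<mu> n) A) \<le> 1 / z * (c n * measure (\<mu> n) A)"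
      using \<open>0 < z\<close> z(3)[of n] c(1)[of n] by (intro mult_right_mono) (auto simp: frac_le)
    ultimately show ?thesis by simp
  qed
  then show ?thesis using \<nu> by blast
qed

text \<open>The nested balls of Baire's argument become sets of measures above a multiple of a given
  one: \<open>(\<mu>, c, b)\<close> stands for all \<open>\<nu>\<close> that dominate
  \<open>c / b\<close> times \<open>\<mu>\<close>. Each step raises \<open>c\<close>, so that the
  measures \<open>c\<close> times \<open>\<mu>\<close> increase, while \<open>b\<close> bounds all
  later values of \<open>c\<close>.\<close>

lemma weak_topology_Baire:
  assumes op: "\<And>n. openin (weak_topology K) (U n)"
    and dense: "\<And>n \<mu> q. \<mu> \<in> borel_prob_measures K \<Longrightarrow> 0 < q \<Longrightarrow> q < 1 \<Longrightarrow>
      \<exists>\<nu>\<in>U n. \<forall>A\<in>sets \<mu>. q * measure \<mu> A \<le> measure \<nu> A"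
  shows "weak_topology K closure_of (\<Inter>n::nat. U n) = topspace (weak_topology K)"
  unfolding dense_intersects_open
proof (intro allI impI)
  fix W assume W: "openin (weak_topology K) W \<and> W \<noteq> {}"
  then obtain \<mu>0 where \<mu>0: "\<mu>0 \<in> W" by blast
  define V where "V = (\<lambda>n. case n of 0 \<Rightarrow> W | Suc n \<Rightarrow> U n)"
  have sub: "V n \<subseteq> borel_prob_measures K" for n
    using W op openin_subset unfolding V_def topspace_weak_topology[symmetric] by (cases n) auto
  have V_open: "openin (weak_topology K) (V n)" for n using W op by (cases n) (auto simp: V_def)
  define P where "P = (\<lambda>n (\<mu>, c, b). \<mu> \<in> borel_prob_measures K \<and> 0 < c \<and> c < b \<and>
    (\<forall>\<nu>\<in>borel_prob_measures K. (\<forall>A\<in>sets \<mu>. c / b * measure \<mu> A \<le> measure \<nu> A) \<longrightarrow> \<nu> \<in> V n))"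
  define Q where "Q = (\<lambda>(n::nat) (\<mu> :: 'a measure, c :: real, b :: real) (\<mu>', c', b'). b' \<le> b \<and>
    (\<forall>A\<in>sets \<mu>. c * measure \<mu> A \<le> c' * measure \<mu>' A))"
  have P_exists: "\<exists>b'\<le>b. P n (\<mu>, c, b')" if V: "\<mu> \<in> V n" "0 < c" "c < b" for n \<mu> c b
  proof -
    obtain q where q: "0 < q" "q < 1" "\<And>\<nu>. \<nu> \<in> borel_prob_measures K \<Longrightarrow>
        \<forall>A\<in>sets \<mu>. q * measure \<mu> A \<le> measure \<nu> A \<Longrightarrow> \<nu> \<in> V n"
      using weak_topology_dominated[OF V_open V(1)] by blast
    define b' where "b' = min b (c / q)"
    have b': "c < b'" "b' \<le> b" "q \<le> c / b'"
      using V q by (auto simp: b'_def min_def field_simps)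
    have "\<nu> \<in> V n" if "\<nu> \<in> borel_prob_measures K" "\<forall>A\<in>sets \<mu>. c / b' * measure \<mu> A \<le> measure \<nu> A" for \<nu>
      using q(3)[OF that(1)] that(2) b'(3) by (meson measure_nonneg mult_right_mono order_trans)
    then show ?thesis using b' V sub by (intro exI[of _ b']) (auto simp: P_def)
  qed
  have "\<exists>f. \<forall>n. P n (f n) \<and> Q n (f n) (f (Suc n))"
  proof (rule dependent_nat_choice)
    show "\<exists>x. P 0 x" using P_exists[of \<mu>0 0 1 2] \<mu>0 by (auto simp: V_def)
    fix x n assume x: "P n x"
    obtain \<mu> c b where x_eq: "x = (\<mu>, c, b)" by (cases x)
    have \<mu>: "\<mu> \<in> borel_prob_measures K" "0 < c" "c < b" using x unfolding x_eq P_def by auto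
    \<comment> \<open>Any value strictly between \<open>c / b\<close> and 1 works: the new factor
      \<open>c / q\<close> is then still below \<open>b\<close>.\<close>
    define q where "q = (1 + c / b) / 2"
    have q: "0 < q" "q < 1" "c / q < b" using \<mu> by (auto simp: q_def field_simps)
    obtain \<nu> where \<nu>: "\<nu> \<in> U n" "\<And>A. A \<in> sets \<mu> \<Longrightarrow> q * measure \<mu> A \<le> measure \<nu> A"
      using dense[OF \<mu>(1) q(1,2)] by blast
    obtain b' where b': "b' \<le> b" "P (Suc n) (\<nu>, c / q, b')"
      using P_exists[of \<nu> "Suc n" "c / q" b] \<nu>(1) q \<mu>(2) by (auto simp: V_def)
    have "c * measure \<mu> A \<le> c / q * measure \<nu> A" if "A \<in> sets \<mu>" for A
      using mult_left_mono[OF \<nu>(2)[OF that], of "c / q"] q \<mu>(2) by simp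
    then have "Q n x (\<nu>, c / q, b')" using b' by (simp add: Q_def x_eq)
    then show "\<exists>y. P (Suc n) y \<and> Q n x y" using b' by blast
  qed
  then obtain f where f: "\<And>n. P n (f n)" "\<And>n. Q n (f n) (f (Suc n))" by blast
  define \<mu> c b where "\<mu> = (\<lambda>n. fst (f n))" and "c = (\<lambda>n. fst (snd (f n)))" and "b = (\<lambda>n. snd (snd (f n)))"
  have f_eq: "f n = (\<mu> n, c n, b n)" for n by (simp add: \<mu>_def c_def b_def)
  have P: "\<mu> n \<in> borel_prob_measures K" "0 < c n" "c n < b n"
    "\<And>\<nu>. \<nu> \<in> borel_prob_measures K \<Longrightarrow> \<forall>A\<in>sets (\<mu> n). c n / b n * measure (\<mu> n) A \<le> measure \<nu> A \<Longrightarrow> \<nu> \<in> V n" for n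
    using f(1)[of n] unfolding f_eq P_def by auto
  have Q: "b (Suc n) \<le> b n" "\<And>A. A \<in> sets (\<mu> n) \<Longrightarrow> c n * measure (\<mu> n) A \<le> c (Suc n) * measure (\<mu> (Suc n)) A" for n
    using f(2)[of n] unfolding f_eq Q_def by auto
  obtain \<nu> where "\<nu> \<in> borel_prob_measures K" "\<And>n. \<forall>A\<in>sets (\<mu> n). c n / b n * measure (\<mu> n) A \<le> measure \<nu> A"
    using limit_of_increasing_measures[of \<mu> K c b, OF P(1-3) Q] by blast
  then have \<nu>: "\<nu> \<in> V n" for n using P(4) by blast
  have "\<nu> \<in> W" using \<nu>[of 0] by (simp add: V_def)
  moreover have "\<nu> \<in> U n" for n using \<nu>[of "Suc n"] by (simp add: V_def)
  ultimately show "(\<Inter>n. U n) \<inter> W \<noteq> {}" by blast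
qed

section \<open>Typical measures\<close>

text \<open>The indicator of an open ball is the increasing limit of the continuous functions
  \<open>f m\<close>, so its mass exceeds \<open>a\<close> exactly when one of their integrals
  does.\<close>

lemma openin_measure_ball_greater:
  fixes K :: "'a::metric_space set"
  shows "openin (weak_topology K) {\<mu> \<in> borel_prob_measures K. a < measure \<mu> (ball x r \<inter> K)}"
proof -
  define f where "f = (\<lambda>(m::nat) y. min 1 (real m * max 0 (r - dist x y)))"
  have cont: "continuous_on K (f m)" for m unfolding f_def by (intro continuous_intros)
  have f01: "0 \<le> f m y" "f m y \<le> 1" for m y by (auto simp: f_def)
  have f_out: "f m y = 0" if "y \<notin> ball x r" for m y using that by (simp add: f_def)
  have eq: "{\<mu> \<in> borel_prob_measures K. a < measure \<mu> (ball x r \<inter> K)}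
    = (\<Union>m. {\<mu> \<in> borel_prob_measures K. (\<integral>y. f m y \<partial>\<mu>) \<in> {a<..}})"
  proof (rule set_eqI)
    fix \<mu> :: "'a measure"
    show "\<mu> \<in> {\<mu> \<in> borel_prob_measures K. a < measure \<mu> (ball x r \<inter> K)}
      \<longleftrightarrow> \<mu> \<in> (\<Union>m. {\<mu> \<in> borel_prob_measures K. (\<integral>y. f m y \<partial>\<mu>) \<in> {a<..}})"
    proof (cases "\<mu> \<in> borel_prob_measures K")
      case \<mu>: True
      interpret prob_space \<mu> by (rule borel_prob_measuresD(1)[OF \<mu>])
      define S where "S = ball x r \<inter> K"
      have S: "S \<in> sets \<mu>" unfolding S_def by (rule ball_Int_sets[OF \<mu>])
      have sp: "space \<mu> = K" by (rule borel_prob_measuresD(3)[OF \<mu>])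
      have int: "integrable \<mu> (f m)" for m
        using f01 by (intro integrable_borel_prob[OF \<mu> cont, where B = 1]) simp
      have intS: "integrable \<mu> (indicator S :: 'a \<Rightarrow> real)"
        using S by (intro integrable_real_indicator) (simp_all add: emeasure_eq_measure)
      have integral_S: "(\<integral>y. indicator S y \<partial>\<mu>) = measure \<mu> S"
        using S sp by (simp add: S_def Int_absorb2)
      have le: "(\<integral>y. f m y \<partial>\<mu>) \<le> measure \<mu> S" for m
        unfolding integral_S[symmetric]
      proof (rule integral_mono[OF int intS])
        fix y assume "y \<in> space \<mu>"
        then show "f m y \<le> indicator S y"
          using f01 f_out sp by (cases "y \<in> S") (auto simp: S_def)
      qed
      have lim: "(\<lambda>m. \<integral>y. f m y \<partial>\<mu>) \<longlonglongrightarrow> measure \<mu> S"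
        unfolding integral_S[symmetric]
      proof (rule integral_dominated_convergence[where w = "\<lambda>_. 1"])
        show "AE y in \<mu>. (\<lambda>m. f m y) \<longlonglongrightarrow> indicator S y"
        proof (rule AE_I2)
          fix y assume "y \<in> space \<mu>"
          show "(\<lambda>m. f m y) \<longlonglongrightarrow> indicator S y"
          proof (cases "y \<in> S")
            case True
            then have pos: "0 < r - dist x y" by (simp add: S_def)
            obtain N :: nat where N: "1 / (r - dist x y) < N" using reals_Archimedean2 by blast
            have "f m y = 1" if "m \<ge> N" for m
            proof -
              have "1 / (r - dist x y) \<le> m" using N that by linarith
              then have "1 \<le> m * (r - dist x y)" using pos by (simp add: field_simps)
              then show ?thesis using pos by (simp add: f_def)
            qed
            then have "\<forall>\<^sub>F m in sequentially. f m y = 1" by (auto simp: eventually_sequentially)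
            then show ?thesis using True by (simp add: tendsto_eventually)
          next
            case False
            then show ?thesis using f_out \<open>y \<in> space \<mu>\<close> sp by (auto simp: S_def)
          qed
        qed
        show "AE y in \<mu>. norm (f m y) \<le> 1" for m using f01 by (intro AE_I2) (simp add: abs_le_iff)
      qed (use int intS in auto)
      have "a < measure \<mu> S \<longleftrightarrow> (\<exists>m. a < (\<integral>y. f m y \<partial>\<mu>))"
      proof
        assume "a < measure \<mu> S"
        then have "\<forall>\<^sub>F m in sequentially. a < (\<integral>y. f m y \<partial>\<mu>)" using lim by (intro order_tendstoD)
        then show "\<exists>m. a < (\<integral>y. f m y \<partial>\<mu>)" using eventually_happens'[OF sequentially_bot] by blast
      next
        assume "\<exists>m. a < (\<integral>y. f m y \<partial>\<mu>)"
        then show "a < measure \<mu> S" using le order_less_le_trans by blast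
      qed
      then show ?thesis using \<mu> by (simp add: S_def)
    qed simp
  qed
  have "bounded (f m ` K)" for m
    unfolding bounded_iff using f01 by (intro exI[of _ 1]) simp
  then have "openin (weak_topology K) {\<mu> \<in> borel_prob_measures K. (\<integral>y. f m y \<partial>\<mu>) \<in> {a<..}}" for m
    using cont by (intro openin_weak_topology) auto
  then show ?thesis unfolding eq by blast
qed

lemma openin_finite_Collect:
  assumes "finite Y" "\<And>p. p \<in> Y \<Longrightarrow> openin X {\<mu> \<in> topspace X. P p \<mu>}"
  shows "openin X {\<mu> \<in> topspace X. \<forall>p\<in>Y. P p \<mu>}"
  using assms
proof (induction Y rule: finite_induct)
  case (insert p Y)
  have "{\<mu> \<in> topspace X. \<forall>p\<in>insert p Y. P p \<mu>} = {\<mu> \<in> topspace X. P p \<mu>} \<inter> {\<mu> \<in> topspace X. \<forall>p\<in>Y. P p \<mu>}"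
    by auto
  then show ?case using insert by auto
qed simp

text \<open>The factor \<open>2\<close> in the required mass accounts for recentring: a point of \<open>ball x r\<close> is the centre of
  a ball of radius \<open>2 r\<close> that contains \<open>ball x r\<close>.\<close>

definition ball_charged :: "'a::metric_space set \<Rightarrow> 'a set \<Rightarrow> real \<Rightarrow> real \<Rightarrow> 'a measure set" where
  "ball_charged K E \<beta> \<delta> = {\<mu> \<in> borel_prob_measures K. \<exists>Y. finite Y \<and> Y \<subseteq> K \<times> {0<..<\<delta>}
    \<and> E \<subseteq> (\<Union>(x, r)\<in>Y. ball x r) \<and> (\<forall>(x, r)\<in>Y. (2 * r) powr \<beta> < measure \<mu> (ball x r \<inter> K))}"

lemma openin_ball_charged: "openin (weak_topology K) (ball_charged K E \<beta> \<delta>)"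
proof -
  define \<Y> where "\<Y> = {Y. finite Y \<and> Y \<subseteq> K \<times> {0<..<\<delta>} \<and> E \<subseteq> (\<Union>(x, r)\<in>Y. ball x r)}"
  have eq: "ball_charged K E \<beta> \<delta> = (\<Union>Y\<in>\<Y>. {\<mu> \<in> topspace (weak_topology K).
      \<forall>p\<in>Y. case p of (x, r) \<Rightarrow> (2 * r) powr \<beta> < measure \<mu> (ball x r \<inter> K)})"
    unfolding ball_charged_def topspace_weak_topology \<Y>_def by blast
  have "openin (weak_topology K) {\<mu> \<in> topspace (weak_topology K).
      \<forall>p\<in>Y. case p of (x, r) \<Rightarrow> (2 * r) powr \<beta> < measure \<mu> (ball x r \<inter> K)}" if "Y \<in> \<Y>" for Y
  proof (rule openin_finite_Collect)
    show "finite Y" using that by (simp add: \<Y>_def)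
    show "openin (weak_topology K) {\<mu> \<in> topspace (weak_topology K).
      case p of (x, r) \<Rightarrow> (2 * r) powr \<beta> < measure \<mu> (ball x r \<inter> K)}" for p
      using openin_measure_ball_greater[of K "(2 * snd p) powr \<beta>" "fst p" "snd p"]
      by (simp add: case_prod_unfold topspace_weak_topology)
  qed
  then show ?thesis unfolding eq by blast
qed

lemma borel_prob_mixture:
  assumes \<mu>: "\<mu> \<in> borel_prob_measures K" and \<kappa>: "\<kappa> \<in> borel_prob_measures K" and q: "0 \<le> q" "q \<le> 1"
  shows "\<exists>\<nu>\<in>borel_prob_measures K. \<forall>A\<in>sets \<mu>. measure \<nu> A = q * measure \<mu> A + (1 - q) * measure \<kappa> A"
proof -
  interpret M: prob_space \<mu> by (rule borel_prob_measuresD(1)[OF \<mu>])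
  interpret N: prob_space \<kappa> by (rule borel_prob_measuresD(1)[OF \<kappa>])
  let ?R = "restrict_space borel K"
  define F where "F = (\<lambda>b. if b then \<mu> else \<kappa>)"
  have F: "F \<in> measurable (measure_pmf (bernoulli_pmf q)) (subprob_algebra ?R)"
  proof -
    have "F b \<in> space (subprob_algebra ?R)" for b
      using borel_prob_measuresD(2)[OF \<mu>] borel_prob_measuresD(2)[OF \<kappa>] M.prob_space_axioms N.prob_space_axioms
      by (cases b) (simp_all add: F_def space_subprob_algebra prob_space_imp_subprob_space)
    then show ?thesis by simp
  qed
  \<comment> \<open>The convex combination of the two measures, obtained by drawing one of them at
    random.\<close>
  define \<nu> where "\<nu> = measure_pmf (bernoulli_pmf q) \<bind> F"
  have "prob_space \<nu>" unfolding \<nu>_def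
    by (rule prob_space.prob_space_bind[OF measure_pmf.prob_space_axioms _ F])
       (auto simp: F_def M.prob_space_axioms N.prob_space_axioms)
  moreover have sets: "sets \<nu> = sets ?R"
    unfolding \<nu>_def using sets_kernel[OF F] by (intro sets_bind) auto
  ultimately have \<nu>: "\<nu> \<in> borel_prob_measures K" by (simp add: borel_prob_measures_def)
  interpret L: prob_space \<nu> by fact
  have "measure \<nu> A = q * measure \<mu> A + (1 - q) * measure \<kappa> A" if A: "A \<in> sets \<mu>" for A
  proof -
    have "A \<in> sets ?R" using A borel_prob_measuresD(2)[OF \<mu>] by simp
    then have "emeasure \<nu> A = (\<integral>\<^sup>+b. emeasure (F b) A \<partial>measure_pmf (bernoulli_pmf q))"
      unfolding \<nu>_def using F by (intro emeasure_bind) auto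
    also have "\<dots> = emeasure \<mu> A * ennreal q + emeasure \<kappa> A * ennreal (1 - q)"
      using q by (simp add: F_def)
    also have "\<dots> = ennreal (q * measure \<mu> A + (1 - q) * measure \<kappa> A)"
      using q by (simp add: M.emeasure_eq_measure N.emeasure_eq_measure ennreal_mult[symmetric] ennreal_plus[symmetric] mult.commute del: ennreal_plus)
    finally show ?thesis using q unfolding L.emeasure_eq_measure
      by (subst (asm) ennreal_inj) auto
  qed
  then show ?thesis using \<nu> by blast
qed

lemma atomic_borel_prob:
  fixes K :: "'a::metric_space set" and Y :: "('a \<times> real) set"
  assumes Y: "finite Y" "Y \<noteq> {}" "Y \<subseteq> K \<times> {0<..}" and sum: "(\<Sum>(x, r)\<in>Y. r powr \<beta>) \<le> 1"
  shows "\<exists>\<kappa>\<in>borel_prob_measures K. \<forall>(x, r)\<in>Y. r powr \<beta> \<le> measure \<kappa> (ball x r \<inter> K)"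
proof -
  let ?R = "restrict_space borel K"
  define w where "w = (\<lambda>p :: 'a \<times> real. snd p powr \<beta>)"
  have w: "0 < w p" if "p \<in> Y" for p using that Y(3) by (auto simp: w_def)
  \<comment> \<open>The total weight is at most 1, so normalising can only increase the
    masses.\<close>
  define Z where "Z = (\<Sum>p\<in>Y. w p)"
  have Z: "0 < Z" "Z \<le> 1"
    using w Y(1,2) sum by (auto simp: Z_def w_def case_prod_unfold intro!: sum_pos)
  define h where "h = (\<lambda>p. if p \<in> Y then w p / Z else 0)"
  have h_nonneg: "0 \<le> h p" for p using w[of p] Z by (auto simp: h_def less_imp_le)
  have "(\<integral>\<^sup>+p. ennreal (h p) \<partial>count_space UNIV) = (\<Sum>p\<in>Y. ennreal (h p))"
    by (rule nn_integral_count_space'[OF Y(1)]) (auto simp: h_def)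
  also have "\<dots> = ennreal (\<Sum>p\<in>Y. h p)" by (rule sum_ennreal) (rule h_nonneg)
  also have "(\<Sum>p\<in>Y. h p) = 1" using Z by (simp add: h_def sum_divide_distrib[symmetric] Z_def[symmetric])
  finally have int: "(\<integral>\<^sup>+p. ennreal (h p) \<partial>count_space UNIV) = 1" by simp
  define P where "P = embed_pmf h"
  have pmf_P: "pmf P p = h p" for p unfolding P_def using h_nonneg int by (intro pmf_embed_pmf)
  obtain x0 where x0: "x0 \<in> K" using Y(2,3) by auto
  \<comment> \<open>Several pairs may share a centre, so the weights sit on pairs and are pushed
    forward to centres; off \<open>Y\<close> the value is an arbitrary point of
    \<open>K\<close>.\<close>
  define g where "g = (\<lambda>p :: 'a \<times> real. if p \<in> Y then fst p else x0)"
  have "g p \<in> K" for p using x0 Y(3) by (auto simp: g_def)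
  then have g: "g \<in> measurable (measure_pmf P) ?R"
    by (auto simp: space_restrict_space)
  define \<kappa> where "\<kappa> = distr (measure_pmf P) ?R g"
  have "prob_space \<kappa>" unfolding \<kappa>_def using g by (rule measure_pmf.prob_space_distr)
  then have \<kappa>: "\<kappa> \<in> borel_prob_measures K" by (simp add: borel_prob_measures_def \<kappa>_def)
  have "r powr \<beta> \<le> measure \<kappa> (ball x r \<inter> K)" if p: "(x, r) \<in> Y" for x r
  proof -
    have "0 < r" "x \<in> K" using p Y(3) by auto
    have "r powr \<beta> \<le> w (x, r) / Z" using Z w[OF p] by (simp add: w_def field_simps mult_left_le)
    also have "\<dots> = measure (measure_pmf P) {(x, r)}" using p by (simp add: measure_pmf_single pmf_P h_def)
    also have "\<dots> \<le> measure (measure_pmf P) (g -` (ball x r \<inter> K) \<inter> space (measure_pmf P))"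
      using p \<open>0 < r\<close> \<open>x \<in> K\<close> by (intro measure_pmf.finite_measure_mono) (auto simp: g_def)
    also have "\<dots> = measure \<kappa> (ball x r \<inter> K)"
      unfolding \<kappa>_def using ball_Int_sets[OF \<kappa>] g by (intro measure_distr[symmetric]) (auto simp: \<kappa>_def)
    finally show ?thesis .
  qed
  then show ?thesis using \<kappa> by blast
qed

lemma ball_charged_dense:
  fixes K :: "'a::metric_space set"
  assumes cov: "\<And>\<beta>. \<gamma> < \<beta> \<Longrightarrow> ball_coverable K \<beta> E" and "\<gamma> < \<beta>" "0 < \<delta>"
    and \<mu>: "\<mu> \<in> borel_prob_measures K" and q: "0 < q" "q < 1"
  shows "\<exists>\<nu>\<in>ball_charged K E \<beta> \<delta>. \<forall>A\<in>sets \<mu>. q * measure \<mu> A \<le> measure \<nu> A"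
proof -
  \<comment> \<open>The cover is taken at an exponent \<open>\<beta>'\<close> below
    \<open>\<beta>\<close>: for small radii the gain \<open>r powr (\<beta> - \<beta>')\<close>
    makes up for the factor \<open>2 powr \<beta>\<close> and the small weight \<open>1 - q\<close>
    of the added masses; \<open>t\<close> is the threshold for this gain.\<close>
  define \<beta>' where "\<beta>' = (\<gamma> + \<beta>) / 2"
  have \<beta>': "\<gamma> < \<beta>'" "\<beta>' < \<beta>" using \<open>\<gamma> < \<beta>\<close> by (auto simp: \<beta>'_def)
  define t where "t = (1 - q) / 2 powr \<beta>"
  have "0 < t" using q by (simp add: t_def)
  define \<epsilon> where "\<epsilon> = min (min \<delta> 1) (t powr (1 / (\<beta> - \<beta>')))"
  have "0 < \<epsilon>" "\<epsilon> \<le> \<delta>" "\<epsilon> \<le> 1" using \<open>0 < \<delta>\<close> \<open>0 < t\<close> by (auto simp: \<epsilon>_def)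
  have small: "(2 * r) powr \<beta> < (1 - q) * r powr \<beta>'" if r: "0 < r" "r < \<epsilon>" for r
  proof -
    have "r powr (\<beta> - \<beta>') < (t powr (1 / (\<beta> - \<beta>'))) powr (\<beta> - \<beta>')"
      using r \<beta>' by (intro powr_less_mono2) (auto simp: \<epsilon>_def)
    also have "\<dots> = t" using \<beta>' \<open>0 < t\<close> by (simp add: powr_powr)
    finally have "2 powr \<beta> * r powr (\<beta> - \<beta>') < 1 - q" by (simp add: t_def field_simps)
    then have "2 powr \<beta> * r powr (\<beta> - \<beta>') * r powr \<beta>' < (1 - q) * r powr \<beta>'"
      using r by (intro mult_strict_right_mono) auto
    moreover have "r powr (\<beta> - \<beta>') * r powr \<beta>' = r powr \<beta>" by (simp add: powr_add[symmetric])
    ultimately show ?thesis using r by (simp add: powr_mult mult.assoc)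
  qed
  obtain Y where Y: "finite Y" "Y \<subseteq> K \<times> {0<..<\<epsilon>}" "E \<subseteq> (\<Union>(x, r)\<in>Y. ball x r)"
      "(\<Sum>(x, r)\<in>Y. r powr \<beta>') \<le> \<epsilon>"
    by (rule ball_coverableE[OF cov[OF \<beta>'(1)] \<open>0 < \<epsilon>\<close>])
  have Y_\<delta>: "Y \<subseteq> K \<times> {0<..<\<delta>}" using Y(2) \<open>\<epsilon> \<le> \<delta>\<close> by auto
  show ?thesis
  \<comment> \<open>An empty cover has no weights to normalise, but then \<open>E\<close> is empty
    and \<open>\<mu>\<close> itself serves.\<close>
  proof (cases "Y = {}")
    case True
    then have "\<mu> \<in> ball_charged K E \<beta> \<delta>"
      using \<mu> Y(3) unfolding ball_charged_def by (auto intro!: exI[of _ "{}"])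
    moreover have "q * measure \<mu> A \<le> measure \<mu> A" for A using q by (simp add: mult_left_le_one_le)
    ultimately show ?thesis by blast
  next
    case False
    have "Y \<subseteq> K \<times> {0<..}" using Y(2) by auto
    then obtain \<kappa> where \<kappa>: "\<kappa> \<in> borel_prob_measures K"
        "\<And>x r. (x, r) \<in> Y \<Longrightarrow> r powr \<beta>' \<le> measure \<kappa> (ball x r \<inter> K)"
      using atomic_borel_prob[OF Y(1) False, of K \<beta>'] Y(4) \<open>\<epsilon> \<le> 1\<close> by fastforce
    obtain \<nu> where \<nu>: "\<nu> \<in> borel_prob_measures K"
        "\<And>A. A \<in> sets \<mu> \<Longrightarrow> measure \<nu> A = q * measure \<mu> A + (1 - q) * measure \<kappa> A"
      using borel_prob_mixture[OF \<mu> \<kappa>(1), of q] q by auto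
    have "(2 * r) powr \<beta> < measure \<nu> (ball x r \<inter> K)" if p: "(x, r) \<in> Y" for x r
    proof -
      have "(2 * r) powr \<beta> < (1 - q) * r powr \<beta>'" using p Y(2) by (intro small) auto
      also have "\<dots> \<le> (1 - q) * measure \<kappa> (ball x r \<inter> K)"
        using \<kappa>(2)[OF p] q by (intro mult_left_mono) auto
      also have "\<dots> \<le> measure \<nu> (ball x r \<inter> K)"
        using \<nu>(2)[OF ball_Int_sets[OF \<mu>]] q by simp
      finally show ?thesis .
    qed
    then have "\<nu> \<in> ball_charged K E \<beta> \<delta>"
      unfolding ball_charged_def using \<nu>(1) Y(1,3) Y_\<delta> by blast
    moreover have "q * measure \<mu> A \<le> measure \<nu> A" if "A \<in> sets \<mu>" for A
      using \<nu>(2)[OF that] q by simp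
    ultimately show ?thesis by blast
  qed
qed

lemma lower_local_dim_ball_charged:
  assumes charged: "\<And>n::nat. \<mu> \<in> ball_charged K E \<beta> (1 / Suc n)" and y: "y \<in> E"
  shows "lower_local_dim \<mu> y \<le> ereal \<beta>"
proof (rule lower_local_dim_leI)
  fix \<delta> :: real assume "0 < \<delta>"
  then obtain n where n: "1 / real (Suc n) < \<delta> / 2"
    using reals_Archimedean[of "\<delta> / 2"] by (auto simp: inverse_eq_divide)
  have \<mu>: "\<mu> \<in> borel_prob_measures K" using charged[of n] by (simp add: ball_charged_def)
  interpret prob_space \<mu> by (rule borel_prob_measuresD(1)[OF \<mu>])
  obtain Y where Y: "Y \<subseteq> K \<times> {0<..<1 / Suc n}" "E \<subseteq> (\<Union>(x, r)\<in>Y. ball x r)"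
      "\<forall>(x, r)\<in>Y. (2 * r) powr \<beta> < measure \<mu> (ball x r \<inter> K)"
    using charged[of n] unfolding ball_charged_def by blast
  obtain x r where p: "(x, r) \<in> Y" "y \<in> ball x r" using Y(2) y by blast
  have r: "0 < r" "r < 1 / Suc n" using p(1) Y(1) by auto
  have "ball x r \<subseteq> ball y (2 * r)"
  proof
    fix z assume "z \<in> ball x r"
    then show "z \<in> ball y (2 * r)"
      using p(2) dist_triangle[of y z x] by (simp add: dist_commute)
  qed
  then have "measure \<mu> (ball x r \<inter> K) \<le> measure \<mu> (ball y (2 * r) \<inter> K)"
    using ball_Int_sets[OF \<mu>] by (intro finite_measure_mono) auto
  moreover have "(2 * r) powr \<beta> < measure \<mu> (ball x r \<inter> K)" using Y(3) p(1) by blast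
  ultimately show "\<exists>r. 0 < r \<and> r < \<delta> \<and> r powr \<beta> < measure \<mu> (ball y r \<inter> space \<mu>)"
    using r n borel_prob_measuresD(3)[OF \<mu>] by (intro exI[of _ "2 * r"]) auto
qed

lemma typical_lower_local_dim:
  fixes \<E> :: "('a::metric_space set \<times> real) set"
  assumes "countable \<E>" and cov: "\<And>E \<gamma> \<beta>. (E, \<gamma>) \<in> \<E> \<Longrightarrow> \<gamma> < \<beta> \<Longrightarrow> ball_coverable K \<beta> E"
  shows "typical_in (weak_topology K) (\<lambda>\<mu>. \<mu> \<in> borel_prob_measures K \<and>
    (\<forall>(E, \<gamma>)\<in>\<E>. \<forall>x\<in>E. lower_local_dim \<mu> x \<le> ereal \<gamma>))"
proof (cases "\<E> = {}")
  case True
  then show ?thesis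
    unfolding typical_in_def
    by (intro exI[of _ "topspace (weak_topology K)"]) (auto simp: topspace_weak_topology[symmetric])
next
  case False
  define I where "I = \<E> \<times> (UNIV :: nat set) \<times> (UNIV :: nat set)"
  have I: "countable I" "I \<noteq> {}" using False assms(1) by (auto simp: I_def)
  \<comment> \<open>Covers exist only at exponents above \<open>\<gamma>\<close>, which is therefore
    approached through \<open>\<gamma> + 1 / Suc m\<close>; the index \<open>n\<close> sends the
    radii to 0.\<close>
  define B where "B = (\<lambda>((E, \<gamma>), m, n). ball_charged K E (\<gamma> + 1 / Suc m) (1 / Suc n))"
  define U where "U = (\<lambda>n. B (from_nat_into I n))"
  have mem: "from_nat_into I n \<in> I" for n using I(2) by (rule from_nat_into)
  have op: "openin (weak_topology K) (U n)" for n
    unfolding U_def B_def by (auto split: prod.split intro: openin_ball_charged)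
  have dense: "\<exists>\<nu>\<in>U n. \<forall>A\<in>sets \<mu>. q * measure \<mu> A \<le> measure \<nu> A"
    if "\<mu> \<in> borel_prob_measures K" "0 < q" "q < 1" for n \<mu> q
  proof -
    obtain E \<gamma> m k where eq: "from_nat_into I n = ((E, \<gamma>), m, k)" by (metis surj_pair)
    have "((E, \<gamma>), m, k) \<in> I" using mem[of n] unfolding eq .
    then have "(E, \<gamma>) \<in> \<E>" by (simp add: I_def)
    then show ?thesis
      unfolding U_def B_def eq using cov that by (auto intro!: ball_charged_dense)
  qed
  show ?thesis
    unfolding typical_in_def
  proof (intro exI[of _ "\<Inter>n. U n"] conjI)
    show "gdelta_in (weak_topology K) (\<Inter>n. U n)"
      using op by (intro gdelta_in_Inter) (auto intro: open_imp_gdelta_in)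
    show "weak_topology K closure_of (\<Inter>n. U n) = topspace (weak_topology K)"
      using op dense by (rule weak_topology_Baire)
    show "\<forall>\<mu>\<in>\<Inter>n. U n. \<mu> \<in> borel_prob_measures K \<and> (\<forall>(E, \<gamma>)\<in>\<E>. \<forall>x\<in>E. lower_local_dim \<mu> x \<le> ereal \<gamma>)"
    proof (rule ballI, rule conjI)
      fix \<mu> assume \<mu>: "\<mu> \<in> (\<Inter>n. U n)"
      then show "\<mu> \<in> borel_prob_measures K"
        using openin_subset[OF op[of 0]] by (auto simp: topspace_weak_topology)
      show "\<forall>(E, \<gamma>)\<in>\<E>. \<forall>x\<in>E. lower_local_dim \<mu> x \<le> ereal \<gamma>"
      proof (intro ballI, unfold split_paired_all split_conv, intro ballI)
        fix E \<gamma> x assume E: "(E, \<gamma>) \<in> \<E>" "x \<in> E"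
        have charged: "\<mu> \<in> ball_charged K E (\<gamma> + 1 / Suc m) (1 / Suc n)" for m n
        proof -
          have "((E, \<gamma>), m, n) \<in> I" using E by (simp add: I_def)
          then obtain k where "from_nat_into I k = ((E, \<gamma>), m, n)"
            using I(1) from_nat_into_surj by metis
          then show ?thesis using \<mu> unfolding U_def B_def by (auto dest!: spec[of _ k])
        qed
        have *: "lower_local_dim \<mu> x \<le> ereal (\<gamma> + 1 / Suc m)" for m
          using lower_local_dim_ball_charged[OF charged E(2)] .
        show "lower_local_dim \<mu> x \<le> ereal \<gamma>"
        proof (rule ereal_le_epsilon2)
          fix e :: real assume "0 < e"
          then obtain m where "1 / real (Suc m) < e"
            using reals_Archimedean[of e] by (auto simp: inverse_eq_divide)
          then have "ereal (\<gamma> + 1 / Suc m) \<le> ereal \<gamma> + ereal e" by simp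
          then show "lower_local_dim \<mu> x \<le> ereal \<gamma> + ereal e" using *[of m] order_trans by blast
        qed
      qed
    qed
  qed
qed

section \<open>One countable family for all exponents, and the conclusion\<close>

lemma typical_in_mono: "typical_in X P \<Longrightarrow> (\<And>\<mu>. P \<mu> \<Longrightarrow> Q \<mu>) \<Longrightarrow> typical_in X Q"
  unfolding typical_in_def by blast

text \<open>A chain built from \<open>t\<close> serves only exponents below \<open>t\<close>;
  positive rational \<open>t\<close> below the dimension reach every \<open>\<alpha>\<close> and
  keep the union countable.\<close>

lemma countable_coverable_family:
  fixes K :: "'a::euclidean_space set"
  assumes "compact K"
  obtains \<E> where "countable \<E>"
    "\<And>E \<gamma> \<beta>. (E, \<gamma>) \<in> \<E> \<Longrightarrow> \<gamma> < \<beta> \<Longrightarrow> ball_coverable K \<beta> E"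
    "\<And>\<alpha>. 0 \<le> \<alpha> \<Longrightarrow> ereal \<alpha> < hausdorff_dim K \<Longrightarrow>
      \<exists>Z\<subseteq>K. hausdorff_measure \<alpha> Z > 0 \<and> (\<forall>\<beta>>\<alpha>. \<exists>(E, \<gamma>)\<in>\<E>. \<gamma> < \<beta> \<and> Z \<subseteq> E)"
proof -
  define R where "R = {t\<in>\<rat>. 0 < t \<and> ereal t < hausdorff_dim K}"
  have "countable R" unfolding R_def using countable_rat by (rule countable_subset[rotated]) auto
  define P where "P = (\<lambda>t \<E>. countable \<E> \<and> (\<forall>(E, \<gamma>)\<in>\<E>. \<forall>\<beta>>\<gamma>. ball_coverable K \<beta> E)
    \<and> (\<forall>\<alpha>. 0 \<le> \<alpha> \<longrightarrow> \<alpha> < t \<longrightarrow>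
      (\<exists>Z\<subseteq>K. hausdorff_measure \<alpha> Z > 0 \<and> (\<forall>\<beta>>\<alpha>. \<exists>(E, \<gamma>)\<in>\<E>. \<gamma> < \<beta> \<and> Z \<subseteq> E))))"
  have "\<forall>t\<in>R. \<exists>\<E>. P t \<E>"
  proof
    fix t assume "t \<in> R"
    then have t: "0 < t" "hausdorff_measure t K > 0"
      using hausdorff_measure_less_dim[of t K] by (auto simp: R_def)
    obtain \<E> where "countable \<E>"
      "\<And>E \<gamma>. (E, \<gamma>) \<in> \<E> \<Longrightarrow> 0 \<le> \<gamma> \<and> (\<forall>\<beta>>\<gamma>. ball_coverable K \<beta> E)"
      "\<And>\<alpha>. 0 \<le> \<alpha> \<Longrightarrow> \<alpha> < t \<Longrightarrow> \<exists>Z\<subseteq>K. hausdorff_measure \<alpha> Z > 0 \<and> (\<forall>\<beta>>\<alpha>. \<exists>(E, \<gamma>)\<in>\<E>. \<gamma> < \<beta> \<and> Z \<subseteq> E)"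
      by (rule nested_coverable_sets[OF assms t]) (rule that)
    then show "\<exists>\<E>. P t \<E>" unfolding P_def by (intro exI[of _ \<E>]) auto
  qed
  then obtain \<E> where P: "\<forall>t\<in>R. P t (\<E> t)" unfolding bchoice_iff by (elim exE)
  have \<E>: "countable (\<E> t)" "\<forall>(E, \<gamma>)\<in>\<E> t. \<forall>\<beta>>\<gamma>. ball_coverable K \<beta> E"
    "\<forall>\<alpha>. 0 \<le> \<alpha> \<longrightarrow> \<alpha> < t \<longrightarrow>
      (\<exists>Z\<subseteq>K. hausdorff_measure \<alpha> Z > 0 \<and> (\<forall>\<beta>>\<alpha>. \<exists>(E, \<gamma>)\<in>\<E> t. \<gamma> < \<beta> \<and> Z \<subseteq> E))"
    if "t \<in> R" for t
    using bspec[OF P that] unfolding P_def by simp_all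
  show ?thesis
  proof (rule that[of "\<Union>t\<in>R. \<E> t"])
    show "countable (\<Union>t\<in>R. \<E> t)" using \<open>countable R\<close> \<E>(1) by blast
    show "ball_coverable K \<beta> E" if E: "(E, \<gamma>) \<in> (\<Union>t\<in>R. \<E> t)" "\<gamma> < \<beta>" for E \<gamma> \<beta>
    proof -
      obtain t where "t \<in> R" "(E, \<gamma>) \<in> \<E> t" using E(1) by blast
      then show ?thesis using bspec[OF \<E>(2)] E(2) by fast
    qed
    fix \<alpha> assume \<alpha>: "0 \<le> \<alpha>" "ereal \<alpha> < hausdorff_dim K"
    then obtain s where s: "ereal \<alpha> < ereal s" "ereal s < hausdorff_dim K" using ereal_dense2 by blast
    then obtain t where t: "t \<in> \<rat>" "\<alpha> < t" "t < s" using Rats_dense_in_real[of \<alpha> s] by auto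
    have "ereal t < hausdorff_dim K" using t(3) s(2) by (meson ereal_less(2) less_ereal.simps(1) less_trans)
    then have R: "t \<in> R" using t \<alpha> by (simp add: R_def)
    then obtain Z where Z: "Z \<subseteq> K" "hausdorff_measure \<alpha> Z > 0" "\<forall>\<beta>>\<alpha>. \<exists>(E, \<gamma>)\<in>\<E> t. \<gamma> < \<beta> \<and> Z \<subseteq> E"
      using \<E>(3)[OF R, rule_format, OF \<alpha>(1) t(2)] by (elim exE conjE)
    have "\<exists>(E, \<gamma>)\<in>(\<Union>t\<in>R. \<E> t). \<gamma> < \<beta> \<and> Z \<subseteq> E" if "\<alpha> < \<beta>" for \<beta>
      using Z(3)[rule_format, OF that] R by blast
    then show "\<exists>Z\<subseteq>K. hausdorff_measure \<alpha> Z > 0 \<and> (\<forall>\<beta>>\<alpha>. \<exists>(E, \<gamma>)\<in>(\<Union>t\<in>R. \<E> t). \<gamma> < \<beta> \<and> Z \<subseteq> E)"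
      using Z(1,2) by (intro exI[of _ Z] conjI allI impI)
  qed
qed

lemma hausdorff_dim_lower_level_set_of_family:
  fixes K :: "'a::euclidean_space set"
  assumes \<mu>: "\<mu> \<in> borel_prob_measures K" "\<forall>(E, \<gamma>)\<in>\<E>. \<forall>x\<in>E. lower_local_dim \<mu> x \<le> ereal \<gamma>"
    and "0 \<le> \<alpha>" and Z: "Z \<subseteq> K" "hausdorff_measure \<alpha> Z > 0"
    and \<E>: "\<And>\<beta>. \<alpha> < \<beta> \<Longrightarrow> \<exists>(E, \<gamma>)\<in>\<E>. \<gamma> < \<beta> \<and> Z \<subseteq> E"
  shows "hausdorff_dim (lower_level_set K \<mu> \<alpha>) = ereal \<alpha>"
proof (rule hausdorff_dim_lower_level_set[OF \<mu>(1) \<open>0 \<le> \<alpha>\<close> Z])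
  fix x assume "x \<in> Z"
  show "lower_local_dim \<mu> x \<le> ereal \<alpha>"
  proof (rule ereal_le_epsilon2)
    fix e :: real assume "0 < e"
    then obtain E \<gamma> where "(E, \<gamma>) \<in> \<E>" "\<gamma> < \<alpha> + e" "Z \<subseteq> E" using \<E>[of "\<alpha> + e"] by auto
    then have "lower_local_dim \<mu> x \<le> ereal \<gamma>" using \<mu>(2) \<open>x \<in> Z\<close> by blast
    also have "\<dots> \<le> ereal \<alpha> + ereal e" using \<open>\<gamma> < \<alpha> + e\<close> by simp
    finally show "lower_local_dim \<mu> x \<le> ereal \<alpha> + ereal e" .
  qed
qed

theorem theorem1p1:
  fixes K :: "'a::euclidean_space set"
  assumes "compact K"
  shows "typical_in (weak_topology K)
           (\<lambda>\<mu>. \<forall>\<alpha>. 0 \<le> \<alpha> \<and> ereal \<alpha> < hausdorff_dim K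
                  \<longrightarrow> hausdorff_dim (lower_level_set K \<mu> \<alpha>) = ereal \<alpha>)
       \<and> (\<forall>s. hausdorff_dim K = ereal s \<and> hausdorff_measure s K > 0
            \<longrightarrow> typical_in (weak_topology K)
                  (\<lambda>\<mu>. \<forall>\<alpha>\<in>{0..s}. hausdorff_dim (lower_level_set K \<mu> \<alpha>) = ereal \<alpha>))"
proof -
  obtain \<E> where \<E>: "countable \<E>"
    "\<And>E \<gamma> \<beta>. (E, \<gamma>) \<in> \<E> \<Longrightarrow> \<gamma> < \<beta> \<Longrightarrow> ball_coverable K \<beta> E"
    "\<And>\<alpha>. 0 \<le> \<alpha> \<Longrightarrow> ereal \<alpha> < hausdorff_dim K \<Longrightarrow>
      \<exists>Z\<subseteq>K. hausdorff_measure \<alpha> Z > 0 \<and> (\<forall>\<beta>>\<alpha>. \<exists>(E, \<gamma>)\<in>\<E>. \<gamma> < \<beta> \<and> Z \<subseteq> E)"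
    by (rule countable_coverable_family[OF assms]) (rule that)
  have below: "hausdorff_dim (lower_level_set K \<mu> \<alpha>) = ereal \<alpha>"
    if \<mu>: "\<mu> \<in> borel_prob_measures K" "\<forall>(E, \<gamma>)\<in>\<E>. \<forall>x\<in>E. lower_local_dim \<mu> x \<le> ereal \<gamma>"
      and \<alpha>: "0 \<le> \<alpha>" "ereal \<alpha> < hausdorff_dim K" for \<mu> \<alpha>
  proof -
    obtain Z where "Z \<subseteq> K" "hausdorff_measure \<alpha> Z > 0" "\<forall>\<beta>>\<alpha>. \<exists>(E, \<gamma>)\<in>\<E>. \<gamma> < \<beta> \<and> Z \<subseteq> E"
      using \<E>(3)[OF \<alpha>] by blast
    then show ?thesis using hausdorff_dim_lower_level_set_of_family[OF \<mu> \<alpha>(1)] by blast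
  qed
  show ?thesis
  proof (intro conjI allI impI)
    show "typical_in (weak_topology K) (\<lambda>\<mu>. \<forall>\<alpha>. 0 \<le> \<alpha> \<and> ereal \<alpha> < hausdorff_dim K
        \<longrightarrow> hausdorff_dim (lower_level_set K \<mu> \<alpha>) = ereal \<alpha>)"
      using typical_lower_local_dim[OF \<E>(1,2)] by (rule typical_in_mono) (use below in blast)+
    fix s assume s: "hausdorff_dim K = ereal s \<and> hausdorff_measure s K > 0"
    have "0 \<le> hausdorff_dim K" unfolding hausdorff_dim_def by (rule INF_greatest) auto
    then have "0 \<le> s" using s by simp
    \<comment> \<open>No starting exponent above \<open>s\<close> exists, so \<open>K\<close> itself
      joins the family with exponent \<open>s\<close>: it is null, hence coverable, at every
      \<open>\<beta> > s\<close>.\<close>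
    have "ball_coverable K \<beta> E" if "(E, \<gamma>) \<in> insert (K, s) \<E>" "\<gamma> < \<beta>" for E \<gamma> \<beta>
    proof (cases "(E, \<gamma>) = (K, s)")
      case True
      then have "hausdorff_measure \<beta> K = 0" "0 \<le> \<beta>"
        using that(2) s \<open>0 \<le> s\<close> by (auto intro: hausdorff_measure_greater_dim)
      then show ?thesis using True ball_coverable_null[OF assms order_refl] by simp
    next
      case False
      then show ?thesis using \<E>(2) that by blast
    qed
    then have "typical_in (weak_topology K) (\<lambda>\<mu>. \<mu> \<in> borel_prob_measures K \<and>
        (\<forall>(E, \<gamma>)\<in>insert (K, s) \<E>. \<forall>x\<in>E. lower_local_dim \<mu> x \<le> ereal \<gamma>))"
      using \<E>(1) by (intro typical_lower_local_dim) auto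
    then show "typical_in (weak_topology K)
        (\<lambda>\<mu>. \<forall>\<alpha>\<in>{0..s}. hausdorff_dim (lower_level_set K \<mu> \<alpha>) = ereal \<alpha>)"
    proof (rule typical_in_mono, intro ballI)
      fix \<mu> \<alpha> assume \<mu>: "\<mu> \<in> borel_prob_measures K \<and>
          (\<forall>(E, \<gamma>)\<in>insert (K, s) \<E>. \<forall>x\<in>E. lower_local_dim \<mu> x \<le> ereal \<gamma>)" and \<alpha>: "\<alpha> \<in> {0..s}"
      show "hausdorff_dim (lower_level_set K \<mu> \<alpha>) = ereal \<alpha>"
      proof (cases "\<alpha> = s")
        case True
        then show ?thesis
          using \<mu> s \<alpha> by (intro hausdorff_dim_lower_level_set[of _ _ _ K]) auto
      next
        case False
        then show ?thesis using \<mu> \<alpha> s by (intro below) auto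
      qed
    qed
  qed
qed

end
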